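(* Let $n\ge1$, let $\alpha=(\alpha_1,\dots,\alpha_n)$ with $\alpha_i>0$ for all $i$, and let $\beta=(1/2,\dots,1/2)+\alpha$. There exist positive constants $A,B$ (depending only on $n$ and $\alpha$) such that for all $f\in\mathcal S(\mathbf R^n)$ and all $x\in\mathbf R^n$, $$A\,\mu_\alpha(f)(x)\le h_\beta\big((H\otimes\cdots\otimes H)(f)\big)(x)\le B\,\mu_\alpha(f)(x).$$
   Context: $\mathcal S(\mathbf R^n)$ is the Schwartz space and $\hat f(\xi)=\int_{\mathbf R^n} f(x)e^{-2\pi i x\cdot\xi}\,dx$. The $n$-fold tensor product of the Hilbert transform, $H\otimes\cdots\otimes H$, is given by $\big((H\otimes\cdots\otimes H)f\big)^{\wedge}(\xi)=\prod_{j=1}^n(-i\,\mathrm{sgn}(\xi_j))\,\hat f(\xi)$. For $\beta=(\beta_1,\dots,\beta_n)$, $\beta_i>0$, and $R=(R_1,\dots,R_n)$, $R_i>0$, put $$\tau_R^\beta(g)(x)=\int_{-R_1}^{R_1}\cdots\int_{-R_n}^{R_n}\prod_{i=1}^n\left[\beta_i\frac{|\xi_i|}{R_i}\left(1-\frac{|\xi_i|}{R_i}\right)^{\beta_i-1}\right]\hat g(\xi)e^{2\pi i x\cdot\xi}\,d\xi,$$ $$h_\beta(g)(x)=\left(\int_0^\infty\cdots\int_0^\infty|\tau_R^\beta(g)(x)|^2\,\frac{dR_1}{R_1}\cdots\frac{dR_n}{R_n}\right)^{1/2}.$$ For $a>0$ let $\varphi^{(a)}(x)=a\,|1-|x||^{a-1}(\chi_{[0,1]}(x)-\chi_{[-1,0]}(x))$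 on $\mathbf R$ and $\varphi^{(a)}_s(x)=s^{-1}\varphi^{(a)}(x/s)$ for $s>0$. For $t=(t_1,\dots,t_n)$, $t_i>0$, put $\Phi_t^{(\alpha)}(x)=\prod_{i=1}^n\varphi^{(\alpha_i)}_{t_i}(x_i)$, $S_t^\alpha(f)=f\star\Phi_t^{(\alpha)}$ and $$\mu_\alpha(f)(x)=\left(\int_0^\infty\cdots\int_0^\infty|S_t^\alpha(f)(x)|^2\,\frac{dt_1}{t_1}\cdots\frac{dt_n}{t_n}\right)^{1/2}.$$ *)

theory Defs
  imports "HOL-Analysis.Analysis"
begin

definition partial_deriv :: "'n::finite \<Rightarrow> (real^'n \<Rightarrow> complex) \<Rightarrow> real^'n \<Rightarrow> complex" where
  "partial_deriv i f = (\<lambda>x. frechet_derivative f (at x) (axis i 1))"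

text \<open>A list of indices encodes an iterated partial derivative, one entry per differentiation.\<close>

definition partial_derivs :: "'n::finite list \<Rightarrow> (real^'n \<Rightarrow> complex) \<Rightarrow> real^'n \<Rightarrow> complex" where
  "partial_derivs is f = foldr partial_deriv is f"

definition schwartz_space :: "(real^'n::finite \<Rightarrow> complex) set" where
  "schwartz_space = {f.
     (\<forall>is x. partial_derivs is f differentiable (at x)) \<and>
     (\<forall>is k. \<exists>C. \<forall>x. norm x ^ k * norm (partial_derivs is f x) \<le> C)}"

definition fourier :: "(real^'n::finite \<Rightarrow> complex) \<Rightarrow> real^'n \<Rightarrow> complex" where
  "fourier f \<xi> = (LINT x|lborel. f x * cis (- (2 * pi * (x \<bullet> \<xi>))))"

text \<open>
  The image of a Schwartz function under the tensor product of Hilbert transforms is in general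
  not integrable, but it is in \<open>L\<^sup>2\<close>. Its Fourier transform is therefore the one of Plancherel's
  theorem: the \<open>L\<^sup>2\<close> limit of the Fourier integrals of the truncations to balls,
  which is determined up to null sets.
\<close>

definition square_integrable :: "(real^'n::finite \<Rightarrow> complex) \<Rightarrow> bool" where
  "square_integrable g \<longleftrightarrow>
     g \<in> borel_measurable borel \<and> (\<integral>\<^sup>+x. ennreal ((norm (g x))\<^sup>2) \<partial>lborel) < \<infinity>"

definition has_fourier_L2 :: "(real^'n::finite \<Rightarrow> complex) \<Rightarrow> (real^'n \<Rightarrow> complex) \<Rightarrow> bool" where
  "has_fourier_L2 g G \<longleftrightarrow> square_integrable g \<and> square_integrable G \<and>
     (\<lambda>k::nat. \<integral>\<^sup>+\<xi>. ennreal ((norm (fourier (\<lambda>x. indicator (cball 0 (real k)) x * g x) \<xi> - G \<xi>))\<^sup>2)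
        \<partial>lborel) \<longlonglongrightarrow> 0"

definition fourier_L2 :: "(real^'n::finite \<Rightarrow> complex) \<Rightarrow> real^'n \<Rightarrow> complex" where
  "fourier_L2 g = (SOME G. has_fourier_L2 g G)"

text \<open>
  The \<open>L\<^sup>2\<close> function with Fourier transform \<open>\<Prod>\<^sub>j (-i sgn \<xi>\<^sub>j) f^(\<xi>)\<close>; it is unique up to null sets,
  which do not affect \<open>fourier_L2\<close> of it, nor the integrals below.
\<close>

definition hilbert_tensor :: "(real^'n::finite \<Rightarrow> complex) \<Rightarrow> real^'n \<Rightarrow> complex" where
  "hilbert_tensor f =
     (SOME g. has_fourier_L2 g (\<lambda>\<xi>. (\<Prod>j\<in>UNIV. - \<i> * complex_of_real (sgn (\<xi> $ j))) * fourier f \<xi>))"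

definition positive_orthant :: "(real^'n::finite) set" where
  "positive_orthant = {t. \<forall>i. 0 < t $ i}"

definition ennsqrt :: "ennreal \<Rightarrow> ennreal" where
  "ennsqrt u = (if u = \<infinity> then \<infinity> else ennreal (sqrt (enn2real u)))"

text \<open>
  The square root of \<open>\<integral>\<dots>\<integral> |F(t)|\<^sup>2 dt\<^sub>1/t\<^sub>1 \<dots> dt\<^sub>n/t\<^sub>n\<close> over \<open>(0,\<infinity>)\<^sup>n\<close>, with values in \<open>[0,\<infinity>]\<close>.
\<close>

definition square_function :: "(real^'n::finite \<Rightarrow> complex) \<Rightarrow> ennreal" where
  "square_function F =
     ennsqrt (\<integral>\<^sup>+t\<in>positive_orthant. ennreal ((norm (F t))\<^sup>2 / (\<Prod>i\<in>UNIV. t $ i)) \<partial>lborel)"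

text \<open>
  The conventions \<open>0 powr a = 0\<close> and \<open>0 powr 0 = 0\<close> only matter on null sets here and in \<open>phi\<close>.
\<close>

definition tau :: "real^'n::finite \<Rightarrow> real^'n \<Rightarrow> (real^'n \<Rightarrow> complex) \<Rightarrow> real^'n \<Rightarrow> complex" where
  "tau \<beta> R g x =
     (LINT \<xi>:{\<xi>. \<forall>i. - (R $ i) \<le> \<xi> $ i \<and> \<xi> $ i \<le> R $ i}|lborel.
        complex_of_real
          (\<Prod>i\<in>UNIV. \<beta> $ i * (\<bar>\<xi> $ i\<bar> / R $ i) * (1 - \<bar>\<xi> $ i\<bar> / R $ i) powr (\<beta> $ i - 1))
        * fourier_L2 g \<xi> * cis (2 * pi * (x \<bullet> \<xi>)))"

definition h_func :: "real^'n::finite \<Rightarrow> (real^'n \<Rightarrow> complex) \<Rightarrow> real^'n \<Rightarrow> ennreal" where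
  "h_func \<beta> g x = square_function (\<lambda>R. tau \<beta> R g x)"

definition phi :: "real \<Rightarrow> real \<Rightarrow> real" where
  "phi a x = a * \<bar>1 - \<bar>x\<bar>\<bar> powr (a - 1) * (indicator {0..1} x - indicator {-1..0} x)"

definition phi_dil :: "real \<Rightarrow> real \<Rightarrow> real \<Rightarrow> real" where
  "phi_dil a s x = phi a (x / s) / s"

definition Phi :: "real^'n::finite \<Rightarrow> real^'n \<Rightarrow> real^'n \<Rightarrow> real" where
  "Phi \<alpha> t x = (\<Prod>i\<in>UNIV. phi_dil (\<alpha> $ i) (t $ i) (x $ i))"

definition S_op :: "real^'n::finite \<Rightarrow> real^'n \<Rightarrow> (real^'n \<Rightarrow> complex) \<Rightarrow> real^'n \<Rightarrow> complex" where
  "S_op \<alpha> t f x = (LINT y|lborel. f (x - y) * complex_of_real (Phi \<alpha> t y))"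

definition mu_func :: "real^'n::finite \<Rightarrow> (real^'n \<Rightarrow> complex) \<Rightarrow> real^'n \<Rightarrow> ennreal" where
  "mu_func \<alpha> f x = square_function (\<lambda>t. S_op \<alpha> t f x)"

end

(*
  The Mellin transform turns both square functions into weighted L^2 norms of one function.
  With E(xi) = f^(xi) e^(2 pi i x.xi), Fourier inversion gives
    S_t f(x) = (-i)^n int E(xi) prod_j s_j(t_j xi_j) dxi,
    tau_R (H f)(x) = (-i)^n int E(xi) prod_j m_j(xi_j / R_j) dxi,
  where s_j is the sine transform of phi^(alpha_j) and m_j(r) = beta_j r (1 - |r|)_+^(beta_j - 1).
  Expanding the square and integrating first over t (or R), the one-dimensional inversion
  formula in logarithmic coordinates, applied to the autocorrelation of s_j (or m_j), gives
    mu(f)(x)^2 = int prod_j |s_j~(l_j)|^2 |M(l)|^2 dl,   h(Hf)(x)^2 = int prod_j |m_j~(l_j)|^2 |M(l)|^2 dl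
  with s~, m~ the Mellin transforms on the imaginary axis and the same M, the Mellin transform
  of the part of E that is odd in each coordinate.
  It remains to compare |s~| with |m~| in one variable. Testing the sine transform against
  x exp(-pi x^2), which it fixes, gives
    |s~(l)| |Gamma(1 + i pi l)| = sqrt pi |riesz_alpha~(l)| |Gamma(1/2 + i pi l)|,
  and the Beta integral expresses riesz_a~(l) as a quotient of Gamma functions. Since
  beta = alpha + 1/2, only quotients |Gamma(z + 1/2)| / |Gamma(z)| remain, and these are
  comparable with |z|^(1/2).
*)

theory Submission
  imports Defs "HOL-Probability.Probability"
begin

section \<open>Integrals of products and the Fourier integral\<close>

text \<open>Every interchange of integrals is absolute. The kernels depend on t xi or xi / R alone,
  so their L^2 norms in dt/t are the same for all nonzero frequencies. This dominates the expanded
  square by a multiple of |E(xi) E(eta)| and shows that both square functions are finite. The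
  delicate point is inversion for the autocorrelation. For beta < 1 the Riesz kernel is unbounded at
  r = 1; its square is integrable there exactly because beta > 1/2. Inversion is therefore proved
  pointwise, where continuity of the autocorrelation is established; this leaves out |xi_i| =
  |eta_i|, a null set. As the transform of an autocorrelation is nonnegative, it is integrable as
  soon as the autocorrelation is bounded. The Hilbert transform of f is in general only in L^2 and
  is given by choice, so its Plancherel transform must be identified almost everywhere before
  \<open>tau\<close> can be computed. The shift by 1/2 is forced: Gamma(1/2 + i pi l) / Gamma(1 + i
  pi l) has size |l|^(-1/2) for large |l|, and raising the order of the Riesz kernel by 1/2 changes
  its Mellin transform by the same power.\<close>

lemma
  fixes f :: "'a::euclidean_space \<Rightarrow> real \<Rightarrow> 'b::{real_normed_field,banach,second_countable_topology}"
  assumes f: "\<And>b. b \<in> Basis \<Longrightarrow> integrable lborel (f b)"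
  shows integrable_lborel_prod_Basis: "integrable lborel (\<lambda>x. \<Prod>b\<in>Basis. f b (x \<bullet> b))"
    and integral_lborel_prod_Basis:
      "(LINT x|lborel. (\<Prod>b\<in>Basis. f b (x \<bullet> b))) = (\<Prod>b\<in>Basis. integral\<^sup>L lborel (f b))"
proof -
  interpret product_sigma_finite "\<lambda>_::'a. lborel :: real measure" ..
  have [measurable]: "f b \<in> borel_measurable borel" if "b \<in> Basis" for b
    using borel_measurable_integrable[OF f[OF that]] by simp
  have eq: "(\<Prod>b\<in>Basis. f b ((\<Sum>b\<in>Basis. x b *\<^sub>R b) \<bullet> b)) = (\<Prod>b\<in>Basis. f b (x b))" for x
    by (rule prod.cong) auto
  have m: "(\<lambda>x::'a \<Rightarrow> real. \<Sum>b\<in>Basis. x b *\<^sub>R b) \<in> measurable (\<Pi>\<^sub>M b\<in>Basis. lborel) borel"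
    by measurable
  have mf: "(\<lambda>x::'a. \<Prod>b\<in>Basis. f b (x \<bullet> b)) \<in> borel_measurable borel"
    by measurable
  show "integrable lborel (\<lambda>x. \<Prod>b\<in>Basis. f b (x \<bullet> b))"
    unfolding lborel_eq[where 'a='a]
    by (subst integrable_distr_eq[OF m mf]) (simp only: eq, intro product_integrable_prod f finite_Basis)
  show "(LINT x|lborel. (\<Prod>b\<in>Basis. f b (x \<bullet> b))) = (\<Prod>b\<in>Basis. integral\<^sup>L lborel (f b))"
    unfolding lborel_eq[where 'a='a]
    by (subst integral_distr[OF m mf]) (simp only: eq, intro product_integral_prod f finite_Basis)
qed

lemma
  fixes f :: "'n::finite \<Rightarrow> real \<Rightarrow> 'b::{real_normed_field,banach,second_countable_topology}"
  assumes f: "\<And>i. integrable lborel (f i)"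
  shows integrable_lborel_prod_vec: "integrable lborel (\<lambda>x::real^'n. \<Prod>i\<in>UNIV. f i (x $ i))"
    and integral_lborel_prod_vec:
      "(LINT x::real^'n|lborel. (\<Prod>i\<in>UNIV. f i (x $ i))) = (\<Prod>i\<in>UNIV. integral\<^sup>L lborel (f i))"
proof -
  have inj: "inj (\<lambda>i::'n. axis i (1::real))"
    by (auto simp: inj_def axis_eq_axis)
  \<comment> \<open>The inverse of i -> \<open>axis i 1\<close> relabels the factors by basis
    vectors.\<close>
  define g where "g b = f (inv (\<lambda>i::'n. axis i (1::real)) b)" for b
  have g: "g (axis i 1) = f i" for i
    by (simp add: g_def inv_f_f[OF inj])
  have B: "Basis = range (\<lambda>i::'n. axis i (1::real))"
    by (auto simp: Basis_vec_def)
  have prod: "(\<Prod>b\<in>Basis. h b) = (\<Prod>i\<in>UNIV. h (axis i 1))" for h :: "real^'n \<Rightarrow> 'b"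
    unfolding B by (subst prod.reindex[OF inj]) simp
  have int: "integrable lborel (g b)" for b
    unfolding g_def by (rule f)
  show "integrable lborel (\<lambda>x::real^'n. \<Prod>i\<in>UNIV. f i (x $ i))"
    using integrable_lborel_prod_Basis[of g] int by (simp add: prod g inner_axis)
  show "(LINT x::real^'n|lborel. (\<Prod>i\<in>UNIV. f i (x $ i))) = (\<Prod>i\<in>UNIV. integral\<^sup>L lborel (f i))"
    using integral_lborel_prod_Basis[of g] int by (simp add: prod g inner_axis)
qed

section \<open>Affine changes of variable\<close>

lemma
  fixes f :: "'a::euclidean_space \<Rightarrow> 'b::{banach, second_countable_topology}"
  assumes c: "c \<noteq> 0"
  shows lborel_integrable_affine_iff:
      "integrable lborel (\<lambda>x. f (t + c *\<^sub>R x)) \<longleftrightarrow> integrable lborel f"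
    and lborel_integral_affine:
      "(LINT x|lborel. f x) = \<bar>c\<bar> ^ DIM('a) *\<^sub>R (LINT x|lborel. f (t + c *\<^sub>R x))"
proof -
  have one: "integrable lborel (\<lambda>x. f (t + c *\<^sub>R x))" if "integrable lborel f" "c \<noteq> 0" 
    for c t and f :: "'a \<Rightarrow> 'b"
  proof -
    have [measurable]: "f \<in> borel_measurable borel" using that(1) by auto
    from that(1) show ?thesis
      using integrable_scaleR_right[of "1 / \<bar>c\<bar> ^ DIM('a)" lborel "\<lambda>x. \<bar>c\<bar> ^ DIM('a) *\<^sub>R f (t + c *\<^sub>R x)"] that(2)
      by (subst (asm) lborel_affine[OF that(2), of t])
         (simp add: integrable_density integrable_distr_eq)
  qed
  show iff: "integrable lborel (\<lambda>x. f (t + c *\<^sub>R x)) \<longleftrightarrow> integrable lborel f"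
  proof
    assume "integrable lborel (\<lambda>x. f (t + c *\<^sub>R x))"
    from one[OF this, of "1/c" "- (1/c) *\<^sub>R t"] show "integrable lborel f"
      using c by (simp add: scaleR_right_distrib scaleR_right_diff_distrib)
  qed (rule one[OF _ c])
  show "(LINT x|lborel. f x) = \<bar>c\<bar> ^ DIM('a) *\<^sub>R (LINT x|lborel. f (t + c *\<^sub>R x))"
  proof cases
    assume f: "integrable lborel f"
    then have [measurable]: "f \<in> borel_measurable borel" by auto
    show ?thesis
      apply (subst lborel_affine[OF c, of t])
      using f iff by (simp add: integral_density integral_distr)
  next
    assume "\<not> integrable lborel f"
    with iff show ?thesis by (simp add: not_integrable_integral_eq)
  qed
qed

lemma
  fixes f :: "'a::euclidean_space \<Rightarrow> 'b::{banach, second_countable_topology}"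
  shows lborel_integrable_translate: "integrable lborel (\<lambda>x. f (x + t)) \<longleftrightarrow> integrable lborel f"
    and lborel_integral_translate: "(LINT x|lborel. f (x + t)) = (LINT x|lborel. f x)"
  using lborel_integrable_affine_iff[of 1 f t] lborel_integral_affine[of 1 f t]
  by (simp_all add: add.commute)

lemma
  fixes f :: "'a::euclidean_space \<Rightarrow> 'b::{banach, second_countable_topology}"
  shows lborel_integrable_reflect: "integrable lborel (\<lambda>x. f (t - x)) \<longleftrightarrow> integrable lborel f"
    and lborel_integral_reflect: "(LINT x|lborel. f (t - x)) = (LINT x|lborel. f x)"
  using lborel_integrable_affine_iff[of "-1" f t] lborel_integral_affine[of "-1" f t]
  by simp_all

text \<open>The integral of \<open>fourier\<close> on an arbitrary euclidean space: on
  \<open>real\<close> it also serves as the Mellin transform in logarithmic coordinates.\<close>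

definition ft :: "('a::euclidean_space \<Rightarrow> complex) \<Rightarrow> 'a \<Rightarrow> complex" where
  "ft h \<xi> = (LINT x|lborel. h x * cis (- (2 * pi * (x \<bullet> \<xi>))))"

lemma fourier_eq_ft: "fourier = ft"
  by (simp add: fun_eq_iff fourier_def ft_def)

lemma borel_measurable_cis [measurable (raw)]:
  assumes "f \<in> borel_measurable M" shows "(\<lambda>x. cis (f x)) \<in> borel_measurable M"
  unfolding cis_conv_exp using assms by (intro measurable_compose[OF _ borel_measurable_continuous_onI[of exp]]) (auto intro!: continuous_intros)

lemma integrable_mult_cis:
  assumes "integrable M f" "g \<in> borel_measurable M"
  shows "integrable M (\<lambda>x. f x * cis (g x))"
proof (rule Bochner_Integration.integrable_bound[OF assms(1)])
  show "(\<lambda>x. f x * cis (g x)) \<in> borel_measurable M"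
    using borel_measurable_integrable[OF assms(1)] assms(2) by measurable
qed (simp add: norm_mult)

lemma integrable_ft_integrand:
  assumes "integrable lborel h"
  shows "integrable lborel (\<lambda>x. h x * cis (- (2 * pi * (x \<bullet> \<xi>))))"
  by (rule integrable_mult_cis[OF assms]) measurable

lemma norm_ft_le: "norm (ft h \<xi>) \<le> (LINT x|lborel. norm (h x))"
  unfolding ft_def by (rule order_trans[OF integral_norm_bound]) (simp add: norm_mult)

lemma isCont_ft:
  assumes h: "integrable lborel h"
  shows "isCont (ft h) \<xi>"
  unfolding continuous_at_sequentially o_def
proof (intro allI impI)
  fix X assume X: "X \<longlonglongrightarrow> \<xi>"
  have [measurable]: "h \<in> borel_measurable borel" using h by auto
  show "(\<lambda>n. ft h (X n)) \<longlonglongrightarrow> ft h \<xi>"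
    unfolding ft_def
  proof (rule integral_dominated_convergence[where w="\<lambda>x. norm (h x)"])
    show "AE x in lborel. (\<lambda>i. h x * cis (- (2 * pi * (x \<bullet> X i)))) \<longlonglongrightarrow> h x * cis (- (2 * pi * (x \<bullet> \<xi>)))"
      by (intro AE_I2 tendsto_intros X)
  qed (use h in \<open>auto simp: norm_mult\<close>)
qed

lemma continuous_on_ft: "integrable lborel h \<Longrightarrow> continuous_on UNIV (ft h)"
  by (simp add: continuous_at_imp_continuous_on isCont_ft)

lemma borel_measurable_ft [measurable]: "integrable lborel h \<Longrightarrow> ft h \<in> borel_measurable borel"
  by (rule borel_measurable_continuous_onI[OF continuous_on_ft])

section \<open>The Gaussian as its own Fourier transform\<close>

lemma gaussian_ft_real:
  fixes y :: real
  shows "integrable lborel (\<lambda>x. complex_of_real (exp (- pi * x\<^sup>2)))"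
    and "(LINT x|lborel. complex_of_real (exp (- pi * x\<^sup>2)) * cis (- (2 * pi * (x * y)))) = exp (- pi * y\<^sup>2)"
proof -
  \<comment> \<open>Dilation by \<open>c\<close> turns the exponent x^2 / 2 of the standard normal
    density into pi x^2, and the Jacobian \<open>c\<close> cancels its normalisation. The
    characteristic function of the normal law then gives the transform.\<close>
  define c where "c = sqrt (2 * pi)"
  have c: "c > 0" "c\<^sup>2 = 2 * pi" by (auto simp: c_def)
  have "integrable lborel std_normal_density" by simp
  then have "integrable lborel (\<lambda>x. complex_of_real (std_normal_density x))" by simp
  then have "integrable lborel (\<lambda>x. complex_of_real (std_normal_density (0 + c * x)))"
    using c by (subst lborel_integrable_real_affine_iff) auto
  then have "integrable lborel (\<lambda>x. of_real c * complex_of_real (std_normal_density (0 + c * x)))"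
    by (intro integrable_mult_right)
  moreover have eq: "c * (std_normal_density (0 + c * x)) = exp (- pi * x\<^sup>2)" for x
    using c by (simp add: normal_density_def power_mult_distrib c_def[symmetric])
  ultimately show *: "integrable lborel (\<lambda>x. complex_of_real (exp (- pi * x\<^sup>2)))"
    by (simp flip: of_real_mult)
  have "exp (- pi * y\<^sup>2) = exp (- ((c * y)\<^sup>2) / 2)"
    using c by (simp add: power_mult_distrib)
  also have "complex_of_real \<dots> = char std_normal_distribution (- (c * y))"
    by (simp add: char_std_normal_distribution)
  also have "\<dots> = (LINT x|lborel. complex_of_real (std_normal_density x) * cis (- (c * y * x)))"
    unfolding char_def by (subst integral_density) (auto simp: scaleR_conv_of_real normal_density_nonneg cis_conv_exp field_simps)
  also have "\<dots> = (LINT x|lborel. complex_of_real (c * std_normal_density (0 + c * x)) * cis (- (c * y * (c * x))))"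
    using c by (subst lborel_integral_real_affine[where c=c and t=0])
      (simp_all add: scaleR_conv_of_real mult.assoc)
  also have "\<dots> = (LINT x|lborel. complex_of_real (exp (- pi * x\<^sup>2)) * cis (- (2 * pi * (x * y))))"
  proof -
    have "c * y * (c * x) = 2 * pi * (x * y)" for x
      using c(2) unfolding power2_eq_square by algebra
    then show ?thesis unfolding eq by (simp only:)
  qed
  finally show "(LINT x|lborel. complex_of_real (exp (- pi * x\<^sup>2)) * cis (- (2 * pi * (x * y)))) = exp (- pi * y\<^sup>2)" ..
qed

lemma cis_sum: "finite A \<Longrightarrow> cis (\<Sum>a\<in>A. f a) = (\<Prod>a\<in>A. cis (f a))"
  by (induction A rule: finite_induct) (auto simp: cis_mult[symmetric])

lemma exp_norm_eq_prod:
  "exp (- pi * (norm (x::'a::euclidean_space))\<^sup>2) = (\<Prod>b\<in>Basis. exp (- pi * (x \<bullet> b)\<^sup>2))"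
proof -
  have "(norm x)\<^sup>2 = (\<Sum>b\<in>Basis. (x \<bullet> b)\<^sup>2)"
    unfolding power2_norm_eq_inner by (subst euclidean_inner) (simp add: power2_eq_square)
  then show ?thesis
    by (simp add: exp_sum[symmetric] sum_distrib_left sum_negf)
qed

lemma
  fixes y :: "'a::euclidean_space"
  shows integrable_gaussian: "integrable lborel (\<lambda>x::'a. complex_of_real (exp (- pi * (norm x)\<^sup>2)))"
    and ft_gaussian: "ft (\<lambda>x::'a. complex_of_real (exp (- pi * (norm x)\<^sup>2))) y = exp (- pi * (norm y)\<^sup>2)"
proof -
  show int: "integrable lborel (\<lambda>x::'a. complex_of_real (exp (- pi * (norm x)\<^sup>2)))"
    unfolding exp_norm_eq_prod of_real_prod
    by (intro integrable_lborel_prod_Basis gaussian_ft_real)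
  have "ft (\<lambda>x::'a. complex_of_real (exp (- pi * (norm x)\<^sup>2))) y =
    (LINT x|lborel. (\<Prod>b\<in>Basis. complex_of_real (exp (- pi * (x \<bullet> b)\<^sup>2)) * cis (- (2 * pi * ((x \<bullet> b) * (y \<bullet> b))))))"
    unfolding ft_def exp_norm_eq_prod of_real_prod prod.distrib
    by (subst euclidean_inner) (simp add: cis_sum[symmetric] sum_distrib_left sum_negf)
  also have "\<dots> = (\<Prod>b\<in>Basis. complex_of_real (exp (- pi * (y \<bullet> b)\<^sup>2)))"
    by (subst integral_lborel_prod_Basis)
       (auto intro!: integrable_mult_cis gaussian_ft_real[simplified] prod.cong simp: gaussian_ft_real[simplified])
  finally show "ft (\<lambda>x::'a. complex_of_real (exp (- pi * (norm x)\<^sup>2))) y = exp (- pi * (norm y)\<^sup>2)"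
    by (simp only: exp_norm_eq_prod of_real_prod)
qed

section \<open>Fourier inversion and Plancherel\<close>

lemma borel_measurable_cnj [measurable (raw)]:
  "f \<in> borel_measurable M \<Longrightarrow> (\<lambda>x. cnj (f x)) \<in> borel_measurable M"
  by (rule measurable_compose[OF _ borel_measurable_continuous_onI[of cnj]]) (auto intro!: continuous_intros)

lemma (in pair_sigma_finite) integrable_pair_mult:
  fixes f g :: "_ \<Rightarrow> 'z::{real_normed_field,banach,second_countable_topology}"
  assumes f: "integrable M1 f" and g: "integrable M2 g"
  shows "integrable (M1 \<Otimes>\<^sub>M M2) (\<lambda>(x,y). f x * g y)"
proof (rule Fubini_integrable)
  have [measurable]: "f \<in> borel_measurable M1" "g \<in> borel_measurable M2"
    using f g by auto
  show "(\<lambda>(x,y). f x * g y) \<in> borel_measurable (M1 \<Otimes>\<^sub>M M2)"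
    by measurable
qed (use f g in \<open>auto simp: norm_mult\<close>)

lemma (in pair_sigma_finite) integrable_pair_mult_cis:
  assumes "integrable M1 f" "integrable M2 g" "case_prod \<phi> \<in> borel_measurable (M1 \<Otimes>\<^sub>M M2)"
  shows "integrable (M1 \<Otimes>\<^sub>M M2) (\<lambda>(x,y). f x * g y * cis (\<phi> x y))"
  using integrable_mult_cis[OF integrable_pair_mult[OF assms(1,2)] assms(3)]
  by (simp add: case_prod_unfold)

lemma integrable_gaussian_scaled:
  assumes "c \<noteq> 0"
  shows "integrable lborel (\<lambda>x::'a::euclidean_space. complex_of_real (exp (- pi * (norm (c *\<^sub>R x))\<^sup>2)))"
  using lborel_integrable_affine_iff[OF assms, of "\<lambda>x::'a. complex_of_real (exp (- pi * (norm x)\<^sup>2))" 0] integrable_gaussian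
  by simp

lemma ft_gaussian_scaled:
  assumes "c > 0"
  shows "ft (\<lambda>x::'a::euclidean_space. complex_of_real (exp (- pi * (norm (c *\<^sub>R x))\<^sup>2))) y =
    exp (- pi * (norm (y /\<^sub>R c))\<^sup>2) / c ^ DIM('a)"
proof -
  have "of_real (exp (- pi * (norm (y /\<^sub>R c))\<^sup>2)) = ft (\<lambda>x::'a. complex_of_real (exp (- pi * (norm x)\<^sup>2))) (y /\<^sub>R c)"
    by (simp only: ft_gaussian)
  also have "\<dots> = c ^ DIM('a) *\<^sub>R ft (\<lambda>x::'a::euclidean_space. complex_of_real (exp (- pi * (norm (c *\<^sub>R x))\<^sup>2))) y"
  proof -
    have *: "inverse c * (c * t) = t" for t using assms by simp
    show ?thesis
      using assms unfolding ft_def by (subst lborel_integral_affine[of c _ 0]) (auto simp: *)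
  qed
  finally show ?thesis
    using assms by (simp add: scaleR_conv_of_real field_simps)
qed

text \<open>The Gaussian factor makes the double integral absolutely convergent even if
  \<open>ft A\<close> is not integrable. After Fubini the inner integral is again a Gaussian, and
  the substitution y = x + c z yields the right-hand side.\<close>

lemma gaussian_regularization:
  fixes A :: "'a::euclidean_space \<Rightarrow> complex"
  assumes A: "integrable lborel A" and c: "c > 0"
  shows "(LINT \<xi>|lborel. ft A \<xi> * exp (- pi * (norm (c *\<^sub>R \<xi>))\<^sup>2) * cis (2 * pi * (x \<bullet> \<xi>))) =
    (LINT z|lborel. A (x + c *\<^sub>R z) * exp (- pi * (norm z)\<^sup>2))" (is "?L = ?R")
proof -
  let ?g = "\<lambda>\<xi>::'a. complex_of_real (exp (- pi * (norm (c *\<^sub>R \<xi>))\<^sup>2))"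
  have g: "integrable lborel ?g" using c integrable_gaussian_scaled[of c] by simp
  have "?L = (LINT \<xi>|lborel. (LINT y|lborel. A y * ?g \<xi> * cis (- (2 * pi * ((y - x) \<bullet> \<xi>)))))"
  proof -
    have "cis (- (2 * pi * ((y - x) \<bullet> \<xi>))) = cis (- (2 * pi * (y \<bullet> \<xi>))) * cis (2 * pi * (x \<bullet> \<xi>))" for y \<xi>
      by (simp add: cis_mult inner_diff_left algebra_simps)
    moreover have "ft A \<xi> * ?g \<xi> * cis (2 * pi * (x \<bullet> \<xi>)) =
        (LINT y|lborel. A y * cis (- (2 * pi * (y \<bullet> \<xi>))) * (?g \<xi> * cis (2 * pi * (x \<bullet> \<xi>))))" for \<xi>
      unfolding ft_def by (subst integral_mult_left_zero) (rule mult.assoc)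
    ultimately show ?thesis
      by (intro Bochner_Integration.integral_cong refl) (simp only: mult_ac)
  qed
  also have "\<dots> = (LINT y|lborel. (LINT \<xi>|lborel. A y * ?g \<xi> * cis (- (2 * pi * ((y - x) \<bullet> \<xi>)))))"
    by (intro lborel_pair.Fubini_integral lborel_pair.integrable_pair_mult_cis A g) measurable
  also have "\<dots> = (LINT y|lborel. A y * ft ?g (y - x))"
    by (simp add: ft_def mult.assoc inner_commute)
  also have "\<dots> = (LINT y|lborel. A y * (exp (- pi * (norm ((y - x) /\<^sub>R c))\<^sup>2) / c ^ DIM('a)))"
    by (subst ft_gaussian_scaled[OF c]) simp
  also have "\<dots> = ?R"
    using c by (subst lborel_integral_affine[of c _ x]) (simp_all add: scaleR_conv_of_real)
  finally show ?thesis .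
qed

lemma gaussian_approx_tendsto:
  fixes A :: "'a::euclidean_space \<Rightarrow> complex"
  assumes A: "A \<in> borel_measurable borel" and B: "\<And>x. norm (A x) \<le> B" and cont: "isCont A x"
    and c: "c \<longlonglongrightarrow> 0"
  shows "(\<lambda>k. LINT z|lborel. A (x + c k *\<^sub>R z) * exp (- pi * (norm z)\<^sup>2)) \<longlonglongrightarrow> A x"
proof -
  note [measurable] = A
  have "(\<lambda>k. LINT z|lborel. A (x + c k *\<^sub>R z) * exp (- pi * (norm z)\<^sup>2)) \<longlonglongrightarrow> (LINT z|lborel. A x * complex_of_real (exp (- pi * (norm (z::'a))\<^sup>2)))"
  proof (rule integral_dominated_convergence[where w="\<lambda>z. B * exp (- pi * (norm z)\<^sup>2)"])
    show "integrable lborel (\<lambda>z::'a. B * exp (- pi * (norm z)\<^sup>2))"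
      using integrable_gaussian[where 'a='a] by (simp add: complex_of_real_integrable_eq)
    have "(\<lambda>k. A (x + c k *\<^sub>R z)) \<longlonglongrightarrow> A x" for z
    proof (rule isCont_tendsto_compose[OF cont])
      have "(\<lambda>k. x + c k *\<^sub>R z) \<longlonglongrightarrow> x + 0 *\<^sub>R z" by (intro tendsto_intros c)
      then show "(\<lambda>k. x + c k *\<^sub>R z) \<longlonglongrightarrow> x" by simp
    qed
    then show "AE z in lborel. (\<lambda>k. A (x + c k *\<^sub>R z) * exp (- pi * (norm z)\<^sup>2)) \<longlonglongrightarrow> A x * complex_of_real (exp (- pi * (norm z)\<^sup>2))"
      by (intro AE_I2 tendsto_intros)
  qed (auto simp: norm_mult B intro!: mult_right_mono)
  also have "(LINT z|lborel. A x * complex_of_real (exp (- pi * (norm (z::'a))\<^sup>2))) = A x"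
    using ft_gaussian[of "0::'a"] by (simp add: ft_def)
  finally show ?thesis .
qed

text \<open>At x = 0 the regularised formula bounds the integrals of \<open>P\<close> against wide
  Gaussians by \<open>B\<close>, whatever the width. Since \<open>P\<close> is nonnegative, Fatou's
  lemma carries the bound to \<open>P\<close> itself.\<close>

lemma integrable_ft_nonneg:
  fixes A :: "'a::euclidean_space \<Rightarrow> complex"
  assumes A: "integrable lborel A" and B: "\<And>x. norm (A x) \<le> B"
    and P: "\<And>\<xi>. ft A \<xi> = of_real (P \<xi>)" "\<And>\<xi>. P \<xi> \<ge> 0"
  shows "integrable lborel P"
proof -
  have Pm [measurable]: "P \<in> borel_measurable borel"
  proof -
    have "(\<lambda>\<xi>. Re (ft A \<xi>)) \<in> borel_measurable borel" using A by measurable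
    then show ?thesis by (simp add: P)
  qed
  have Pb: "P \<xi> \<le> (LINT x|lborel. norm (A x))" for \<xi>
    using norm_ft_le[of A \<xi>] P by simp
  define c where "c k = 1 / real (Suc k)" for k
  have c: "c k > 0" for k by (simp add: c_def)
  define e where "e k \<xi> = exp (- pi * (norm (c k *\<^sub>R \<xi>))\<^sup>2)" for k and \<xi> :: 'a
  have em [measurable]: "e k \<in> borel_measurable borel" for k unfolding e_def by measurable
  have e: "integrable lborel (\<lambda>\<xi>. complex_of_real (e k \<xi>))" for k
    unfolding e_def using integrable_gaussian_scaled[of "c k"] c[of k] by simp
  have g: "integrable lborel (\<lambda>z::'a. exp (- pi * (norm z)\<^sup>2))"
    using integrable_gaussian[where 'a='a] by (simp add: complex_of_real_integrable_eq)
  have Pe: "integrable lborel (\<lambda>\<xi>. P \<xi> * e k \<xi>)" for k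
  proof (rule Bochner_Integration.integrable_bound[where f="\<lambda>\<xi>. (LINT x|lborel. norm (A x)) * e k \<xi>"])
    show "integrable lborel (\<lambda>\<xi>. (LINT x|lborel. norm (A x)) * e k \<xi>)"
      using e[of k] by (simp add: complex_of_real_integrable_eq)
  qed (auto intro!: AE_I2 mult_right_mono simp: abs_mult P e_def intro: order_trans[OF Pb])
  have bd: "(LINT \<xi>|lborel. P \<xi> * e k \<xi>) \<le> B" for k
  proof -
    have "complex_of_real (LINT \<xi>|lborel. P \<xi> * e k \<xi>) = (LINT \<xi>|lborel. ft A \<xi> * of_real (e k \<xi>) * cis (2 * pi * (0 \<bullet> \<xi>)))"
      by (simp add: P flip: of_real_mult)
    also have "\<dots> = (LINT z|lborel. A (0 + c k *\<^sub>R z) * exp (- pi * (norm z)\<^sup>2))"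
      unfolding e_def by (rule gaussian_regularization[OF A c])
    also have "norm \<dots> \<le> (LINT z|lborel. norm (A (0 + c k *\<^sub>R z) * exp (- pi * (norm z)\<^sup>2)))"
      by (rule integral_norm_bound)
    also have "\<dots> \<le> (LINT z|lborel. B * exp (- pi * (norm (z::'a))\<^sup>2))"
    proof (rule integral_mono')
      show "integrable lborel (\<lambda>z::'a. B * exp (- pi * (norm z)\<^sup>2))"
        by (intro integrable_mult_right g)
    qed (use B order_trans[OF norm_ge_zero B] in \<open>auto simp: norm_mult intro!: mult_right_mono\<close>)
    also have "\<dots> = B"
    proof -
      have "complex_of_real (LINT z|lborel. exp (- pi * (norm (z::'a))\<^sup>2)) = 1"
        using ft_gaussian[of "0::'a"] by (simp add: ft_def)
      then have "(LINT z|lborel. exp (- pi * (norm (z::'a))\<^sup>2)) = 1"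
        by (simp only: of_real_eq_1_iff)
      then show ?thesis by (simp only: integral_mult_right_zero mult_1_right)
    qed
    finally show ?thesis by (simp del: of_real_mult)
  qed
  have "(\<integral>\<^sup>+\<xi>. ennreal (P \<xi>) \<partial>lborel) = (\<integral>\<^sup>+\<xi>. liminf (\<lambda>k. ennreal (P \<xi> * e k \<xi>)) \<partial>lborel)"
  proof (rule nn_integral_cong)
    fix \<xi>
    have "c \<longlonglongrightarrow> 0" unfolding c_def by (rule LIMSEQ_Suc[OF lim_1_over_n])
    then have "(\<lambda>k. P \<xi> * e k \<xi>) \<longlonglongrightarrow> P \<xi> * exp (- pi * (norm (0 *\<^sub>R \<xi>))\<^sup>2)"
      unfolding e_def by (intro tendsto_intros)
    then have "(\<lambda>k. P \<xi> * e k \<xi>) \<longlonglongrightarrow> P \<xi>" by simp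
    then have "(\<lambda>k. ennreal (P \<xi> * e k \<xi>)) \<longlonglongrightarrow> ennreal (P \<xi>)" by (rule tendsto_ennrealI)
    then show "ennreal (P \<xi>) = liminf (\<lambda>k. ennreal (P \<xi> * e k \<xi>))"
      by (simp add: lim_imp_Liminf)
  qed
  also have "\<dots> \<le> liminf (\<lambda>k. \<integral>\<^sup>+\<xi>. ennreal (P \<xi> * e k \<xi>) \<partial>lborel)"
    by (rule nn_integral_liminf) measurable
  also have "\<dots> \<le> ennreal B"
  proof -
    have "(\<integral>\<^sup>+\<xi>. ennreal (P \<xi> * e k \<xi>) \<partial>lborel) \<le> ennreal B" for k
      using bd[of k] by (subst nn_integral_eq_integral[OF Pe]) (auto intro!: AE_I2 simp: P e_def ennreal_leI)
    then show ?thesis by (intro Liminf_le) auto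
  qed
  finally have "(\<integral>\<^sup>+\<xi>. ennreal (P \<xi>) \<partial>lborel) < \<infinity>"
    using le_less_trans[OF _ ennreal_less_top] by simp
  then show ?thesis
    by (intro integrableI_bounded) (auto simp: P)
qed

text \<open>The two sides are the limits, as c tends to 0, of the two sides of
  \<open>gaussian_regularization\<close>.\<close>

lemma ft_inversion:
  fixes A :: "'a::euclidean_space \<Rightarrow> complex"
  assumes A: "integrable lborel A" and B: "\<And>x. norm (A x) \<le> B"
    and cont: "isCont A x" and int: "integrable lborel (ft A)"
  shows "A x = (LINT \<xi>|lborel. ft A \<xi> * cis (2 * pi * (x \<bullet> \<xi>)))"
proof -
  have [measurable]: "A \<in> borel_measurable borel" "ft A \<in> borel_measurable borel" using A by auto
  define c where "c k = 1 / real (Suc k)" for k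
  have c: "c k > 0" for k by (simp add: c_def)
  have c0: "c \<longlonglongrightarrow> 0" unfolding c_def by (rule LIMSEQ_Suc[OF lim_1_over_n])
  have "(\<lambda>k. LINT z|lborel. A (x + c k *\<^sub>R z) * exp (- pi * (norm z)\<^sup>2)) \<longlonglongrightarrow> A x"
    by (rule gaussian_approx_tendsto[OF _ B cont c0]) measurable
  moreover have "(\<lambda>k. LINT \<xi>|lborel. ft A \<xi> * exp (- pi * (norm (c k *\<^sub>R \<xi>))\<^sup>2) * cis (2 * pi * (x \<bullet> \<xi>)))
      \<longlonglongrightarrow> (LINT \<xi>|lborel. ft A \<xi> * cis (2 * pi * (x \<bullet> \<xi>)))"
  proof (rule integral_dominated_convergence[where w="\<lambda>\<xi>. norm (ft A \<xi>)"])
    have "(\<lambda>k. ft A \<xi> * complex_of_real (exp (- pi * (norm (c k *\<^sub>R \<xi>))\<^sup>2)) * cis (2 * pi * (x \<bullet> \<xi>)))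
       \<longlonglongrightarrow> ft A \<xi> * complex_of_real (exp (- pi * (norm (0 *\<^sub>R \<xi>))\<^sup>2)) * cis (2 * pi * (x \<bullet> \<xi>))" for \<xi>
      by (intro tendsto_intros c0)
    then show "AE \<xi> in lborel. (\<lambda>k. ft A \<xi> * complex_of_real (exp (- pi * (norm (c k *\<^sub>R \<xi>))\<^sup>2)) * cis (2 * pi * (x \<bullet> \<xi>)))
       \<longlonglongrightarrow> ft A \<xi> * cis (2 * pi * (x \<bullet> \<xi>))" by simp
  qed (use int in \<open>auto simp: norm_mult intro!: mult_left_le\<close>)
  ultimately show ?thesis
    unfolding gaussian_regularization[OF A c] by (rule LIMSEQ_unique)
qed

section \<open>Autocorrelations and Plancherel\<close>

definition autocorr :: "('a::euclidean_space \<Rightarrow> complex) \<Rightarrow> 'a \<Rightarrow> complex" where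
  "autocorr \<phi> z = (LINT y|lborel. \<phi> (y + z) * cnj (\<phi> y))"

text \<open>For fixed y the z-integral of the modulus of phi(y + z) cnj(phi(y)) is |phi(y)| times
  the L^1 norm of phi, so the pair integral converges absolutely and both claims follow from
  Fubini.\<close>

lemma
  fixes \<phi> :: "'a::euclidean_space \<Rightarrow> complex"
  assumes \<phi>: "integrable lborel \<phi>"
  shows integrable_autocorr: "integrable lborel (autocorr \<phi>)"
    and ft_autocorr: "ft (autocorr \<phi>) \<xi> = of_real ((norm (ft \<phi> \<xi>))\<^sup>2)"
proof -
  have [measurable]: "\<phi> \<in> borel_measurable borel" using \<phi> by auto
  have pair: "integrable (lborel \<Otimes>\<^sub>M lborel) (\<lambda>(y, z). \<phi> (y + z) * cnj (\<phi> y))"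
  proof (rule lborel_pair.Fubini_integrable)
    have "(LINT z|lborel. norm (\<phi> (y + z) * cnj (\<phi> y))) = (LINT z|lborel. norm (\<phi> z)) * norm (\<phi> y)" for y
      using lborel_integral_translate[of "\<lambda>z. norm (\<phi> z)" y] by (simp add: norm_mult add.commute)
    then show "integrable lborel (\<lambda>y. LINT z|lborel. norm (case (y, z) of (y, z) \<Rightarrow> \<phi> (y + z) * cnj (\<phi> y)))"
      using \<phi> by simp
    show "AE y in lborel. integrable lborel (\<lambda>z. case (y, z) of (y, z) \<Rightarrow> \<phi> (y + z) * cnj (\<phi> y))"
      using \<phi> lborel_integrable_translate[of \<phi>] by (simp add: add.commute)
  qed measurable
  show "integrable lborel (autocorr \<phi>)"
    unfolding autocorr_def using lborel_pair.integrable_snd[OF pair] by simp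
  show "ft (autocorr \<phi>) \<xi> = of_real ((norm (ft \<phi> \<xi>))\<^sup>2)"
  proof -
    have "ft (autocorr \<phi>) \<xi> = (LINT z|lborel. LINT y|lborel. \<phi> (y + z) * cnj (\<phi> y) * cis (- (2 * pi * (z \<bullet> \<xi>))))"
      unfolding ft_def autocorr_def by (simp flip: integral_mult_left_zero)
    also have "\<dots> = (LINT y|lborel. LINT z|lborel. \<phi> (y + z) * cnj (\<phi> y) * cis (- (2 * pi * (z \<bullet> \<xi>))))"
    proof (rule lborel_pair.Fubini_integral)
      show "integrable (lborel \<Otimes>\<^sub>M lborel) (\<lambda>(y, z). \<phi> (y + z) * cnj (\<phi> y) * cis (- (2 * pi * (z \<bullet> \<xi>))))"
        using integrable_mult_cis[OF pair, of "\<lambda>(y,z). - (2 * pi * (z \<bullet> \<xi>))"] by (simp add: case_prod_unfold)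
    qed
    also have "\<dots> = (LINT y|lborel. cnj (\<phi> y * cis (- (2 * pi * (y \<bullet> \<xi>)))) * ft \<phi> \<xi>)"
    proof (rule Bochner_Integration.integral_cong[OF refl])
      fix y
      have "(LINT z|lborel. \<phi> (y + z) * cnj (\<phi> y) * cis (- (2 * pi * (z \<bullet> \<xi>)))) =
        (LINT z|lborel. \<phi> (z + y) * cnj (\<phi> y) * cis (2 * pi * (y \<bullet> \<xi>)) * cis (- (2 * pi * ((z + y) \<bullet> \<xi>))))"
        by (rule Bochner_Integration.integral_cong[OF refl]) (simp add: cis_mult inner_add_left algebra_simps)
      also have "\<dots> = (LINT z|lborel. \<phi> z * cnj (\<phi> y) * cis (2 * pi * (y \<bullet> \<xi>)) * cis (- (2 * pi * (z \<bullet> \<xi>))))"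
        by (rule lborel_integral_translate)
      also have "\<dots> = cnj (\<phi> y * cis (- (2 * pi * (y \<bullet> \<xi>)))) * ft \<phi> \<xi>"
        unfolding ft_def by (simp add: cis_cnj mult_ac flip: integral_mult_right_zero)
      finally show "(LINT z|lborel. \<phi> (y + z) * cnj (\<phi> y) * cis (- (2 * pi * (z \<bullet> \<xi>)))) = \<dots>" .
    qed
    also have "\<dots> = cnj (ft \<phi> \<xi>) * ft \<phi> \<xi>"
      unfolding integral_mult_left_zero by (simp only: Bochner_Integration.integral_cnj ft_def)
    finally show ?thesis
      by (metis complex_norm_square mult.commute of_real_power)
  qed
qed

text \<open>Boundedness of the autocorrelation, rather than of \<open>\<phi>\<close>, is assumed so
  that kernels with an integrable singularity are covered; continuity is asked only at the point of
  evaluation.\<close>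

lemma
  fixes \<phi> :: "'a::euclidean_space \<Rightarrow> complex"
  assumes \<phi>: "integrable lborel \<phi>" and B: "\<And>z. norm (autocorr \<phi> z) \<le> B"
  shows integrable_norm_ft_square: "integrable lborel (\<lambda>\<xi>. (norm (ft \<phi> \<xi>))\<^sup>2)"
    and autocorr_eq_integral: "isCont (autocorr \<phi>) z \<Longrightarrow>
      autocorr \<phi> z = (LINT \<xi>|lborel. of_real ((norm (ft \<phi> \<xi>))\<^sup>2) * cis (2 * pi * (z \<bullet> \<xi>)))"
proof -
  show int: "integrable lborel (\<lambda>\<xi>. (norm (ft \<phi> \<xi>))\<^sup>2)"
    by (rule integrable_ft_nonneg[OF integrable_autocorr[OF \<phi>] B ft_autocorr[OF \<phi>]]) simp
  have *: "ft (autocorr \<phi>) = (\<lambda>\<xi>. of_real ((norm (ft \<phi> \<xi>))\<^sup>2))"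
    using ft_autocorr[OF \<phi>] by blast
  assume cont: "isCont (autocorr \<phi>) z"
  have "autocorr \<phi> z = (LINT \<xi>|lborel. ft (autocorr \<phi>) \<xi> * cis (2 * pi * (z \<bullet> \<xi>)))"
    by (rule ft_inversion[OF integrable_autocorr[OF \<phi>] B cont])
       (use int in \<open>simp add: * complex_of_real_integrable_eq del: of_real_power\<close>)
  then show "autocorr \<phi> z = (LINT \<xi>|lborel. of_real ((norm (ft \<phi> \<xi>))\<^sup>2) * cis (2 * pi * (z \<bullet> \<xi>)))"
    by (simp only: *)
qed

text \<open>Inversion of the autocorrelation at 0. Continuity there follows by dominated convergence
  from almost everywhere continuity of \<open>\<phi>\<close>, which is general enough for the jumps
  of the Hilbert multiplier and for truncations to balls.\<close>

lemma
  fixes \<phi> :: "'a::euclidean_space \<Rightarrow> complex"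
  assumes \<phi>: "integrable lborel \<phi>" and B: "\<And>x. norm (\<phi> x) \<le> B"
    and cont: "AE x in lborel. isCont \<phi> x"
  shows plancherel_integrable: "integrable lborel (\<lambda>\<xi>. (norm (ft \<phi> \<xi>))\<^sup>2)"
    and plancherel: "(LINT \<xi>|lborel. (norm (ft \<phi> \<xi>))\<^sup>2) = (LINT x|lborel. (norm (\<phi> x))\<^sup>2)"
proof -
  have [measurable]: "\<phi> \<in> borel_measurable borel" using \<phi> by auto
  have B0: "0 \<le> B" using order_trans[OF norm_ge_zero B] .
  have dom: "norm (\<phi> (y + z) * cnj (\<phi> y)) \<le> B * norm (\<phi> y)" for y z
    by (auto simp: norm_mult intro!: mult_right_mono B)
  have AB: "norm (autocorr \<phi> z) \<le> B * (LINT y|lborel. norm (\<phi> y))" for z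
  proof -
    have "norm (autocorr \<phi> z) \<le> (LINT y|lborel. norm (\<phi> (y + z) * cnj (\<phi> y)))"
      unfolding autocorr_def by (rule integral_norm_bound)
    also have "\<dots> \<le> (LINT y|lborel. B * norm (\<phi> y))"
      using \<phi> B0 by (intro integral_mono' dom) auto
    finally show ?thesis by simp
  qed
  have A0: "isCont (autocorr \<phi>) 0"
    unfolding continuous_at_sequentially o_def
  proof (intro allI impI)
    fix X :: "nat \<Rightarrow> 'a" assume X: "X \<longlonglongrightarrow> 0"
    show "(\<lambda>n. autocorr \<phi> (X n)) \<longlonglongrightarrow> autocorr \<phi> 0"
      unfolding autocorr_def
    proof (rule integral_dominated_convergence[where w="\<lambda>y. B * norm (\<phi> y)"])
      show "AE y in lborel. (\<lambda>i. \<phi> (y + X i) * cnj (\<phi> y)) \<longlonglongrightarrow> \<phi> (y + 0) * cnj (\<phi> y)"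
        using cont
      proof eventually_elim
        case (elim y)
        have "(\<lambda>i. y + X i) \<longlonglongrightarrow> y + 0" by (intro tendsto_intros X)
        then have "(\<lambda>i. \<phi> (y + X i)) \<longlonglongrightarrow> \<phi> (y + 0)"
          by (rule isCont_tendsto_compose[rotated]) (use elim in simp)
        then show ?case
          by (intro tendsto_intros)
      qed
    qed (use \<phi> dom in auto)
  qed
  show "integrable lborel (\<lambda>\<xi>. (norm (ft \<phi> \<xi>))\<^sup>2)"
    by (rule integrable_norm_ft_square[OF \<phi> AB])
  have "of_real (LINT \<xi>|lborel. (norm (ft \<phi> \<xi>))\<^sup>2) = autocorr \<phi> 0"
    unfolding autocorr_eq_integral[OF \<phi> AB A0] by (simp del: of_real_power)
  also have "\<dots> = of_real (LINT x|lborel. (norm (\<phi> x))\<^sup>2)"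
    unfolding autocorr_def by (simp add: complex_norm_square[symmetric] del: of_real_power)
  finally show "(LINT \<xi>|lborel. (norm (ft \<phi> \<xi>))\<^sup>2) = (LINT x|lborel. (norm (\<phi> x))\<^sup>2)"
    by (simp only: of_real_eq_iff)
qed

section \<open>Schwartz functions\<close>

lemma integrable_1_div_1_plus_square: "integrable lborel (\<lambda>x::real. 1 / (1 + x\<^sup>2))"
  using integrable_inverse_1_plus_square
  by (simp add: set_integrable_def einterval_def inverse_eq_divide)

lemma ft_translate:
  fixes h :: "'a::euclidean_space \<Rightarrow> complex"
  shows "ft (\<lambda>x. h (x + t)) \<xi> = cis (2 * pi * (t \<bullet> \<xi>)) * ft h \<xi>"
proof -
  have "ft (\<lambda>x. h (x + t)) \<xi> = (LINT x|lborel. cis (2 * pi * (t \<bullet> \<xi>)) * (h (x + t) * cis (- (2 * pi * ((x + t) \<bullet> \<xi>)))))"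
    unfolding ft_def
    by (rule Bochner_Integration.integral_cong[OF refl])
       (simp add: mult.left_commute cis_mult inner_add_left algebra_simps)
  also have "\<dots> = cis (2 * pi * (t \<bullet> \<xi>)) * ft h \<xi>"
    unfolding ft_def integral_mult_right_zero
    by (subst lborel_integral_translate) (rule refl)
  finally show ?thesis .
qed

lemma schwartz_differentiable: "f \<in> schwartz_space \<Longrightarrow> f differentiable (at x)"
  unfolding schwartz_space_def partial_derivs_def by (auto dest: spec[of _ "[]"])

lemma schwartz_isCont: "f \<in> schwartz_space \<Longrightarrow> isCont f x"
  by (rule differentiable_imp_continuous_within[OF schwartz_differentiable])

lemma schwartz_measurable: "f \<in> schwartz_space \<Longrightarrow> f \<in> borel_measurable borel"
  by (rule borel_measurable_continuous_onI) (simp add: continuous_at_imp_continuous_on schwartz_isCont)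

lemma schwartz_partial_deriv:
  assumes "f \<in> schwartz_space" shows "partial_deriv i f \<in> schwartz_space"
proof -
  have "partial_derivs is (partial_deriv i f) = partial_derivs (is @ [i]) f" for "is"
    by (simp add: partial_derivs_def)
  then show ?thesis using assms unfolding schwartz_space_def by simp
qed

lemma schwartz_decay:
  assumes "f \<in> schwartz_space" shows "\<exists>C. \<forall>x. norm x ^ k * norm (f x) \<le> C"
  using assms unfolding schwartz_space_def partial_derivs_def by (auto dest: spec[of _ "[]"])

lemma schwartz_bounded:
  assumes "f \<in> schwartz_space" obtains B where "\<And>x. norm (f x) \<le> B"
  using schwartz_decay[OF assms, of 0] by auto

text \<open>A tensor weight instead of a power of the norm: its integrability reduces to one
  variable.\<close>

lemma integrable_weight: "integrable lborel (\<lambda>x::real^'n::finite. \<Prod>i\<in>UNIV. 1 / (1 + (x $ i)\<^sup>2))"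
  by (rule integrable_lborel_prod_vec) (rule integrable_1_div_1_plus_square)

lemma integrable_if_bounded_by_weight:
  fixes f :: "real^'n::finite \<Rightarrow> complex"
  assumes [measurable]: "f \<in> borel_measurable borel"
    and C: "\<And>x. (\<Prod>i\<in>UNIV. 1 + (x $ i)\<^sup>2) * norm (f x) \<le> C"
  shows "integrable lborel f"
proof (rule Bochner_Integration.integrable_bound[OF integrable_mult_right[OF integrable_weight, of C]])
  have pos: "(\<Prod>i\<in>UNIV. 1 + (x $ i)\<^sup>2) > 0" for x :: "real^'n"
    by (intro prod_pos) (auto intro: add_pos_nonneg)
  show "AE x in lborel. norm (f x) \<le> norm (C * (\<Prod>i\<in>UNIV. 1 / (1 + (x $ i)\<^sup>2)))"
  proof (rule AE_I2)
    fix x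
    have "norm (f x) \<le> C / (\<Prod>i\<in>UNIV. 1 + (x $ i)\<^sup>2)"
      using C[of x] pos[of x] by (simp add: field_simps)
    also have "\<dots> = C * (\<Prod>i\<in>UNIV. 1 / (1 + (x $ i)\<^sup>2))"
      by (simp add: prod_dividef)
    finally show "norm (f x) \<le> norm (C * (\<Prod>i\<in>UNIV. 1 / (1 + (x $ i)\<^sup>2)))" by simp
  qed
qed simp

text \<open>The inverse weight is at most (1 + |x|^2)^n <= 2^n (1 + |x|^(2n)), so the decay bounds
  of orders 0 and 2n suffice.\<close>

lemma schwartz_integrable:
  fixes f :: "real^'n::finite \<Rightarrow> complex"
  assumes f: "f \<in> schwartz_space" shows "integrable lborel f"
proof -
  obtain C0 where C0: "\<And>x. norm (f x) \<le> C0"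
    using schwartz_bounded[OF f] by blast
  obtain C1 where C1: "\<And>x. norm x ^ (2 * CARD('n)) * norm (f x) \<le> C1"
    using schwartz_decay[OF f] by blast
  show ?thesis
  proof (rule integrable_if_bounded_by_weight[OF schwartz_measurable[OF f]])
    fix x :: "real^'n"
    let ?n = "CARD('n)"
    have "(\<Prod>i\<in>UNIV. 1 + (x $ i)\<^sup>2) \<le> (\<Prod>i\<in>(UNIV::'n set). 1 + (norm x)\<^sup>2)"
      using component_le_norm_cart[of x] by (intro prod_mono) (auto simp: add_nonneg_nonneg abs_le_square_iff[symmetric])
    also have "\<dots> = (1 + (norm x)\<^sup>2) ^ ?n" by simp
    also have "\<dots> \<le> 2 ^ ?n * (1 + norm x ^ (2 * ?n))"
    proof (cases "norm x \<le> 1")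
      case True
      then have "(1 + (norm x)\<^sup>2) ^ ?n \<le> 2 ^ ?n"
        by (intro power_mono) (auto simp: power_le_one)
      also have "\<dots> \<le> 2 ^ ?n * (1 + norm x ^ (2 * ?n))" by simp
      finally show ?thesis .
    next
      case False
      then have "(1 + (norm x)\<^sup>2) ^ ?n \<le> (2 * (norm x)\<^sup>2) ^ ?n"
        by (intro power_mono) auto
      also have "\<dots> \<le> 2 ^ ?n * (1 + norm x ^ (2 * ?n))" by (simp add: power_mult_distrib power_mult)
      finally show ?thesis .
    qed
    finally have "(\<Prod>i\<in>UNIV. 1 + (x $ i)\<^sup>2) * norm (f x) \<le> 2 ^ ?n * (1 + norm x ^ (2 * ?n)) * norm (f x)"
      by (rule mult_right_mono) simp
    also have "\<dots> = 2 ^ ?n * (norm (f x) + norm x ^ (2 * ?n) * norm (f x))" by (simp add: algebra_simps)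
    also have "\<dots> \<le> 2 ^ ?n * (C0 + C1)"
      using C0[of x] C1[of x] by (intro mult_left_mono add_mono) auto
    finally show "(\<Prod>i\<in>UNIV. 1 + (x $ i)\<^sup>2) * norm (f x) \<le> 2 ^ ?n * (C0 + C1)" .
  qed
qed

text \<open>Shifting by half a period in the \<open>i\<close>-th direction changes the sign of the Fourier integral,
  which bounds it by that of the difference quotient.\<close>

lemma ft_partial_deriv_bound:
  fixes f :: "real^'n::finite \<Rightarrow> complex"
  assumes f: "f \<in> schwartz_space"
  shows "\<bar>\<xi> $ i\<bar> * norm (ft f \<xi>) \<le> norm (ft (partial_deriv i f) \<xi>)"
proof (cases "\<xi> $ i = 0")
  case False
  define e where "e = axis i (1::real)"
  define s where "s = 1 / (2 * \<bar>\<xi> $ i\<bar>)"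
  define D where "D = partial_deriv i f"
  have s: "s > 0" using False by (simp add: s_def)
  have DS: "D \<in> schwartz_space" unfolding D_def by (rule schwartz_partial_deriv[OF f])
  have D: "integrable lborel D" by (rule schwartz_integrable[OF DS])
  have fi: "integrable lborel f" by (rule schwartz_integrable[OF f])
  have [measurable]: "D \<in> borel_measurable borel" by (rule schwartz_measurable[OF DS])
  have e: "e \<bullet> \<xi> = \<xi> $ i" by (simp add: e_def inner_axis')
  have "cis (2 * pi * (s *\<^sub>R e \<bullet> \<xi>)) = cis (if \<xi> $ i > 0 then pi else - pi)"
    using False by (intro arg_cong[where f=cis]) (auto simp: e s_def field_simps)
  then have c: "cis (2 * pi * (s *\<^sub>R e \<bullet> \<xi>)) = -1" by (auto simp: cis.ctr complex_eq_iff)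
  have deriv: "((\<lambda>\<sigma>. f (x + \<sigma> *\<^sub>R e)) has_vector_derivative D (x + \<sigma> *\<^sub>R e)) (at \<sigma> within A)" for x \<sigma> A
  proof -
    have "(f has_derivative frechet_derivative f (at (x + \<sigma> *\<^sub>R e))) (at (x + \<sigma> *\<^sub>R e))"
      using schwartz_differentiable[OF f] frechet_derivative_works by blast
    then have *: "((f \<circ> (\<lambda>\<sigma>. x + \<sigma> *\<^sub>R e)) has_derivative
       (frechet_derivative f (at (x + \<sigma> *\<^sub>R e)) \<circ> (\<lambda>h. h *\<^sub>R e))) (at \<sigma>)"
      by (intro diff_chain_at) (auto intro!: derivative_eq_intros)
    have "linear (frechet_derivative f (at (x + \<sigma> *\<^sub>R e)))"
      by (intro linear_frechet_derivative schwartz_differentiable[OF f])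
    then have "frechet_derivative f (at (x + \<sigma> *\<^sub>R e)) \<circ> (\<lambda>h. h *\<^sub>R e) = (\<lambda>h. h *\<^sub>R D (x + \<sigma> *\<^sub>R e))"
      by (simp add: fun_eq_iff linear_scale D_def partial_deriv_def e_def)
    with * show ?thesis
      by (simp add: has_vector_derivative_def o_def has_derivative_at_withinI)
  qed
  have ftc: "(LINT \<sigma>|lborel. indicator {0..s} \<sigma> *\<^sub>R D (x + \<sigma> *\<^sub>R e)) = f (x + s *\<^sub>R e) - f x" for x
  proof -
    have "continuous_on {0..s} (\<lambda>\<sigma>. D (x + \<sigma> *\<^sub>R e))"
      by (intro continuous_at_imp_continuous_on ballI isCont_o2[OF _ schwartz_isCont[OF DS]] continuous_intros)
    from integral_FTC_atLeastAtMost[OF less_imp_le[OF s] deriv this] show ?thesis by simp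
  qed
  let ?c = "\<lambda>x. cis (- (2 * pi * (x \<bullet> \<xi>)))"
  let ?L = "\<lambda>\<sigma>. indicator {0..s} \<sigma> *\<^sub>R (cis (2 * pi * ((\<sigma> *\<^sub>R e) \<bullet> \<xi>)) * ft D \<xi>)"
  let ?J = "\<lambda>\<sigma> x. indicator {0..s} \<sigma> *\<^sub>R (D (x + \<sigma> *\<^sub>R e) * ?c x)"
  have "- 2 * ft f \<xi> = ft (\<lambda>x. f (x + s *\<^sub>R e)) \<xi> - ft f \<xi>"
    unfolding ft_translate c by simp
  also have "\<dots> = (LINT x|lborel. (f (x + s *\<^sub>R e) - f x) * ?c x)"
    unfolding ft_def left_diff_distrib
    by (intro Bochner_Integration.integral_diff[symmetric] integrable_ft_integrand fi iffD2[OF lborel_integrable_translate])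
  also have "\<dots> = (LINT x|lborel. (LINT \<sigma>|lborel. ?J \<sigma> x))"
    unfolding ftc[symmetric] integral_mult_left_zero[symmetric] by simp
  also have "\<dots> = (LINT \<sigma>|lborel. (LINT x|lborel. ?J \<sigma> x))"
  proof (rule lborel_pair.Fubini_integral, rule lborel_pair.Fubini_integrable)
    have tr: "integrable lborel (\<lambda>x. D (x + y))" for y
      using D lborel_integrable_translate by blast
    show "AE \<sigma> in lborel. integrable lborel (\<lambda>x. case (\<sigma>, x) of (\<sigma>, x) \<Rightarrow> ?J \<sigma> x)"
      by (auto intro!: AE_I2 integrable_ft_integrand tr)
    have "(LINT x|lborel. norm (case (\<sigma>, x) of (\<sigma>, x) \<Rightarrow> ?J \<sigma> x)) =
        indicator {0..s} \<sigma> * (LINT x|lborel. norm (D x))" for \<sigma>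
      using lborel_integral_translate[of "\<lambda>x. norm (D x)" "\<sigma> *\<^sub>R e"] by (simp add: norm_mult)
    moreover have "integrable lborel (\<lambda>\<sigma>::real. indicator {0..s} \<sigma> * (LINT x|lborel. norm (D x)))"
      by (intro integrable_mult_left integrable_real_indicator) (auto simp: emeasure_lborel_Icc_eq)
    ultimately show "integrable lborel (\<lambda>\<sigma>. LINT x|lborel. norm (case (\<sigma>, x) of (\<sigma>, x) \<Rightarrow> ?J \<sigma> x))"
      by (simp only:)
  qed measurable
  also have "\<dots> = (LINT \<sigma>|lborel. ?L \<sigma>)"
    unfolding ft_translate[symmetric] by (simp add: ft_def)
  finally have eq: "- 2 * ft f \<xi> = (LINT \<sigma>|lborel. ?L \<sigma>)" .
  have "2 * norm (ft f \<xi>) = norm (- 2 * ft f \<xi>)" by (simp add: norm_mult)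
  also have "\<dots> \<le> (LINT \<sigma>|lborel. norm (?L \<sigma>))"
    unfolding eq by (rule integral_norm_bound)
  also have "\<dots> = s * norm (ft D \<xi>)"
    using s by (simp add: norm_mult)
  \<comment> \<open>The shift length \<open>s\<close> is half a period, 1 / (2 |xi_i|), which
    produces the 4. The sharp factor would be 2 pi; only the decay is used later, so the constant is
    dropped altogether.\<close>
  finally have "norm (ft f \<xi>) \<le> norm (ft D \<xi>) / (4 * \<bar>\<xi> $ i\<bar>)"
    by (simp add: s_def)
  then have "\<bar>\<xi> $ i\<bar> * norm (ft f \<xi>) \<le> norm (ft D \<xi>) / 4"
    using False by (simp add: field_simps)
  then show ?thesis using norm_ge_zero[of "ft D \<xi>"] unfolding D_def by linarith
qed simp

text \<open>Each new coordinate costs two derivatives in that direction. Hence \<open>f\<close>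
  varies in the induction: the hypothesis is applied to \<open>f\<close> and to its second partial
  derivative.\<close>

lemma schwartz_ft_decay:
  fixes f :: "real^'n::finite \<Rightarrow> complex"
  assumes "finite S" "f \<in> schwartz_space"
  shows "\<exists>C. \<forall>\<xi>. (\<Prod>i\<in>S. 1 + (\<xi> $ i)\<^sup>2) * norm (ft f \<xi>) \<le> C"
  using assms
proof (induction S arbitrary: f rule: finite_induct)
  case empty
  then show ?case using norm_ft_le[of f] by auto
next
  case (insert i S)
  let ?D = "partial_deriv i (partial_deriv i f)"
  obtain C1 where C1: "\<And>\<xi>. (\<Prod>i\<in>S. 1 + (\<xi> $ i)\<^sup>2) * norm (ft f \<xi>) \<le> C1"
    using insert.IH[OF insert.prems] by blast
  obtain C2 where C2: "\<And>\<xi>. (\<Prod>i\<in>S. 1 + (\<xi> $ i)\<^sup>2) * norm (ft ?D \<xi>) \<le> C2"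
    using insert.IH[OF schwartz_partial_deriv[OF schwartz_partial_deriv[OF insert.prems]]] by blast
  have "(\<Prod>i\<in>insert i S. 1 + (\<xi> $ i)\<^sup>2) * norm (ft f \<xi>) \<le> C1 + C2" for \<xi>
  proof -
    have "(\<xi> $ i)\<^sup>2 * norm (ft f \<xi>) = \<bar>\<xi> $ i\<bar> * (\<bar>\<xi> $ i\<bar> * norm (ft f \<xi>))"
      by (simp add: power2_eq_square mult.assoc[symmetric])
    also have "\<dots> \<le> \<bar>\<xi> $ i\<bar> * norm (ft (partial_deriv i f) \<xi>)"
      by (intro mult_left_mono ft_partial_deriv_bound insert.prems) auto
    also have "\<dots> \<le> norm (ft ?D \<xi>)"
      by (intro ft_partial_deriv_bound schwartz_partial_deriv insert.prems)
    finally have "(1 + (\<xi> $ i)\<^sup>2) * norm (ft f \<xi>) \<le> norm (ft f \<xi>) + norm (ft ?D \<xi>)"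
      by (simp add: distrib_right)
    then have "(\<Prod>i\<in>S. 1 + (\<xi> $ i)\<^sup>2) * ((1 + (\<xi> $ i)\<^sup>2) * norm (ft f \<xi>)) \<le>
        (\<Prod>i\<in>S. 1 + (\<xi> $ i)\<^sup>2) * (norm (ft f \<xi>) + norm (ft ?D \<xi>))"
      by (intro mult_left_mono prod_nonneg) auto
    also have "\<dots> \<le> C1 + C2"
      using C1[of \<xi>] C2[of \<xi>] by (simp add: distrib_left)
    finally show ?thesis
      using insert.hyps by (simp add: mult_ac)
  qed
  then show ?case by blast
qed

lemma schwartz_ft_integrable:
  fixes f :: "real^'n::finite \<Rightarrow> complex"
  assumes f: "f \<in> schwartz_space" shows "integrable lborel (ft f)"
  using schwartz_ft_decay[OF finite f] integrable_if_bounded_by_weight[of "ft f"] schwartz_integrable[OF f]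
  by auto

section \<open>The tensor product of Hilbert transforms\<close>

text \<open>Unlike \<open>borel_measurable_ft\<close>, this covers truncations of an L^2 function
  without first showing them integrable.\<close>

lemma measurable_ft:
  fixes h :: "'a::euclidean_space \<Rightarrow> complex"
  assumes [measurable]: "h \<in> borel_measurable borel"
  shows "ft h \<in> borel_measurable borel"
proof -
  have "(\<lambda>\<xi>. LINT x|lborel. h x * cis (- (2 * pi * (x \<bullet> \<xi>)))) \<in> borel_measurable (borel :: 'a measure)"
    by (rule lborel.borel_measurable_lebesgue_integral) measurable
  then show ?thesis unfolding ft_def[abs_def] .
qed

text \<open>Supplies the almost everywhere continuity that \<open>plancherel\<close> asks of a
  truncation: the cutoff jumps only on a sphere, a null set.\<close>

lemma AE_isCont_indicator_cball_mult:
  fixes g :: "'a::euclidean_space \<Rightarrow> complex"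
  assumes "\<And>x. isCont g x" "r \<noteq> 0"
  shows "AE x in lborel. isCont (\<lambda>x. indicator (cball 0 r) x * g x) x"
proof -
  have "sphere (0::'a) r \<in> null_sets lborel"
    using negligible_sphere[of "0::'a" r] by (auto simp: null_sets_completion_iff negligible_iff_null_sets)
  then have "AE x in lborel. x \<notin> sphere (0::'a) r" by (rule AE_not_in)
  then show ?thesis
  proof eventually_elim
    case (elim x)
    have "isCont (indicator (cball 0 r) :: 'a \<Rightarrow> real) x"
      using elim assms(2) by (simp add: isCont_indicator)
    then have "isCont (\<lambda>x. complex_of_real (indicator (cball 0 r) x)) x"
      by (intro continuous_intros)
    then have "isCont (\<lambda>x. indicator (cball 0 r) x :: complex) x"
      by (simp add: of_real_indicator)
    then show ?case by (intro continuous_intros assms)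
  qed
qed

text \<open>Let g be the inverse transform of G and g_k its truncations. Plancherel gives ||ft g_k||
  = ||g_k|| and ||G|| = ||g||, while the inner product of ft g_k with G equals that of g_k with g,
  which is ||g_k||^2. Expanding, ||ft g_k - G||^2 = ||g||^2 - ||g_k||^2, which tends to 0.\<close>

lemma has_fourier_L2_inverse:
  fixes G :: "real^'n::finite \<Rightarrow> complex"
  assumes G: "integrable lborel G" and B: "\<And>\<xi>. norm (G \<xi>) \<le> B"
    and cont: "AE \<xi> in lborel. isCont G \<xi>"
  shows "has_fourier_L2 (\<lambda>x. ft G (- x)) G"
proof -
  define g where "g = (\<lambda>x. ft G (- x))"
  have [measurable]: "G \<in> borel_measurable borel" using G by auto
  have g_eq: "g x = (LINT \<xi>|lborel. G \<xi> * cis (2 * pi * (x \<bullet> \<xi>)))" for x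
    by (simp add: g_def ft_def inner_commute)
  have gc: "isCont g x" for x
    unfolding g_def by (rule isCont_o2[OF _ isCont_ft[OF G]]) (intro continuous_intros)
  have gm [measurable]: "g \<in> borel_measurable borel"
    by (rule borel_measurable_continuous_onI) (simp add: continuous_at_imp_continuous_on gc)
  define C where "C = (LINT x|lborel. norm (G x))"
  have gC: "norm (g x) \<le> C" for x unfolding g_def C_def by (rule norm_ft_le)
  have C0: "C \<ge> 0" using order_trans[OF norm_ge_zero gC] .
  have g2: "integrable lborel (\<lambda>x. (norm (g x))\<^sup>2)"
    and gG: "(LINT x|lborel. (norm (g x))\<^sup>2) = (LINT \<xi>|lborel. (norm (G \<xi>))\<^sup>2)"
    using lborel_integrable_reflect[of "\<lambda>x. (norm (ft G x))\<^sup>2" 0] plancherel_integrable[OF G B cont]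
      lborel_integral_reflect[of "\<lambda>x. (norm (ft G x))\<^sup>2" 0] plancherel[OF G B cont]
    by (simp_all add: g_def)
  have G2: "integrable lborel (\<lambda>\<xi>. (norm (G \<xi>))\<^sup>2)"
    by (rule Bochner_Integration.integrable_bound[OF integrable_mult_right[OF integrable_norm[OF G], of B]])
      (use order_trans[OF B abs_ge_self] in \<open>auto simp: power2_eq_square abs_mult intro!: mult_right_mono\<close>)
  have sq: "square_integrable h" if "h \<in> borel_measurable borel" "integrable lborel (\<lambda>x. (norm (h x))\<^sup>2)" for h :: "real^'n \<Rightarrow> complex"
    using that unfolding square_integrable_def integrable_iff_bounded by simp
  define gk where "gk k = (\<lambda>x. indicator (cball 0 (real k)) x * g x)" for k
  have gkm [measurable]: "gk k \<in> borel_measurable borel" for k 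
    unfolding gk_def by (intro borel_measurable_times borel_measurable_indicator gm) auto
  have gkC: "norm (gk k x) \<le> C" for k x
    using gC[of x] C0 by (auto simp: gk_def indicator_def)
  have gki: "integrable lborel (gk k)" for k
  proof (rule Bochner_Integration.integrable_bound)
    show "integrable lborel (\<lambda>x::real^'n. C * indicator (cball 0 (real k)) x)"
      by (intro integrable_mult_right integrable_real_indicator) (auto simp: emeasure_lborel_cball_finite[unfolded infinity_ennreal_def])
  qed (use gC C0 in \<open>auto simp: gk_def indicator_def\<close>)
  have key: "(LINT \<xi>|lborel. (norm (ft (gk k) \<xi> - G \<xi>))\<^sup>2) = (LINT x|lborel. (norm (g x))\<^sup>2) - (LINT x|lborel. (norm (gk k x))\<^sup>2)"
    and keyi: "integrable lborel (\<lambda>\<xi>. (norm (ft (gk k) \<xi> - G \<xi>))\<^sup>2)" if k: "k > 0" for k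
  proof -
    have ck: "AE x in lborel. isCont (gk k) x"
      unfolding gk_def using k by (intro AE_isCont_indicator_cball_mult gc) auto
    note pi = plancherel_integrable[OF gki gkC ck] and pe = plancherel[OF gki gkC ck]
    have ftm [measurable]: "ft (gk k) \<in> borel_measurable borel" using gki by measurable
    have crossi: "integrable lborel (\<lambda>\<xi>. ft (gk k) \<xi> * cnj (G \<xi>))"
    proof (rule Bochner_Integration.integrable_bound[OF integrable_mult_right[OF integrable_norm[OF G], of "LINT x|lborel. norm (gk k x)"]])
      show "AE \<xi> in lborel. norm (ft (gk k) \<xi> * cnj (G \<xi>)) \<le> norm ((LINT x|lborel. norm (gk k x)) * norm (G \<xi>))"
        by (auto intro!: AE_I2 mult_right_mono norm_ft_le simp: norm_mult)
    qed simp
    \<comment> \<open>Fubini moves the transform from \<open>gk k\<close> to \<open>G\<close>. As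
      \<open>gk k\<close> is a cutoff of \<open>g\<close>, multiplying it by
      \<open>cnj (g x)\<close> gives the square of its own modulus.\<close>
    have "(LINT \<xi>|lborel. ft (gk k) \<xi> * cnj (G \<xi>)) =
      (LINT \<xi>|lborel. LINT x|lborel. gk k x * cnj (G \<xi>) * cis (- (2 * pi * (x \<bullet> \<xi>))))"
      by (simp add: ft_def mult_ac flip: integral_mult_right_zero)
    also have "\<dots> = (LINT x|lborel. LINT \<xi>|lborel. gk k x * cnj (G \<xi>) * cis (- (2 * pi * (x \<bullet> \<xi>))))"
      using G by (intro lborel_pair.Fubini_integral lborel_pair.integrable_pair_mult_cis gki) auto
    also have "\<dots> = (LINT x|lborel. gk k x * cnj (g x))"
      by (simp add: g_eq cis_cnj mult_ac flip: integral_mult_right_zero Bochner_Integration.integral_cnj)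
    also have "\<dots> = (LINT x|lborel. of_real ((norm (gk k x))\<^sup>2))"
      by (intro Bochner_Integration.integral_cong refl)
         (simp only: complex_norm_square, auto simp: gk_def indicator_def)
    also have "\<dots> = of_real (LINT x|lborel. (norm (gk k x))\<^sup>2)"
      by (simp del: of_real_power)
    finally have cross: "Re (LINT \<xi>|lborel. ft (gk k) \<xi> * cnj (G \<xi>)) = (LINT x|lborel. (norm (gk k x))\<^sup>2)"
      by simp
    have exp: "(norm (ft (gk k) \<xi> - G \<xi>))\<^sup>2 = (norm (ft (gk k) \<xi>))\<^sup>2 + (norm (G \<xi>))\<^sup>2 - 2 * Re (ft (gk k) \<xi> * cnj (G \<xi>))" for \<xi>
      unfolding cmod_power2 by (simp add: power2_eq_square algebra_simps)
    show "integrable lborel (\<lambda>\<xi>. (norm (ft (gk k) \<xi> - G \<xi>))\<^sup>2)"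
      unfolding exp
      by (intro Bochner_Integration.integrable_add Bochner_Integration.integrable_diff integrable_mult_right pi G2 integrable_Re crossi)
    have "(LINT \<xi>|lborel. (norm (ft (gk k) \<xi> - G \<xi>))\<^sup>2) =
      (LINT \<xi>|lborel. (norm (ft (gk k) \<xi>))\<^sup>2) + (LINT \<xi>|lborel. (norm (G \<xi>))\<^sup>2) - 2 * Re (LINT \<xi>|lborel. ft (gk k) \<xi> * cnj (G \<xi>))"
    proof -
      define r where "r \<xi> = Re (ft (gk k) \<xi> * cnj (G \<xi>))" for \<xi>
      have "integrable lborel r" "integral\<^sup>L lborel r = Re (LINT \<xi>|lborel. ft (gk k) \<xi> * cnj (G \<xi>))"
        unfolding r_def using crossi by (intro integrable_Re integral_Re; simp)+
      then show ?thesis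
        unfolding exp r_def[symmetric] using pi G2 by simp
    qed
    then show "(LINT \<xi>|lborel. (norm (ft (gk k) \<xi> - G \<xi>))\<^sup>2) = (LINT x|lborel. (norm (g x))\<^sup>2) - (LINT x|lborel. (norm (gk k x))\<^sup>2)"
      unfolding cross pe gG by simp
  qed
  have "(\<lambda>k. LINT x|lborel. (norm (gk k x))\<^sup>2) \<longlonglongrightarrow> (LINT x|lborel. (norm (g x))\<^sup>2)"
  proof (rule integral_dominated_convergence[where w="\<lambda>x. (norm (g x))\<^sup>2"])
    show "AE x in lborel. (\<lambda>k. (norm (gk k x))\<^sup>2) \<longlonglongrightarrow> (norm (g x))\<^sup>2"
    proof (rule AE_I2)
      fix x :: "real^'n"
      obtain N :: nat where N: "norm x \<le> real N" using real_arch_simple by blast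
      have "(norm (gk k x))\<^sup>2 = (norm (g x))\<^sup>2" if "k \<ge> N" for k
        using N that by (simp add: gk_def indicator_def)
      then have "eventually (\<lambda>k. (norm (gk k x))\<^sup>2 = (norm (g x))\<^sup>2) sequentially"
        by (auto simp: eventually_sequentially)
      then show "(\<lambda>k. (norm (gk k x))\<^sup>2) \<longlonglongrightarrow> (norm (g x))\<^sup>2"
        by (rule tendsto_eventually)
    qed
  qed (use g2 in \<open>auto simp: gk_def indicator_def\<close>)
  then have "(\<lambda>k. (LINT x|lborel. (norm (g x))\<^sup>2) - (LINT x|lborel. (norm (gk k x))\<^sup>2)) \<longlonglongrightarrow>
     (LINT x|lborel. (norm (g x))\<^sup>2) - (LINT x|lborel. (norm (g x))\<^sup>2)"
    by (intro tendsto_intros)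
  then have "(\<lambda>k. ennreal ((LINT x|lborel. (norm (g x))\<^sup>2) - (LINT x|lborel. (norm (gk k x))\<^sup>2))) \<longlonglongrightarrow> ennreal 0"
    by (intro tendsto_ennrealI) simp
  moreover have "eventually (\<lambda>k. ennreal ((LINT x|lborel. (norm (g x))\<^sup>2) - (LINT x|lborel. (norm (gk k x))\<^sup>2)) =
     (\<integral>\<^sup>+\<xi>. ennreal ((norm (ft (gk k) \<xi> - G \<xi>))\<^sup>2) \<partial>lborel)) sequentially"
    using eventually_gt_at_top[of 0]
    by eventually_elim (subst nn_integral_eq_integral[OF keyi], auto simp: key)
  ultimately have lim: "(\<lambda>k. \<integral>\<^sup>+\<xi>. ennreal ((norm (ft (gk k) \<xi> - G \<xi>))\<^sup>2) \<partial>lborel) \<longlonglongrightarrow> 0"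
    by (simp add: tendsto_cong)
  have "has_fourier_L2 g G"
    unfolding has_fourier_L2_def fourier_eq_ft
    using lim sq[OF _ g2] sq[OF _ G2] unfolding gk_def by simp
  then show ?thesis unfolding g_def .
qed

text \<open>Uniqueness of L^2 limits. The inequality (a + b)^2 <= 2 a^2 + 2 b^2 keeps the estimate
  inside nonnegative integrals, so nothing has to be shown finite beforehand.\<close>

lemma has_fourier_L2_unique:
  fixes g :: "real^'n::finite \<Rightarrow> complex"
  assumes "has_fourier_L2 g G1" "has_fourier_L2 g G2"
  shows "AE \<xi> in lborel. G1 \<xi> = G2 \<xi>"
proof -
  let ?F = "\<lambda>k. ft (\<lambda>x. indicator (cball 0 (real k)) x * g x)"
  have m [measurable]: "g \<in> borel_measurable borel" "G1 \<in> borel_measurable borel" "G2 \<in> borel_measurable borel"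
    using assms by (auto simp: has_fourier_L2_def square_integrable_def)
  have [measurable]: "?F k \<in> borel_measurable borel" for k
    by (intro measurable_ft borel_measurable_times borel_measurable_indicator) (simp_all add: m)
  define I1 where "I1 k = (\<integral>\<^sup>+\<xi>. ennreal ((norm (?F k \<xi> - G1 \<xi>))\<^sup>2) \<partial>lborel)" for k
  define I2 where "I2 k = (\<integral>\<^sup>+\<xi>. ennreal ((norm (?F k \<xi> - G2 \<xi>))\<^sup>2) \<partial>lborel)" for k
  have lim: "I1 \<longlonglongrightarrow> 0" "I2 \<longlonglongrightarrow> 0"
    using assms unfolding has_fourier_L2_def fourier_eq_ft I1_def I2_def by auto
  have le: "(\<integral>\<^sup>+\<xi>. ennreal ((norm (G1 \<xi> - G2 \<xi>))\<^sup>2) \<partial>lborel) \<le> 2 * I1 k + 2 * I2 k" for k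
  proof -
    have "(norm (G1 \<xi> - G2 \<xi>))\<^sup>2 \<le> 2 * (norm (?F k \<xi> - G1 \<xi>))\<^sup>2 + 2 * (norm (?F k \<xi> - G2 \<xi>))\<^sup>2" for \<xi>
    proof -
      have "norm (G1 \<xi> - G2 \<xi>) \<le> norm (?F k \<xi> - G1 \<xi>) + norm (?F k \<xi> - G2 \<xi>)"
        using norm_triangle_ineq4[of "?F k \<xi> - G2 \<xi>" "?F k \<xi> - G1 \<xi>"] by simp
      then have "(norm (G1 \<xi> - G2 \<xi>))\<^sup>2 \<le> (norm (?F k \<xi> - G1 \<xi>) + norm (?F k \<xi> - G2 \<xi>))\<^sup>2"
        by (intro power_mono) auto
      also have "\<dots> \<le> 2 * (norm (?F k \<xi> - G1 \<xi>))\<^sup>2 + 2 * (norm (?F k \<xi> - G2 \<xi>))\<^sup>2"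
        using sum_squares_bound[of "norm (?F k \<xi> - G1 \<xi>)" "norm (?F k \<xi> - G2 \<xi>)"] by (simp add: power2_sum)
      finally show ?thesis .
    qed
    then have "(\<integral>\<^sup>+\<xi>. ennreal ((norm (G1 \<xi> - G2 \<xi>))\<^sup>2) \<partial>lborel) \<le>
      (\<integral>\<^sup>+\<xi>. 2 * ennreal ((norm (?F k \<xi> - G1 \<xi>))\<^sup>2) + 2 * ennreal ((norm (?F k \<xi> - G2 \<xi>))\<^sup>2) \<partial>lborel)"
      by (intro nn_integral_mono) (simp add: ennreal_mult'[symmetric] ennreal_plus[symmetric] ennreal_leI del: ennreal_plus flip: ennreal_numeral)
    also have "\<dots> = 2 * I1 k + 2 * I2 k"
      unfolding I1_def I2_def by (simp add: nn_integral_add nn_integral_cmult)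
    finally show ?thesis .
  qed
  have "(\<lambda>k. 2 * I1 k + 2 * I2 k) \<longlonglongrightarrow> 2 * 0 + 2 * 0"
    by (intro tendsto_add ennreal_tendsto_cmult lim) auto
  then have "(\<integral>\<^sup>+\<xi>. ennreal ((norm (G1 \<xi> - G2 \<xi>))\<^sup>2) \<partial>lborel) \<le> 0"
    using le by (intro LIMSEQ_le_const) auto
  then have "(\<integral>\<^sup>+\<xi>. ennreal ((norm (G1 \<xi> - G2 \<xi>))\<^sup>2) \<partial>lborel) = 0" by simp
  then show ?thesis
    by (subst (asm) nn_integral_0_iff_AE) auto
qed

definition hilbert_mult :: "(real^'n::finite \<Rightarrow> complex) \<Rightarrow> real^'n \<Rightarrow> complex" where
  "hilbert_mult f \<xi> = (\<Prod>j\<in>UNIV. - \<i> * complex_of_real (sgn (\<xi> $ j))) * fourier f \<xi>"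

lemma AE_components_neq: "AE x in lborel. \<forall>i. (x :: real^'n::finite) $ i \<noteq> c i"
proof (subst AE_all_countable, rule allI)
  fix i :: 'n
  have "{x::real^'n. x $ i = c i} \<in> null_sets lborel"
    using negligible_standard_hyperplane[of "axis i 1 :: real^'n" "c i"]
    by (auto simp: null_sets_completion_iff negligible_iff_null_sets cart_eq_inner_axis)
  from AE_not_in[OF this] show "AE x in lborel. (x :: real^'n) $ i \<noteq> c i" by simp
qed

lemma norm_hilbert_mult_le: "norm (hilbert_mult f \<xi>) \<le> norm (ft f \<xi>)"
proof -
  have "norm (\<Prod>j\<in>UNIV. - \<i> * complex_of_real (sgn (\<xi> $ j))) \<le> 1"
    unfolding prod_norm[symmetric] by (intro prod_le_1) (auto simp: norm_mult sgn_if)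
  then show ?thesis
    unfolding hilbert_mult_def norm_mult fourier_eq_ft by (intro mult_left_le_one_le) auto
qed

lemma has_fourier_L2_hilbert_mult:
  fixes f :: "real^'n::finite \<Rightarrow> complex"
  assumes f: "f \<in> schwartz_space"
  shows "has_fourier_L2 (\<lambda>x. ft (hilbert_mult f) (- x)) (hilbert_mult f)"
proof (rule has_fourier_L2_inverse)
  have [measurable]: "ft f \<in> borel_measurable borel" using schwartz_integrable[OF f] by measurable
  show "integrable lborel (hilbert_mult f)"
  proof (rule Bochner_Integration.integrable_bound[OF integrable_norm[OF schwartz_ft_integrable[OF f]]])
    show "hilbert_mult f \<in> borel_measurable lborel"
      unfolding hilbert_mult_def[abs_def] fourier_eq_ft by measurable
  qed (use norm_hilbert_mult_le in auto)
  show "norm (hilbert_mult f \<xi>) \<le> (LINT x|lborel. norm (f x))" for \<xi>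
    using norm_hilbert_mult_le norm_ft_le by (rule order_trans)
  show "AE \<xi> in lborel. isCont (hilbert_mult f) \<xi>"
    using AE_components_neq[of "\<lambda>_. 0"]
  proof eventually_elim
    case (elim \<xi>)
    then show ?case
      unfolding hilbert_mult_def[abs_def] fourier_eq_ft
      by (intro continuous_mult continuous_prod continuous_const continuous_of_real continuous_sgn
            isCont_ft schwartz_integrable f) (auto intro: continuous_intros)
  qed
qed

text \<open>Two choices are resolved here. The explicit inverse transform of
  \<open>hilbert_mult f\<close> witnesses that \<open>hilbert_tensor f\<close> has the intended
  transform; uniqueness then identifies the transform selected by \<open>fourier_L2\<close>, up to a
  null set.\<close>

lemma
  fixes f :: "real^'n::finite \<Rightarrow> complex"
  assumes f: "f \<in> schwartz_space"
  shows fourier_L2_hilbert_tensor: "AE \<xi> in lborel. fourier_L2 (hilbert_tensor f) \<xi> = hilbert_mult f \<xi>"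
    and fourier_L2_hilbert_tensor_measurable: "fourier_L2 (hilbert_tensor f) \<in> borel_measurable borel"
proof -
  have eq: "(\<lambda>\<xi>. (\<Prod>j\<in>UNIV. - \<i> * complex_of_real (sgn (\<xi> $ j))) * fourier f \<xi>) = hilbert_mult f"
    by (simp add: fun_eq_iff hilbert_mult_def)
  have "has_fourier_L2 (hilbert_tensor f) (hilbert_mult f)"
    unfolding hilbert_tensor_def eq
    using has_fourier_L2_hilbert_mult[OF f] by (rule someI[of "\<lambda>g. has_fourier_L2 g (hilbert_mult f)"])
  moreover from this have "has_fourier_L2 (hilbert_tensor f) (fourier_L2 (hilbert_tensor f))"
    unfolding fourier_L2_def by (rule someI[of "has_fourier_L2 (hilbert_tensor f)"])
  ultimately show "AE \<xi> in lborel. fourier_L2 (hilbert_tensor f) \<xi> = hilbert_mult f \<xi>"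
    "fourier_L2 (hilbert_tensor f) \<in> borel_measurable borel"
    by (auto intro!: has_fourier_L2_unique simp: has_fourier_L2_def square_integrable_def)
qed

section \<open>Square functions of tensor product kernels\<close>

lemma borel_measurable_vec_component [measurable (raw)]:
  assumes "f \<in> borel_measurable M"
  shows "(\<lambda>x. (f x :: real^'n::finite) $ i) \<in> borel_measurable M"
  by (rule measurable_compose[OF assms borel_measurable_continuous_onI]) (intro continuous_intros)

text \<open>These are the pairs of frequencies at which the correlation formula of
  \<open>mellin_kernel\<close> is available in every coordinate.\<close>

lemma AE_pair_components_generic:
  "AE p in lborel. \<forall>i. fst p $ i \<noteq> 0 \<and> snd p $ i \<noteq> 0 \<and> \<bar>fst p $ i\<bar> \<noteq> \<bar>(snd p :: real^'n::finite) $ i\<bar>"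
  unfolding lborel_prod[symmetric]
proof (rule lborel_pair.AE_pair_measure)
  show "AE x in lborel. AE y in lborel. \<forall>i. fst (x, y) $ i \<noteq> 0 \<and> snd (x, y) $ i \<noteq> 0 \<and> \<bar>fst (x, y) $ i\<bar> \<noteq> \<bar>(snd (x, y) :: real^'n) $ i\<bar>"
    using AE_components_neq[of "\<lambda>_. 0"]
  proof eventually_elim
    case (elim x)
    from AE_components_neq[of "\<lambda>_. 0"] AE_components_neq[of "\<lambda>i. x $ i"] AE_components_neq[of "\<lambda>i. - (x $ i)"]
    show ?case
    proof eventually_elim
      case (elim y)
      then have "\<bar>x $ i\<bar> \<noteq> \<bar>y $ i\<bar>" for i
        using spec[of _ i] unfolding abs_eq_iff by (metis minus_minus)
      with elim \<open>\<forall>i. x $ i \<noteq> 0\<close> show ?case by simp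
    qed
  qed
qed measurable

text \<open>What one coordinate must provide. \<open>N t b\<close> is the kernel at frequency
  \<open>b\<close> and scale \<open>t\<close>, with the measure dt/t absorbed as a factor 1 / sqrt t
  and extended by 0 to t <= 0 in the instances. \<open>Q\<close> is the squared modulus of the
  Mellin transform, and the signs in the correlation reflect oddness in \<open>b\<close>.\<close>

locale mellin_kernel =
  fixes N :: "real \<Rightarrow> real \<Rightarrow> real" and Q :: "real \<Rightarrow> real" and C :: real
  assumes N_measurable: "case_prod N \<in> borel_measurable borel"
    and N_square_integrable: "b \<noteq> 0 \<Longrightarrow> integrable lborel (\<lambda>t. (N t b)\<^sup>2)"
    and N_square_integral: "b \<noteq> 0 \<Longrightarrow> (LINT t|lborel. (N t b)\<^sup>2) \<le> C"
    and Q_integrable: "integrable lborel Q"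
    and N_correlation: "b \<noteq> 0 \<Longrightarrow> c \<noteq> 0 \<Longrightarrow> \<bar>b\<bar> \<noteq> \<bar>c\<bar> \<Longrightarrow>
      complex_of_real (LINT t|lborel. N t b * N t c) =
      of_real (sgn b * sgn c) * (LINT l|lborel. of_real (Q l) * cis (2 * pi * l * (ln \<bar>b\<bar> - ln \<bar>c\<bar>)))"
begin

lemma C_nonneg: "0 \<le> C"
  using N_square_integral[of 1] by (rule order_trans[rotated]) auto

lemma N_measurable' [measurable (raw)]:
  assumes "f \<in> borel_measurable M" "g \<in> borel_measurable M"
  shows "(\<lambda>x. N (f x) (g x)) \<in> borel_measurable M"
  using measurable_compose[OF borel_measurable_Pair[OF assms] N_measurable] by simp

text \<open>The bound does not depend on \<open>b\<close> and \<open>c\<close>; this uniformity is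
  what makes the integral over both frequencies and the scale absolutely convergent.\<close>

lemma N_product:
  assumes "b \<noteq> 0" "c \<noteq> 0"
  shows "integrable lborel (\<lambda>t. N t b * N t c)" "(LINT t|lborel. \<bar>N t b * N t c\<bar>) \<le> C"
proof -
  have bd: "\<bar>N t b * N t c\<bar> \<le> ((N t b)\<^sup>2 + (N t c)\<^sup>2) / 2" for t
    using sum_squares_bound[of "\<bar>N t b\<bar>" "\<bar>N t c\<bar>"] by (simp add: abs_mult)
  have int: "integrable lborel (\<lambda>t. ((N t b)\<^sup>2 + (N t c)\<^sup>2) / 2)"
    using assms N_square_integrable by simp
  show *: "integrable lborel (\<lambda>t. N t b * N t c)"
    by (rule Bochner_Integration.integrable_bound[OF int]) (use bd in \<open>auto intro: order_trans[OF _ abs_ge_self]\<close>)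
  have "(LINT t|lborel. \<bar>N t b * N t c\<bar>) \<le> (LINT t|lborel. ((N t b)\<^sup>2 + (N t c)\<^sup>2) / 2)"
    by (rule integral_mono') (use int bd in auto)
  also have "\<dots> = ((LINT t|lborel. (N t b)\<^sup>2) + (LINT t|lborel. (N t c)\<^sup>2)) / 2"
    using assms N_square_integrable by simp
  also have "\<dots> \<le> C"
    using N_square_integral[OF assms(1)] N_square_integral[OF assms(2)] by simp
  finally show "(LINT t|lborel. \<bar>N t b * N t c\<bar>) \<le> C" .
qed

end

text \<open>The phase is the product of |xi_i|^(2 pi i l_i). The measure is dxi and not dxi/|xi|, so
  this is a Mellin transform on the line of real part 1.\<close>

definition multi_mellin :: "(real^'n::finite \<Rightarrow> complex) \<Rightarrow> real^'n \<Rightarrow> complex" where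
  "multi_mellin E l = (LINT \<xi>|lborel. E \<xi> * of_real (\<Prod>i\<in>UNIV. sgn (\<xi> $ i)) *
     cis (\<Sum>i\<in>UNIV. 2 * pi * l $ i * ln \<bar>\<xi> $ i\<bar>))"

lemma norm_mult_sgn_cis_le:
  "norm (c * of_real (\<Prod>i\<in>UNIV. sgn ((\<xi> :: real^'n::finite) $ i)) * cis \<theta>) \<le> norm c"
proof -
  have "\<bar>\<Prod>i\<in>UNIV. sgn (\<xi> $ i)\<bar> \<le> 1"
    unfolding abs_prod by (intro prod_le_1) (auto simp: sgn_if)
  then show ?thesis
    by (simp only: norm_mult norm_of_real norm_cis mult_1_right) (simp add: mult_left_le)
qed

text \<open>Fubini is applied twice to pairs p = (xi, eta), with different majorants: |E(xi) E(eta)|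
  times the product of the \<open>C i\<close> when the scale is integrated first, and |E(xi) E(eta)|
  |Q(l)| when the integral over l is pulled out. Between the two, \<open>N_correlation\<close>
  replaces the scale integral coordinate by coordinate, and the phases split into one factor for xi
  and the conjugate one for eta.\<close>

lemma
  fixes E :: "real^'n::finite \<Rightarrow> complex" and N :: "'n \<Rightarrow> real \<Rightarrow> real \<Rightarrow> real"
  assumes E: "integrable lborel E" and N: "\<And>i. mellin_kernel (N i) (Q i) (C i)"
  defines "F \<equiv> \<lambda>t::real^'n. LINT \<xi>|lborel. E \<xi> * of_real (\<Prod>i\<in>UNIV. N i (t $ i) (\<xi> $ i))"
  shows mellin_kernel_integrable: "integrable lborel (\<lambda>t. (norm (F t))\<^sup>2)"
    and mellin_kernel_identity: "(LINT t|lborel. (norm (F t))\<^sup>2) =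
      (LINT l|lborel. (\<Prod>i\<in>UNIV. Q i (l $ i)) * (norm (multi_mellin E l))\<^sup>2)"
proof -
  note Nm [measurable (raw)] = mellin_kernel.N_measurable'[OF N]
  have Em [measurable]: "E \<in> borel_measurable borel" using E by auto
  define K where "K p t = E (fst p) * cnj (E (snd p)) *
    of_real (\<Prod>i\<in>UNIV. N i (t $ i) (fst p $ i) * N i (t $ i) (snd p $ i))" for p :: "(real^'n) \<times> (real^'n)" and t :: "real^'n"
  have Km: "(\<lambda>(p,t). K p t) \<in> borel_measurable (lborel \<Otimes>\<^sub>M lborel)"
    unfolding K_def lborel_prod by (simp add: case_prod_unfold flip: borel_prod)
  let ?gen = "\<lambda>p::(real^'n) \<times> (real^'n). \<forall>i. fst p $ i \<noteq> 0 \<and> snd p $ i \<noteq> 0 \<and> \<bar>fst p $ i\<bar> \<noteq> \<bar>snd p $ i\<bar>"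
  have Kt: "integrable lborel (K p)"
    "(LINT t|lborel. norm (K p t)) \<le> norm (E (fst p)) * norm (E (snd p)) * (\<Prod>i\<in>UNIV. C i)"
    "(LINT t|lborel. K p t) = E (fst p) * cnj (E (snd p)) * (\<Prod>i\<in>UNIV. of_real (LINT t|lborel. N i t (fst p $ i) * N i t (snd p $ i)))"
    if "?gen p" for p
  proof -
    let ?n = "\<lambda>i t. N i t (fst p $ i) * N i t (snd p $ i)"
    have int: "integrable lborel (\<lambda>t. ?n i t)" for i
      using that by (intro mellin_kernel.N_product[OF N]) auto
    have int1: "integrable lborel (\<lambda>t. \<Prod>i\<in>UNIV. ?n i (t $ i))"
      by (rule integrable_lborel_prod_vec[of ?n, OF int])
    then show "integrable lborel (K p)"
      unfolding K_def by (intro integrable_mult_right integrable_of_real)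
    have "(LINT t|lborel. norm (K p t)) = norm (E (fst p)) * norm (E (snd p)) *
       (LINT t::real^'n|lborel. (\<Prod>i\<in>UNIV. \<bar>?n i (t $ i)\<bar>))"
      unfolding K_def by (simp only: norm_mult norm_of_real complex_mod_cnj abs_prod mult.assoc integral_mult_right_zero)
    also have "(LINT t::real^'n|lborel. (\<Prod>i\<in>UNIV. \<bar>?n i (t $ i)\<bar>)) =
      (\<Prod>i\<in>UNIV. LINT t|lborel. \<bar>?n i t\<bar>)"
      using int by (intro integral_lborel_prod_vec[of "\<lambda>i t. \<bar>?n i t\<bar>"] integrable_abs)
    also have "norm (E (fst p)) * norm (E (snd p)) * \<dots> \<le> norm (E (fst p)) * norm (E (snd p)) * (\<Prod>i\<in>UNIV. C i)"
      using that by (intro mult_left_mono prod_mono conjI mellin_kernel.N_product[OF N]) auto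
    finally show "(LINT t|lborel. norm (K p t)) \<le> norm (E (fst p)) * norm (E (snd p)) * (\<Prod>i\<in>UNIV. C i)" .
    have "(LINT t|lborel. K p t) = E (fst p) * cnj (E (snd p)) *
       of_real (LINT t::real^'n|lborel. (\<Prod>i\<in>UNIV. ?n i (t $ i)))"
      unfolding K_def by (simp only: integral_mult_right_zero integral_complex_of_real)
    also have "(LINT t::real^'n|lborel. (\<Prod>i\<in>UNIV. ?n i (t $ i))) =
      (\<Prod>i\<in>UNIV. LINT t|lborel. ?n i t)"
      by (rule integral_lborel_prod_vec[of ?n, OF int])
    finally show "(LINT t|lborel. K p t) = E (fst p) * cnj (E (snd p)) * (\<Prod>i\<in>UNIV. of_real (LINT t|lborel. ?n i t))"
      by simp
  qed
  have EE: "integrable lborel (\<lambda>p. E (fst p) * cnj (E (snd p)))"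
    using lborel_pair.integrable_pair_mult[OF E integrable_cnj[OF E]]
    by (simp add: lborel_prod case_prod_unfold)
  have pairK: "integrable (lborel \<Otimes>\<^sub>M lborel) (\<lambda>(p,t). K p t)"
  proof (rule lborel_pair.Fubini_integrable[OF Km])
    show "AE p in lborel. integrable lborel (\<lambda>t. case (p, t) of (p, t) \<Rightarrow> K p t)"
      using AE_pair_components_generic by eventually_elim (simp add: Kt)
    show "integrable lborel (\<lambda>p. LINT t|lborel. norm (case (p, t) of (p, t) \<Rightarrow> K p t))"
    proof (rule Bochner_Integration.integrable_bound[OF integrable_mult_left[OF integrable_norm[OF EE], of "\<Prod>i\<in>UNIV. C i"]])
      show "(\<lambda>p. LINT t|lborel. norm (case (p, t) of (p, t) \<Rightarrow> K p t)) \<in> borel_measurable lborel"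
        using Km by (simp add: case_prod_unfold) measurable
      show "AE p in lborel. norm (LINT t|lborel. norm (case (p, t) of (p, t) \<Rightarrow> K p t)) \<le>
          norm (norm (E (fst p) * cnj (E (snd p))) * (\<Prod>i\<in>UNIV. C i))"
        using AE_pair_components_generic
      proof eventually_elim
        case (elim p)
        have "(\<Prod>i\<in>UNIV. C i) \<ge> 0" by (intro prod_nonneg mellin_kernel.C_nonneg[OF N])
        with Kt(2)[OF elim] show ?case
          by (simp add: norm_mult abs_mult)
      qed
    qed
  qed
  \<comment> \<open>Only for almost every t is the slice known to be integrable in p; there the
    integral over pairs factors as F(t) times its conjugate.\<close>
  have Ft: "AE t in lborel. (LINT p|lborel. K p t) = of_real ((norm (F t))\<^sup>2)"
    using lborel_pair.AE_integrable_snd[OF pairK]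
  proof eventually_elim
    case (elim t)
    let ?a = "\<lambda>\<xi>. E \<xi> * of_real (\<Prod>i\<in>UNIV. N i (t $ i) (\<xi> $ i))"
    have Kp: "K p t = ?a (fst p) * cnj (?a (snd p))" for p
      unfolding K_def by (simp add: prod.distrib mult_ac)
    have "(LINT p|lborel. K p t) = (LINT p|(lborel \<Otimes>\<^sub>M lborel). K p t)" by (simp add: lborel_prod)
    also have "\<dots> = (LINT \<xi>|lborel. LINT \<eta>|lborel. K (\<xi>, \<eta>) t)"
      using elim by (intro lborel_pair.integral_fst'[symmetric]) (simp add: lborel_prod)
    also have "\<dots> = F t * cnj (F t)"
      unfolding Kp F_def fst_conv snd_conv integral_mult_right_zero integral_mult_left_zero Bochner_Integration.integral_cnj ..
    finally show ?case by (simp only: complex_norm_square)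
  qed
  have Fm: "F \<in> borel_measurable borel"
  proof -
    have "F \<in> borel_measurable lborel"
      unfolding F_def by (rule lborel.borel_measurable_lebesgue_integral) (simp add: case_prod_unfold)
    then show ?thesis by simp
  qed
  have Ki: "integrable lborel (\<lambda>t. LINT p|lborel. K p t)"
    using lborel_pair.integrable_snd[OF pairK] by simp
  have "integrable lborel (\<lambda>t. complex_of_real ((norm (F t))\<^sup>2))"
    by (rule integrable_cong_AE_imp[OF Ki]) (use Ft Fm in \<open>auto simp del: of_real_power\<close>)
  then show "integrable lborel (\<lambda>t. (norm (F t))\<^sup>2)"
    unfolding complex_of_real_integrable_eq .
  define QQ where "QQ l = (\<Prod>i\<in>UNIV. Q i (l $ i))" for l :: "real^'n"
  have QQ: "integrable lborel QQ"
    unfolding QQ_def by (intro integrable_lborel_prod_vec mellin_kernel.Q_integrable[OF N])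
  define a where "a l \<xi> = E \<xi> * of_real (\<Prod>i\<in>UNIV. sgn (\<xi> $ i)) * cis (\<Sum>i\<in>UNIV. 2 * pi * l $ i * ln \<bar>\<xi> $ i\<bar>)" for l \<xi> :: "real^'n"
  have na: "norm (a l \<xi>) \<le> norm (E \<xi>)" for l \<xi>
    unfolding a_def by (rule norm_mult_sgn_cis_le)
  have ai: "integrable lborel (a l)" for l
  proof (rule Bochner_Integration.integrable_bound[OF integrable_norm[OF E]])
    show "a l \<in> borel_measurable lborel" unfolding a_def[abs_def] by measurable
  qed (simp add: na)
  have fub: "integrable (lborel \<Otimes>\<^sub>M lborel) (\<lambda>(p, l). of_real (QQ l) * (a l (fst p) * cnj (a l (snd p))))"
  proof (rule Bochner_Integration.integrable_bound)
    show "integrable (lborel \<Otimes>\<^sub>M lborel) (\<lambda>(p, l). (E (fst p) * cnj (E (snd p))) * complex_of_real (QQ l))"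
      by (intro lborel_pair.integrable_pair_mult EE integrable_of_real QQ)
    have [measurable]: "QQ \<in> borel_measurable borel" using QQ by auto
    show "(\<lambda>(p, l). of_real (QQ l) * (a l (fst p) * cnj (a l (snd p)))) \<in> borel_measurable (lborel \<Otimes>\<^sub>M lborel)"
      unfolding a_def lborel_prod by (simp add: case_prod_unfold flip: borel_prod)
    show "AE x in lborel \<Otimes>\<^sub>M lborel. norm (case x of (p, l) \<Rightarrow> of_real (QQ l) * (a l (fst p) * cnj (a l (snd p))))
        \<le> norm (case x of (p, l) \<Rightarrow> (E (fst p) * cnj (E (snd p))) * complex_of_real (QQ l))"
      by (intro AE_I2) (auto simp: norm_mult mult.commute[of _ "\<bar>QQ _\<bar>"] intro!: mult_left_mono mult_mono na)
  qed
  have "complex_of_real (LINT t|lborel. (norm (F t))\<^sup>2) = (LINT t|lborel. LINT p|lborel. K p t)"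
    unfolding integral_complex_of_real[symmetric]
  proof (rule integral_cong_AE)
    show "(\<lambda>t. LINT p|lborel. K p t) \<in> borel_measurable lborel"
      using Ki by simp
    show "AE t in lborel. complex_of_real ((norm (F t))\<^sup>2) = (LINT p|lborel. K p t)"
      using Ft by eventually_elim (rule sym)
  qed (use Fm in simp)
  also have "\<dots> = (LINT p|lborel. LINT t|lborel. K p t)"
    by (rule lborel_pair.Fubini_integral[OF pairK])
  also have "\<dots> = (LINT p|lborel. LINT l|lborel. of_real (QQ l) * (a l (fst p) * cnj (a l (snd p))))"
  proof (rule integral_cong_AE)
    show "AE p in lborel. (LINT t|lborel. K p t) = (LINT l|lborel. of_real (QQ l) * (a l (fst p) * cnj (a l (snd p))))"
      using AE_pair_components_generic
    proof eventually_elim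
      case (elim p)
      define x y where "x = fst p" and "y = snd p"
      let ?e = "E x * cnj (E y) * of_real (\<Prod>i\<in>UNIV. sgn (x $ i) * sgn (y $ i))"
      let ?h = "\<lambda>i l. complex_of_real (Q i l) * cis (2 * pi * l * (ln \<bar>x $ i\<bar> - ln \<bar>y $ i\<bar>))"
      have "(LINT t|lborel. K p t) = E x * cnj (E y) * (\<Prod>i\<in>UNIV. of_real (sgn (x $ i) * sgn (y $ i)) *
          (LINT l|lborel. ?h i l))"
        unfolding Kt(3)[OF elim] x_def y_def
        by (intro arg_cong2[where f="(*)"] refl prod.cong mellin_kernel.N_correlation[OF N]) (use elim in auto)
      also have "\<dots> = ?e *
          (\<Prod>i\<in>UNIV. LINT l|lborel. ?h i l)"
        by (simp add: prod.distrib)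
      also have "(\<Prod>i\<in>UNIV. LINT l|lborel. ?h i l) =
        (LINT l::real^'n|lborel. (\<Prod>i\<in>UNIV. ?h i (l $ i)))"
        by (rule integral_lborel_prod_vec[symmetric, of ?h])
           (intro integrable_mult_cis integrable_of_real mellin_kernel.Q_integrable[OF N], measurable)
      also have "?e * \<dots> =
        (LINT l|lborel. ?e *
          (\<Prod>i\<in>UNIV. ?h i (l $ i)))"
        by (rule integral_mult_right_zero[symmetric])
      also have "\<dots> = (LINT l|lborel. of_real (QQ l) * (a l (fst p) * cnj (a l (snd p))))"
      proof (rule Bochner_Integration.integral_cong[OF refl])
        fix l :: "real^'n"
        have "(\<Prod>i\<in>UNIV. ?h i (l $ i)) =
          of_real (QQ l) * cis (\<Sum>i\<in>UNIV. 2 * pi * l $ i * (ln \<bar>x $ i\<bar> - ln \<bar>y $ i\<bar>))"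
          by (simp add: prod.distrib QQ_def cis_sum)
        also have "(\<Sum>i\<in>UNIV. 2 * pi * l $ i * (ln \<bar>x $ i\<bar> - ln \<bar>y $ i\<bar>)) =
          (\<Sum>i\<in>UNIV. 2 * pi * l $ i * ln \<bar>x $ i\<bar>) + - (\<Sum>i\<in>UNIV. 2 * pi * l $ i * ln \<bar>y $ i\<bar>)"
          by (simp add: right_diff_distrib sum_subtractf)
        also have "cis \<dots> = cis (\<Sum>i\<in>UNIV. 2 * pi * l $ i * ln \<bar>x $ i\<bar>) * cnj (cis (\<Sum>i\<in>UNIV. 2 * pi * l $ i * ln \<bar>y $ i\<bar>))"
          by (simp only: cis_mult cis_cnj)
        finally show "?e *
          (\<Prod>i\<in>UNIV. ?h i (l $ i)) =
          of_real (QQ l) * (a l (fst p) * cnj (a l (snd p)))"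
          by (simp add: a_def x_def y_def prod.distrib mult_ac)
      qed
      finally show ?case .
    qed
    show "(\<lambda>p. LINT t|lborel. K p t) \<in> borel_measurable lborel"
      using lborel_pair.integrable_fst[OF pairK] by (simp add: borel_measurable_integrable)
    show "(\<lambda>p. LINT l|lborel. of_real (QQ l) * (a l (fst p) * cnj (a l (snd p)))) \<in> borel_measurable lborel"
      using lborel_pair.integrable_fst[OF fub] by (simp add: borel_measurable_integrable)
  qed
  also have "\<dots> = (LINT l|lborel. LINT p|lborel. of_real (QQ l) * (a l (fst p) * cnj (a l (snd p))))"
    by (rule lborel_pair.Fubini_integral[OF fub, symmetric])
  also have "\<dots> = (LINT l|lborel. of_real (QQ l * (norm (multi_mellin E l))\<^sup>2))"
  proof (rule Bochner_Integration.integral_cong[OF refl])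
    fix l :: "real^'n"
    have "(LINT p|lborel. a l (fst p) * cnj (a l (snd p))) = (LINT p|(lborel \<Otimes>\<^sub>M lborel). a l (fst p) * cnj (a l (snd p)))"
      by (simp add: lborel_prod)
    also have "\<dots> = (LINT \<xi>|lborel. LINT \<eta>|lborel. a l (fst (\<xi>, \<eta>)) * cnj (a l (snd (\<xi>, \<eta>))))"
      using lborel_pair.integrable_pair_mult[OF ai integrable_cnj[OF ai]]
      by (intro lborel_pair.integral_fst'[symmetric]) (simp add: case_prod_unfold)
    also have "\<dots> = multi_mellin E l * cnj (multi_mellin E l)"
      unfolding fst_conv snd_conv integral_mult_right_zero integral_mult_left_zero Bochner_Integration.integral_cnj
        multi_mellin_def a_def ..
    finally show "(LINT p|lborel. of_real (QQ l) * (a l (fst p) * cnj (a l (snd p)))) = of_real (QQ l * (norm (multi_mellin E l))\<^sup>2)"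
      by (simp add: complex_norm_square del: of_real_power)
  qed
  finally show "(LINT t|lborel. (norm (F t))\<^sup>2) =
      (LINT l|lborel. (\<Prod>i\<in>UNIV. Q i (l $ i)) * (norm (multi_mellin E l))\<^sup>2)"
    unfolding QQ_def integral_complex_of_real of_real_eq_iff .
qed

section \<open>Kernels commuting with dilations\<close>

text \<open>The substitution t = exp u, with du = dt/t, as an identity of measures. The substitution
  rule is used on the compact intervals from -k to k, and monotone convergence exhausts the
  line.\<close>

lemma distr_lborel_exp: "distr lborel borel exp = density lborel (\<lambda>t::real. ennreal (indicator {0<..} t / t))"
proof (rule measure_eqI)
  fix A :: "real set"
  assume "A \<in> sets (distr lborel borel exp)"
  then have [measurable]: "A \<in> sets borel" by simp
  have eq: "(\<integral>\<^sup>+t. ennreal (indicator A t / t) * indicator {exp (- real k)..exp (real k)} t \<partial>lborel) =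
      (\<integral>\<^sup>+u. indicator A (exp u) * indicator {- real k..real k} u \<partial>lborel)" for k
  proof -
    have "(\<integral>\<^sup>+t. ennreal (indicator A t / t) * indicator {exp (- real k)..exp (real k)} t \<partial>lborel) =
      (\<integral>\<^sup>+u. ennreal (indicator A (exp u) / exp u * exp u * indicator {- real k..real k} u) \<partial>lborel)"
    proof (subst nn_integral_substitution[where g=exp and g'=exp and a="- real k" and b="real k", symmetric])
      show "set_borel_measurable borel {exp (- real k)..exp (real k)} (\<lambda>t. indicator A t / t)"
        unfolding set_borel_measurable_def by measurable
    qed (auto intro!: derivative_eq_intros continuous_intros nn_integral_cong simp: indicator_def)
    also have "\<dots> = (\<integral>\<^sup>+u. indicator A (exp u) * indicator {- real k..real k} u \<partial>lborel)"
      by (intro nn_integral_cong) (auto simp: indicator_def)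
    finally show ?thesis .
  qed
  have lim1: "(\<lambda>k. \<integral>\<^sup>+u. indicator A (exp u) * indicator {- real k..real k} u \<partial>lborel) \<longlonglongrightarrow>
     (\<integral>\<^sup>+u. indicator A (exp u) \<partial>lborel)"
  proof (rule nn_integral_LIMSEQ)
    show "incseq (\<lambda>k u. (indicator A (exp u) :: ennreal) * indicator {- real k..real k} u)"
      by (auto simp: incseq_def le_fun_def indicator_def)
    fix u :: real
    obtain N :: nat where N: "\<bar>u\<bar> \<le> real N" using real_arch_simple by blast
    show "(\<lambda>k. (indicator A (exp u) :: ennreal) * indicator {- real k..real k} u) \<longlonglongrightarrow> indicator A (exp u)"
      by (rule tendsto_eventually, rule eventually_sequentiallyI[of N]) (use N in \<open>auto simp: indicator_def\<close>)
  qed measurable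
  have lim2: "(\<lambda>k. \<integral>\<^sup>+t. ennreal (indicator A t / t) * indicator {exp (- real k)..exp (real k)} t \<partial>lborel) \<longlonglongrightarrow>
     (\<integral>\<^sup>+t. ennreal (indicator {0<..} t / t) * indicator A t \<partial>lborel)"
  proof (rule nn_integral_LIMSEQ)
    show "incseq (\<lambda>k t. ennreal (indicator A t / t) * indicator {exp (- real k)..exp (real k)} t)"
      unfolding incseq_def le_fun_def
      by (auto simp: indicator_def) (meson exp_le_cancel_iff neg_le_iff_le of_nat_le_iff order_trans)+
    fix t :: real
    show "(\<lambda>k. ennreal (indicator A t / t) * indicator {exp (- real k)..exp (real k)} t) \<longlonglongrightarrow>
      ennreal (indicator {0<..} t / t) * indicator A t"
    proof (cases "t > 0")
      case True
      obtain N :: nat where N: "\<bar>ln t\<bar> \<le> real N" using real_arch_simple by blast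
      show ?thesis
      proof (rule tendsto_eventually, rule eventually_sequentiallyI[of N])
        fix k assume "N \<le> k"
        with N True have "exp (- real k) \<le> exp (ln t)" "exp (ln t) \<le> exp (real k)"
          unfolding exp_le_cancel_iff by auto
        then show "ennreal (indicator A t / t) * indicator {exp (- real k)..exp (real k)} t =
            ennreal (indicator {0<..} t / t) * indicator A t"
          using True by (auto simp: indicator_def)
      qed
    next
      case False
      then have "\<not> exp x \<le> t" for x using exp_gt_zero[of x] by linarith
      with False show ?thesis by (auto simp: indicator_def)
    qed
  qed measurable
  have "emeasure (distr lborel borel exp) A = (\<integral>\<^sup>+t. indicator A t \<partial>distr lborel borel (exp :: real \<Rightarrow> real))"
    by simp
  also have "\<dots> = (\<integral>\<^sup>+u. indicator A (exp u) \<partial>lborel)"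
    by (rule nn_integral_distr) measurable
  also have "\<dots> = (\<integral>\<^sup>+t. ennreal (indicator {0<..} t / t) * indicator A t \<partial>lborel)"
    using lim1 lim2 unfolding eq by (rule LIMSEQ_unique)
  finally show "emeasure (distr lborel borel exp) A = emeasure (density lborel (\<lambda>t. ennreal (indicator {0<..} t / t))) A"
    by (simp add: emeasure_density)
qed simp

lemma
  fixes h :: "real \<Rightarrow> 'b::{banach, second_countable_topology}"
  assumes [measurable]: "h \<in> borel_measurable borel"
  shows integrable_exp_iff: "integrable lborel (\<lambda>u. h (exp u)) \<longleftrightarrow> integrable lborel (\<lambda>t. (indicator {0<..} t / t) *\<^sub>R h t)"
    and integral_exp_eq: "(LINT u|lborel. h (exp u)) = (LINT t|lborel. (indicator {0<..} t / t) *\<^sub>R h t)"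
proof -
  have [simp]: "AE t in lborel. 0 \<le> indicator {0<..} t / (t::real)"
    by (auto simp: indicator_def)
  show "integrable lborel (\<lambda>u. h (exp u)) \<longleftrightarrow> integrable lborel (\<lambda>t. (indicator {0<..} t / t) *\<^sub>R h t)"
    by (subst integrable_distr_eq[symmetric, of exp lborel borel]) (simp_all add: distr_lborel_exp integrable_density)
  show "(LINT u|lborel. h (exp u)) = (LINT t|lborel. (indicator {0<..} t / t) *\<^sub>R h t)"
    by (subst integral_distr[symmetric, of exp lborel borel]) (simp_all add: distr_lborel_exp integral_density)
qed

text \<open>The integral of kappa(t) t^(-2 pi i l) dt/t over the positive half-line: the Mellin
  transform on the imaginary axis.\<close>

definition mel :: "(real \<Rightarrow> real) \<Rightarrow> real \<Rightarrow> complex" where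
  "mel \<kappa> = ft (\<lambda>u. complex_of_real (\<kappa> (exp u)))"

text \<open>With t = exp u the kernels are translates k(u + ln|b|) and k(ln|b| - u), up to sgn b.
  The correlation of two of them is in either case the autocorrelation of k at ln|b| - ln|c|, whence
  the same \<open>Q\<close> for dilation by t and by 1/t. Continuity away from 0 suffices because
  |b| and |c| differ in the correlation formula.\<close>

lemma
  fixes \<kappa> :: "real \<Rightarrow> real"
  assumes meas [measurable]: "\<kappa> \<in> borel_measurable borel" and odd: "\<And>r. \<kappa> (- r) = - \<kappa> r"
    and int: "integrable lborel (\<lambda>u. \<kappa> (exp u))" and int2: "integrable lborel (\<lambda>u. (\<kappa> (exp u))\<^sup>2)"
    and cont: "\<And>z. z \<noteq> 0 \<Longrightarrow> isCont (autocorr (\<lambda>u. complex_of_real (\<kappa> (exp u)))) z"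
  shows mellin_kernel_mult: "mellin_kernel (\<lambda>t b. if 0 < t then \<kappa> (t * b) / sqrt t else 0)
      (\<lambda>l. (norm (mel \<kappa> l))\<^sup>2) (LINT u|lborel. (\<kappa> (exp u))\<^sup>2)" (is "mellin_kernel ?N ?Q ?C")
    and mellin_kernel_divide: "mellin_kernel (\<lambda>t b. if 0 < t then \<kappa> (b / t) / sqrt t else 0)
      (\<lambda>l. (norm (mel \<kappa> l))\<^sup>2) (LINT u|lborel. (\<kappa> (exp u))\<^sup>2)" (is "mellin_kernel ?N' _ _")
proof -
  define k where "k u = \<kappa> (exp u)" for u
  define \<phi> where "\<phi> = (\<lambda>u. complex_of_real (k u))"
  have km [measurable]: "k \<in> borel_measurable borel" unfolding k_def by measurable
  have k2: "integrable lborel (\<lambda>u. (k u)\<^sup>2)" using int2 by (simp add: k_def)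
  have \<phi>: "integrable lborel \<phi>" using int by (simp add: \<phi>_def k_def)
  define corr where "corr z = (LINT u|lborel. k (u + z) * k u)" for z
  have ac: "autocorr \<phi> z = of_real (corr z)" for z
    by (simp add: autocorr_def \<phi>_def corr_def flip: of_real_mult)
  have k2t: "integrable lborel (\<lambda>u. (k (u + z))\<^sup>2)" for z
    using k2 lborel_integrable_translate[of "\<lambda>u. (k u)\<^sup>2"] by simp
  have kk: "integrable lborel (\<lambda>u. k (u + z) * k (u + y))" for y z
  proof (rule Bochner_Integration.integrable_bound[OF Bochner_Integration.integrable_add[OF k2t[of z] k2t[of y]]])
    show "AE u in lborel. norm (k (u + z) * k (u + y)) \<le> norm ((k (u + z))\<^sup>2 + (k (u + y))\<^sup>2)"
    proof (rule AE_I2)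
      fix u
      have "2 * \<bar>k (u + z) * k (u + y)\<bar> \<le> (k (u + z))\<^sup>2 + (k (u + y))\<^sup>2"
        using sum_squares_bound[of "\<bar>k (u + z)\<bar>" "\<bar>k (u + y)\<bar>"] by (simp add: abs_mult)
      then show "norm (k (u + z) * k (u + y)) \<le> norm ((k (u + z))\<^sup>2 + (k (u + y))\<^sup>2)" by simp
    qed
  qed simp
  \<comment> \<open>Cauchy-Schwarz for two functions of equal norm: 2 x y <= x^2 + y^2 and
    translation invariance give \<open>?C\<close> without loss.\<close>
  have bound: "norm (autocorr \<phi> z) \<le> ?C" for z
  proof -
    have "\<bar>corr z\<bar> \<le> (LINT u|lborel. \<bar>k (u + z) * k u\<bar>)"
      unfolding corr_def by (rule integral_abs_bound)
    also have "\<dots> \<le> (LINT u|lborel. ((k (u + z))\<^sup>2 + (k u)\<^sup>2) / 2)"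
    proof (rule integral_mono')
      show "\<bar>k (u + z) * k u\<bar> \<le> ((k (u + z))\<^sup>2 + (k u)\<^sup>2) / 2" for u
        using sum_squares_bound[of "\<bar>k (u + z)\<bar>" "\<bar>k u\<bar>"] by (simp add: abs_mult)
    qed (use k2 k2t in auto)
    also have "\<dots> = ?C"
      using k2 k2t lborel_integral_translate[of "\<lambda>u. (k u)\<^sup>2" z] by (simp add: k_def)
    finally show ?thesis by (simp add: ac)
  qed
  have Q: "integrable lborel ?Q"
    using integrable_norm_ft_square[OF \<phi> bound] by (simp add: mel_def \<phi>_def k_def)
  have corr: "complex_of_real (corr z) = (LINT l|lborel. of_real (?Q l) * cis (2 * pi * l * z))" if "z \<noteq> 0" for z
    using autocorr_eq_integral[OF \<phi> bound, of z] cont[OF that]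
    unfolding ac[symmetric] by (simp add: mel_def \<phi>_def k_def mult_ac)
  have translate: "(LINT u|lborel. k (u + x) * k (u + y)) = corr (x - y)" for x y
    using lborel_integral_translate[of "\<lambda>u. k (u + (x - y)) * k u" y] by (simp add: corr_def add_ac)
  have reflect: "(LINT u|lborel. k (x - u) * k (y - u)) = corr (x - y)" for x y
    using lborel_integral_reflect[of "\<lambda>u. k (u + (x - y)) * k u" y] by (simp add: corr_def algebra_simps)
  have reflecti: "integrable lborel (\<lambda>u. k (x - u) * k (y - u))" for x y
    using lborel_integrable_reflect[of "\<lambda>u. k (u + (x - y)) * k (u + 0)" y] kk[of "x - y" 0] by (simp add: algebra_simps)
  have \<kappa>_mult: "\<kappa> (exp u * b) = sgn b * k (u + ln \<bar>b\<bar>)" and \<kappa>_div: "\<kappa> (b / exp u) = sgn b * k (ln \<bar>b\<bar> - u)"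
    if "b \<noteq> 0" for b u
  proof -
    have "exp (u + ln \<bar>b\<bar>) = exp u * \<bar>b\<bar>" "exp (ln \<bar>b\<bar> - u) = \<bar>b\<bar> / exp u"
      using that by (simp_all add: exp_add exp_diff)
    then show "\<kappa> (exp u * b) = sgn b * k (u + ln \<bar>b\<bar>)" "\<kappa> (b / exp u) = sgn b * k (ln \<bar>b\<bar> - u)"
      using that odd[of "exp u * b"] odd[of "b / exp u"] by (auto simp: k_def sgn_if abs_if)
  qed
  have N: "?N t b * ?N t c = (indicator {0<..} t / t) *\<^sub>R (\<kappa> (t * b) * \<kappa> (t * c))"
    and N': "?N' t b * ?N' t c = (indicator {0<..} t / t) *\<^sub>R (\<kappa> (b / t) * \<kappa> (c / t))" for t b c
    by (auto simp: indicator_def)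
  have Nint: "integrable lborel (\<lambda>t. ?N t b * ?N t c)"
    "(LINT t|lborel. ?N t b * ?N t c) = sgn b * sgn c * corr (ln \<bar>b\<bar> - ln \<bar>c\<bar>)"
    and N'int: "integrable lborel (\<lambda>t. ?N' t b * ?N' t c)"
    "(LINT t|lborel. ?N' t b * ?N' t c) = sgn b * sgn c * corr (ln \<bar>b\<bar> - ln \<bar>c\<bar>)" if "b \<noteq> 0" "c \<noteq> 0" for b c
  proof -
    have eq: "\<kappa> (exp u * b) * \<kappa> (exp u * c) = (sgn b * sgn c) * (k (u + ln \<bar>b\<bar>) * k (u + ln \<bar>c\<bar>))"
      "\<kappa> (b / exp u) * \<kappa> (c / exp u) = (sgn b * sgn c) * (k (ln \<bar>b\<bar> - u) * k (ln \<bar>c\<bar> - u))" for u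
      using that by (simp_all add: \<kappa>_mult \<kappa>_div)
    show "integrable lborel (\<lambda>t. ?N t b * ?N t c)"
      unfolding N by (subst integrable_exp_iff[symmetric], measurable) (simp only: eq, intro integrable_mult_right kk)
    show "(LINT t|lborel. ?N t b * ?N t c) = sgn b * sgn c * corr (ln \<bar>b\<bar> - ln \<bar>c\<bar>)"
      unfolding N by (subst integral_exp_eq[symmetric], measurable) (simp only: eq integral_mult_right_zero translate)
    show "integrable lborel (\<lambda>t. ?N' t b * ?N' t c)"
      unfolding N' by (subst integrable_exp_iff[symmetric], measurable) (simp only: eq, intro integrable_mult_right reflecti)
    show "(LINT t|lborel. ?N' t b * ?N' t c) = sgn b * sgn c * corr (ln \<bar>b\<bar> - ln \<bar>c\<bar>)"
      unfolding N' by (subst integral_exp_eq[symmetric], measurable) (simp only: eq integral_mult_right_zero reflect)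
  qed
  have corr0: "corr 0 = ?C"
    by (simp add: corr_def k_def power2_eq_square)
  have ln: "ln \<bar>b\<bar> - ln \<bar>c\<bar> \<noteq> 0" if "b \<noteq> 0" "c \<noteq> 0" "\<bar>b\<bar> \<noteq> \<bar>c\<bar>" for b c :: real
    using that by simp
  have sgn: "sgn b * sgn b = 1" if "b \<noteq> 0" for b :: real
    using that by (simp add: sgn_if)
  show "mellin_kernel ?N ?Q ?C"
  proof (standard, goal_cases)
    case 1 show ?case by (simp add: case_prod_unfold flip: borel_prod)
  next
    case (2 b) then show ?case unfolding power2_eq_square by (rule Nint(1)[OF _ 2])
  next
    case (3 b) then show ?case unfolding power2_eq_square[of "?N _ _"] Nint(2)[OF 3 3] sgn[OF 3] by (simp add: corr0)
  next
    case 4 show ?case by (rule Q)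
  next
    case (5 b c)
    show ?case unfolding Nint(2)[OF 5(1,2)] by (simp only: of_real_mult corr[OF ln[OF 5]])
  qed
  show "mellin_kernel ?N' ?Q ?C"
  proof (standard, goal_cases)
    case 1 show ?case by (simp add: case_prod_unfold flip: borel_prod)
  next
    case (2 b) then show ?case unfolding power2_eq_square by (rule N'int(1)[OF _ 2])
  next
    case (3 b) then show ?case unfolding power2_eq_square[of "?N' _ _"] N'int(2)[OF 3 3] sgn[OF 3] by (simp add: corr0)
  next
    case 4 show ?case by (rule Q)
  next
    case (5 b c)
    show ?case unfolding N'int(2)[OF 5(1,2)] by (simp only: of_real_mult corr[OF ln[OF 5]])
  qed
qed

lemma isCont_autocorr_bounded:
  fixes \<phi> :: "'a::euclidean_space \<Rightarrow> complex"
  assumes \<phi>: "integrable lborel \<phi>" and B: "\<And>x. norm (\<phi> x) \<le> B" and cont: "\<And>x. isCont \<phi> x"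
  shows "isCont (autocorr \<phi>) z"
  unfolding continuous_at_sequentially o_def
proof (intro allI impI)
  fix X :: "nat \<Rightarrow> 'a" assume X: "X \<longlonglongrightarrow> z"
  have [measurable]: "\<phi> \<in> borel_measurable borel" using \<phi> by auto
  show "(\<lambda>n. autocorr \<phi> (X n)) \<longlonglongrightarrow> autocorr \<phi> z"
    unfolding autocorr_def
  proof (rule integral_dominated_convergence[where w="\<lambda>y. B * norm (\<phi> y)"])
    show "AE y in lborel. (\<lambda>i. \<phi> (y + X i) * cnj (\<phi> y)) \<longlonglongrightarrow> \<phi> (y + z) * cnj (\<phi> y)"
      by (intro AE_I2 tendsto_intros isCont_tendsto_compose[OF cont] X)
  qed (use \<phi> in \<open>auto simp: norm_mult intro!: mult_right_mono B\<close>)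
qed

text \<open>Meant for a kernel with a singularity at 0 from the left. For z < 0 the shifted factor
  is evaluated at y + z with y < 0, at a positive distance from the singularity, where it is
  bounded; |k| times that bound dominates. For z > 0 the autocorrelation of a real function is
  even.\<close>

lemma isCont_autocorr_halfline:
  fixes k :: "real \<Rightarrow> real"
  assumes int: "integrable lborel k" and zero: "\<And>u. 0 \<le> u \<Longrightarrow> k u = 0" and cont: "\<And>u. u < 0 \<Longrightarrow> isCont k u"
    and bdd: "\<And>d. 0 < d \<Longrightarrow> \<exists>B. \<forall>u\<le>-d. \<bar>k u\<bar> \<le> B" and z: "z \<noteq> 0"
  shows "isCont (autocorr (\<lambda>u. complex_of_real (k u))) z"
proof -
  let ?\<phi> = "\<lambda>u. complex_of_real (k u)"
  have [measurable]: "k \<in> borel_measurable borel" using int by auto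
  have neg: "isCont (autocorr ?\<phi>) z" if z: "z < 0" for z
    unfolding continuous_at_sequentially o_def
  proof (intro allI impI)
    fix X :: "nat \<Rightarrow> real" assume X: "X \<longlonglongrightarrow> z"
    \<comment> \<open>Half the distance of z from 0, so that X n < -d from some index on and y + X n
      stays below -d for all y < 0.\<close>
    define d where "d = - z / 2"
    have d: "d > 0" using z by (simp add: d_def)
    obtain B where B: "\<And>u. u \<le> - d \<Longrightarrow> \<bar>k u\<bar> \<le> B" using bdd[OF d] by blast
    have B0: "0 \<le> B" using order_trans[OF abs_ge_zero B[OF order_refl]] .
    have "eventually (\<lambda>n. X n < - d) sequentially"
      using X z by (intro order_tendstoD(2)[OF X]) (simp add: d_def)
    then obtain M where M: "\<And>n. n \<ge> M \<Longrightarrow> X n < - d"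
      by (auto simp: eventually_sequentially)
    have "(\<lambda>n. autocorr ?\<phi> (X (n + M))) \<longlonglongrightarrow> autocorr ?\<phi> z"
      unfolding autocorr_def
    proof (rule integral_dominated_convergence[where w="\<lambda>y. B * \<bar>k y\<bar>"])
      show "AE y in lborel. (\<lambda>i. ?\<phi> (y + X (i + M)) * cnj (?\<phi> y)) \<longlonglongrightarrow> ?\<phi> (y + z) * cnj (?\<phi> y)"
      proof (rule AE_I2)
        fix y
        show "(\<lambda>i. ?\<phi> (y + X (i + M)) * cnj (?\<phi> y)) \<longlonglongrightarrow> ?\<phi> (y + z) * cnj (?\<phi> y)"
        proof (cases "y < 0")
          case True
          then have "isCont k (y + z)" using z by (intro cont) simp
          then show ?thesis
            by (intro tendsto_mult tendsto_const tendsto_of_real isCont_tendsto_compose[of "y + z" k] tendsto_add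
                LIMSEQ_ignore_initial_segment X)
        qed (simp add: zero)
      qed
      show "AE y in lborel. norm (?\<phi> (y + X (i + M)) * cnj (?\<phi> y)) \<le> B * \<bar>k y\<bar>" for i
      proof (rule AE_I2)
        fix y
        show "norm (?\<phi> (y + X (i + M)) * cnj (?\<phi> y)) \<le> B * \<bar>k y\<bar>"
        proof (cases "y < 0")
          case True
          then have "\<bar>k (y + X (i + M))\<bar> \<le> B" using M[of "i + M"] by (intro B) simp
          then show ?thesis by (simp add: norm_mult mult_right_mono)
        qed (simp add: zero)
      qed
    qed (use int in auto)
    then show "(\<lambda>n. autocorr ?\<phi> (X n)) \<longlonglongrightarrow> autocorr ?\<phi> z" by (rule LIMSEQ_offset)
  qed
  have even: "autocorr ?\<phi> x = autocorr ?\<phi> (- x)" for x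
    unfolding autocorr_def
    using lborel_integral_translate[of "\<lambda>y. ?\<phi> (y + - x) * cnj (?\<phi> y)" x] by (simp add: mult.commute)
  show ?thesis
  proof (cases "z < 0")
    case False
    then have "isCont (autocorr ?\<phi>) (- z)" using z by (intro neg) simp
    then have "isCont (\<lambda>x. autocorr ?\<phi> (- x)) z"
      by (rule isCont_o2[where f=uminus and g="autocorr ?\<phi>", rotated]) (intro continuous_intros)
    moreover have "(\<lambda>x. autocorr ?\<phi> (- x)) = autocorr ?\<phi>" by (rule ext) (rule even[symmetric])
    ultimately show ?thesis by simp
  qed (rule neg)
qed

section \<open>The Riesz and sine kernels\<close>

lemma
  fixes a c :: real
  assumes a: "a > 0" and c: "c \<ge> 0"
  shows integrable_powr_Icc: "integrable lborel (\<lambda>v. indicator {0..c} v * v powr (a - 1))"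
    and integral_powr_Icc: "(LINT v|lborel. indicator {0..c} v * v powr (a - 1)) = c powr a / a"
proof -
  have "((\<lambda>x. x powr (a - 1)) has_integral (c powr a / a)) {0..c}"
    using has_integral_powr_from_0[of "a - 1" c] a c by simp
  then have "((\<lambda>x. if x \<in> {0..c} then x powr (a - 1) else 0) has_integral (c powr a / a)) UNIV"
    by (simp only: has_integral_restrict_UNIV)
  also have "(\<lambda>x. if x \<in> {0..c} then x powr (a - 1) else 0) = (\<lambda>v. indicator {0..c} v * v powr (a - 1))"
    by (auto simp: fun_eq_iff indicator_def)
  finally have nn: "(\<integral>\<^sup>+v. ennreal (indicator {0..c} v * v powr (a - 1)) \<partial>lborel) = ennreal (c powr a / a)"
    by (intro nn_integral_has_integral_lborel) auto
  show int: "integrable lborel (\<lambda>v. indicator {0..c} v * v powr (a - 1))"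
    using nn by (intro integrableI_bounded) auto
  show "(LINT v|lborel. indicator {0..c} v * v powr (a - 1)) = c powr a / a"
    using nn a by (subst integral_eq_nn_integral) auto
qed

text \<open>The density of the Beta(1, a) distribution. Both one-dimensional kernels come from it:
  \<open>phi a\<close> is its odd extension and \<open>riesz a r\<close> is r times it for r >
  0.\<close>

definition jacobi :: "real \<Rightarrow> real \<Rightarrow> real" where
  "jacobi a y = indicator {0..1} y * (a * (1 - y) powr (a - 1))"

lemma jacobi_reflect: "jacobi a (1 - y) = a * (indicator {0..1} y * y powr (a - 1))"
  by (auto simp: jacobi_def indicator_def)

lemma jacobi_measurable [measurable]: "jacobi a \<in> borel_measurable borel"
  unfolding jacobi_def by measurable

lemma jacobi_nonneg: "a > 0 \<Longrightarrow> 0 \<le> jacobi a y"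
  by (simp add: jacobi_def)

lemma
  assumes a: "a > 0"
  shows integrable_jacobi: "integrable lborel (jacobi a)"
    and integral_jacobi: "integral\<^sup>L lborel (jacobi a) = 1"
proof -
  have "integrable lborel (\<lambda>y. jacobi a (1 - y))"
    unfolding jacobi_reflect by (intro integrable_mult_right integrable_powr_Icc a) simp
  then show "integrable lborel (jacobi a)" using lborel_integrable_reflect by blast
  have "integral\<^sup>L lborel (jacobi a) = (LINT y|lborel. jacobi a (1 - y))"
    by (rule lborel_integral_reflect[symmetric])
  then show "integral\<^sup>L lborel (jacobi a) = 1"
    unfolding jacobi_reflect integral_mult_right_zero using a by (simp add: integral_powr_Icc)
qed

text \<open>The one-dimensional multiplier of \<open>tau\<close>, which is R d/dR of (1 -
  |xi|/R)^beta, times the sign supplied by the Hilbert transform: |r| sgn r = r.\<close>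

definition riesz :: "real \<Rightarrow> real \<Rightarrow> real" where
  "riesz a r = a * r * (1 - \<bar>r\<bar>) powr (a - 1) * indicator {-1..1} r"

lemma riesz_measurable [measurable]: "riesz a \<in> borel_measurable borel"
  unfolding riesz_def by measurable

lemma riesz_odd: "riesz a (- r) = - riesz a r"
  by (auto simp: riesz_def indicator_def)

lemma riesz_eq_jacobi: "r > 0 \<Longrightarrow> riesz a r = r * jacobi a r"
  by (auto simp: riesz_def jacobi_def indicator_def)

lemma integrable_riesz_exp:
  assumes a: "a > 0" shows "integrable lborel (\<lambda>u. riesz a (exp u))"
proof (subst integrable_exp_iff)
  show "integrable lborel (\<lambda>t. (indicator {0<..} t / t) *\<^sub>R riesz a t)"
    by (rule Bochner_Integration.integrable_bound[OF integrable_jacobi[OF a]])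
       (auto simp: riesz_eq_jacobi indicator_def abs_mult)
qed simp

text \<open>The square behaves like (1 - t)^(2a - 2) at t = 1, that is like
  \<open>jacobi (2 * a - 1)\<close>. With a = alpha + 1/2 the assumption reads alpha > 0.\<close>

lemma integrable_riesz_exp_square:
  assumes a: "a > 1 / 2" shows "integrable lborel (\<lambda>u. (riesz a (exp u))\<^sup>2)"
proof (subst integrable_exp_iff)
  have "integrable lborel (\<lambda>t. a\<^sup>2 / (2 * a - 1) * jacobi (2 * a - 1) t)"
    using a by (intro integrable_mult_right integrable_jacobi) simp
  moreover have "norm ((indicator {0<..} t / t) *\<^sub>R (riesz a t)\<^sup>2) \<le> norm (a\<^sup>2 / (2 * a - 1) * jacobi (2 * a - 1) t)" for t
  proof (cases "0 < t \<and> t \<le> 1")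
    case True
    have "((1 - t) powr (a - 1))\<^sup>2 = (1 - t) powr (2 * a - 1 - 1)"
      by (simp add: power2_eq_square powr_add[symmetric])
    then have "norm ((indicator {0<..} t / t) *\<^sub>R (riesz a t)\<^sup>2) = t * (a\<^sup>2 * (1 - t) powr (2 * a - 1 - 1))"
      using True by (simp add: riesz_def power_mult_distrib power2_eq_square[of t])
    also have "\<dots> \<le> 1 * (a\<^sup>2 * (1 - t) powr (2 * a - 1 - 1))"
      using True by (intro mult_right_mono) auto
    also have "\<dots> = norm (a\<^sup>2 / (2 * a - 1) * jacobi (2 * a - 1) t)"
      using True a by (simp add: jacobi_def abs_mult)
    finally show ?thesis .
  qed (auto simp: indicator_def riesz_def)
  ultimately show "integrable lborel (\<lambda>t. (indicator {0<..} t / t) *\<^sub>R (riesz a t)\<^sup>2)"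
    by (intro Bochner_Integration.integrable_bound[where g="\<lambda>t. (indicator {0<..} t / t) *\<^sub>R (riesz a t)\<^sup>2"]) auto
qed simp

lemma isCont_autocorr_riesz:
  assumes a: "a > 0" and z: "z \<noteq> 0"
  shows "isCont (autocorr (\<lambda>u. complex_of_real (riesz a (exp u)))) z"
proof (rule isCont_autocorr_halfline[OF integrable_riesz_exp[OF a] _ _ _ z])
  \<comment> \<open>At u = 0 the value is 0 by the convention \<open>0 powr b = 0\<close>, also when
    a <= 1.\<close>
  show "riesz a (exp u) = 0" if "0 \<le> u" for u
    using that by (cases "u = 0") (auto simp: riesz_def indicator_def)
  show "isCont (\<lambda>u. riesz a (exp u)) u" if "u < 0" for u
  proof -
    have "eventually (\<lambda>u. riesz a (exp u) = a * exp u * (1 - exp u) powr (a - 1)) (nhds u)"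
      unfolding eventually_nhds
      by (rule exI[of _ "{..<0}"]) (use that in \<open>auto simp: riesz_def indicator_def intro: order_trans[of _ 0]\<close>)
    moreover have "isCont (\<lambda>u. a * exp u * (1 - exp u) powr (a - 1)) u"
      using that by (intro continuous_intros) auto
    ultimately show ?thesis by (simp add: isCont_cong)
  qed
  show "\<exists>B. \<forall>u\<le>-d. \<bar>riesz a (exp u)\<bar> \<le> B" if d: "0 < d" for d
  proof (intro exI allI impI)
    fix u assume u: "u \<le> - d"
    have d1: "0 < 1 - exp (- d)" using d by simp
    have u1: "1 - exp (- d) \<le> 1 - exp u" "exp u \<le> 1" "1 - exp u \<le> 1" using u d by auto
    \<comment> \<open>The maximum merges two cases: for a >= 1 the power is at most 1, for a < 1 it
      is largest at the end point u = -d.\<close>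
    have "(1 - exp u) powr (a - 1) \<le> max 1 ((1 - exp (- d)) powr (a - 1))"
    proof (cases "a \<ge> 1")
      case True
      then have "(1 - exp u) powr (a - 1) \<le> 1 powr (a - 1)"
        using u1 by (intro powr_mono2) auto
      then show ?thesis by simp
    next
      case False
      then have "(1 - exp u) powr (a - 1) \<le> (1 - exp (- d)) powr (a - 1)"
        using u1 d1 by (intro powr_mono2') auto
      then show ?thesis by simp
    qed
    then have "a * exp u * (1 - exp u) powr (a - 1) \<le> a * 1 * max 1 ((1 - exp (- d)) powr (a - 1))"
      using a u1 by (intro mult_mono) auto
    moreover have "indicator {-1..1} (exp u) = (1::real)"
      using u1 order_trans[OF _ less_imp_le[OF exp_gt_zero[of u]], of "-1"] by (simp add: indicator_def)
    ultimately show "\<bar>riesz a (exp u)\<bar> \<le> a * max 1 ((1 - exp (- d)) powr (a - 1))"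
      using a u1 by (simp add: riesz_def abs_mult)
  qed
qed

section \<open>The sine transform and its decay\<close>

lemma phi_eq_jacobi: "phi a y = jacobi a y - jacobi a (- y)"
  by (auto simp: phi_def jacobi_def indicator_def)

lemma integrable_phi: "a > 0 \<Longrightarrow> integrable lborel (phi a)"
  using integrable_jacobi[of a] lborel_integrable_reflect[of "jacobi a" 0] unfolding phi_eq_jacobi by simp

text \<open>As \<open>phi a\<close> is odd, its Fourier integral is -i times this; the factor 2
  accounts for the negative half-line.\<close>

definition sine_kernel :: "real \<Rightarrow> real \<Rightarrow> real" where
  "sine_kernel a r = 2 * (LINT y|lborel. jacobi a y * sin (2 * pi * r * y))"

lemma integrable_jacobi_mult:
  assumes "a > 0" "g \<in> borel_measurable borel" "\<And>y. \<bar>g y\<bar> \<le> 1"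
  shows "integrable lborel (\<lambda>y. jacobi a y * g y)"
proof (rule Bochner_Integration.integrable_bound[OF integrable_jacobi[OF assms(1)]])
  show "AE y in lborel. norm (jacobi a y * g y) \<le> norm (jacobi a y)"
    using assms(3) by (auto simp: abs_mult intro!: mult_left_le)
qed (use assms(2) in measurable)

lemma ft_phi:
  assumes a: "a > 0" shows "ft (\<lambda>y. complex_of_real (phi a y)) r = - \<i> * of_real (sine_kernel a r)"
proof -
  define g where "g y = jacobi a y * sin (2 * pi * r * y)" for y
  have g: "integrable lborel g" unfolding g_def by (intro integrable_jacobi_mult a) auto
  define h where "h y = jacobi a y * cos (2 * pi * r * y)" for y
  have h: "integrable lborel h" unfolding h_def by (intro integrable_jacobi_mult a) auto
  have eq: "complex_of_real (phi a y) * cis (- (2 * pi * (y \<bullet> r))) =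
     of_real (h y - h (0 - y)) - \<i> * of_real (g y + g (0 - y))" for y
    by (simp add: phi_eq_jacobi g_def h_def cis.ctr complex_eq_iff algebra_simps)
  have "ft (\<lambda>y. complex_of_real (phi a y)) r =
     of_real ((LINT y|lborel. h y) - (LINT y|lborel. h (0 - y))) - \<i> * of_real ((LINT y|lborel. g y) + (LINT y|lborel. g (0 - y)))"
    unfolding ft_def eq
    using g h iffD2[OF lborel_integrable_reflect[of g 0] g] iffD2[OF lborel_integrable_reflect[of h 0] h]
    by simp
  then show ?thesis
    unfolding lborel_integral_reflect by (simp add: sine_kernel_def flip: g_def)
qed

lemma isCont_sine_kernel:
  assumes a: "a > 0" shows "isCont (sine_kernel a) r"
proof -
  have "sine_kernel a = (\<lambda>r. - Im (ft (\<lambda>y. complex_of_real (phi a y)) r))"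
    by (simp add: ft_phi[OF a] fun_eq_iff)
  then show ?thesis
    using integrable_phi[OF a] by (auto intro!: continuous_intros continuous_Im isCont_ft)
qed

lemma sine_kernel_measurable [measurable]: "a > 0 \<Longrightarrow> sine_kernel a \<in> borel_measurable borel"
  by (rule borel_measurable_continuous_onI) (simp add: continuous_at_imp_continuous_on isCont_sine_kernel)

lemma sine_kernel_odd: "sine_kernel a (- r) = - sine_kernel a r"
  by (simp add: sine_kernel_def)

lemma abs_sine_kernel_le:
  assumes a: "a > 0" shows "\<bar>sine_kernel a r\<bar> \<le> 2"
proof -
  have "\<bar>LINT y|lborel. jacobi a y * sin (2 * pi * r * y)\<bar> \<le> (LINT y|lborel. \<bar>jacobi a y * sin (2 * pi * r * y)\<bar>)"
    by (rule integral_abs_bound)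
  also have "\<dots> \<le> (LINT y|lborel. jacobi a y)"
    by (rule integral_mono')
       (auto simp: abs_mult jacobi_nonneg a intro!: integrable_jacobi mult_left_le)
  finally show ?thesis by (simp add: sine_kernel_def integral_jacobi a)
qed

lemma abs_sine_kernel_le_small:
  assumes a: "a > 0" shows "\<bar>sine_kernel a r\<bar> \<le> 4 * pi * \<bar>r\<bar>"
proof -
  have "\<bar>LINT y|lborel. jacobi a y * sin (2 * pi * r * y)\<bar> \<le> (LINT y|lborel. \<bar>jacobi a y * sin (2 * pi * r * y)\<bar>)"
    by (rule integral_abs_bound)
  also have "\<dots> \<le> (LINT y|lborel. jacobi a y * (2 * pi * \<bar>r\<bar>))"
  proof (rule integral_mono')
    fix y
    show "\<bar>jacobi a y * sin (2 * pi * r * y)\<bar> \<le> jacobi a y * (2 * pi * \<bar>r\<bar>)"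
    proof (cases "y \<in> {0..1}")
      case True
      have "\<bar>sin (2 * pi * r * y)\<bar> \<le> \<bar>2 * pi * r * y\<bar>" by (rule abs_sin_x_le_abs_x)
      also have "\<dots> \<le> 2 * pi * \<bar>r\<bar>" using True by (auto simp: abs_mult intro!: mult_left_le)
      finally show ?thesis using jacobi_nonneg[OF a, of y] by (simp add: abs_mult mult_left_mono)
    qed (simp add: jacobi_def)
  qed (use jacobi_nonneg[OF a] integrable_jacobi[OF a] in auto)
  also have "\<dots> = 2 * pi * \<bar>r\<bar>" using integrable_jacobi[OF a] by (simp add: integral_jacobi a)
  finally show ?thesis by (simp add: sine_kernel_def)
qed

text \<open>Integration by parts away from the singularity of \<open>(1 - y)\<^sup>a\<^sup>-\<^sup>1\<close>, at distance \<open>1 / r\<close> from it.\<close>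

lemma abs_sine_kernel_le_large:
  assumes a: "a > 0" and r: "r \<ge> 1"
  shows "\<bar>sine_kernel a r\<bar> \<le> 2 * (a / r + (1 + a) * r powr (- a))"
proof -
  define d where "d = 1 / r"
  have d: "0 < d" "d \<le> 1" using r by (auto simp: d_def)
  define S where "S v = sin (2 * pi * r * (1 - v))" for v
  define T where "T v = cos (2 * pi * r * (1 - v))" for v
  have [measurable]: "S \<in> borel_measurable borel" "T \<in> borel_measurable borel" unfolding S_def T_def by measurable
  have S1: "\<bar>S v\<bar> \<le> 1" and T1: "\<bar>T v\<bar> \<le> 1" for v by (auto simp: S_def T_def)
  \<comment> \<open>With v = 1 - y, \<open>p1\<close> is the part within \<open>d\<close> of the
    singularity, bounded by d^a regardless of the oscillation. On the rest, \<open>p2\<close> is the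
    derivative of \<open>G\<close> minus \<open>q\<close>: \<open>G\<close> gives the boundary
    terms, and \<open>q\<close> carries the derivative of the power.\<close>
  define p1 where "p1 v = a * (indicator {0..d} v * v powr (a - 1)) * S v" for v
  define p2 where "p2 v = indicator {d..1} v *\<^sub>R (a * v powr (a - 1) * S v)" for v
  define q where "q v = indicator {d..1} v *\<^sub>R (a * ((a - 1) * v powr (a - 2)) / (2 * pi * r) * T v)" for v
  define G where "G v = a * v powr (a - 1) * T v / (2 * pi * r)" for v
  let ?g = "\<lambda>v. a * v powr (a - 1) * S v + a * ((a - 1) * v powr (a - 2)) / (2 * pi * r) * T v"
  let ?q = "\<lambda>v. indicator {d..1} v *\<^sub>R ((a - 1) * v powr (a - 2))"
  have p1i: "integrable lborel (\<lambda>v. a * (indicator {0..d} v * v powr (a - 1)))"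
    using d a by (intro integrable_mult_right integrable_powr_Icc) auto
  have [measurable]: "p1 \<in> borel_measurable borel" unfolding p1_def[abs_def] by measurable
  have p1: "integrable lborel p1"
    by (rule Bochner_Integration.integrable_bound[OF p1i])
       (use S1 in \<open>auto simp: p1_def abs_mult intro!: mult_left_le\<close>)
  have p1_le: "\<bar>integral\<^sup>L lborel p1\<bar> \<le> r powr (- a)"
  proof -
    have "\<bar>integral\<^sup>L lborel p1\<bar> \<le> (LINT v|lborel. \<bar>p1 v\<bar>)" by (rule integral_abs_bound)
    also have "\<dots> \<le> (LINT v|lborel. a * (indicator {0..d} v * v powr (a - 1)))"
    proof (rule integral_mono'[OF p1i])
      fix v
      have "\<bar>p1 v\<bar> = a * (indicator {0..d} v * v powr (a - 1)) * \<bar>S v\<bar>"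
        using a by (simp add: p1_def abs_mult)
      also have "\<dots> \<le> a * (indicator {0..d} v * v powr (a - 1))"
        using a S1 by (intro mult_left_le) auto
      finally show "\<bar>p1 v\<bar> \<le> a * (indicator {0..d} v * v powr (a - 1))" .
    qed (use a in auto)
    also have "\<dots> = d powr a" using d a by (simp add: integral_powr_Icc)
    also have "\<dots> = r powr (- a)" using r by (simp add: d_def powr_divide powr_minus_divide)
    finally show ?thesis .
  qed
  have cont: "continuous_on {d..1} (\<lambda>v. a * v powr (a - 1) * S v)"
    "continuous_on {d..1} (\<lambda>v. a * ((a - 1) * v powr (a - 2)) / (2 * pi * r) * T v)"
    unfolding S_def T_def using d r by (auto intro!: continuous_intros)
  have p2: "integrable lborel p2" "integrable lborel q"
    unfolding p2_def[abs_def] q_def[abs_def]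
    by (rule borel_integrable_atLeastAtMost'[OF cont(1), unfolded set_integrable_def],
        rule borel_integrable_atLeastAtMost'[OF cont(2), unfolded set_integrable_def])
  have deriv: "(G has_vector_derivative ?g v) (at v within {d..1})"
    if "d \<le> v" "v \<le> 1" for v
  proof -
    have "(G has_real_derivative ?g v) (at v within {d..1})"
      unfolding G_def S_def T_def using d that r
      by (auto intro!: derivative_eq_intros simp: field_simps)
    then show ?thesis by (simp only: has_real_derivative_iff_has_vector_derivative)
  qed
  have "integral\<^sup>L lborel p2 + integral\<^sup>L lborel q = (LINT v|lborel. indicator {d..1} v *\<^sub>R ?g v)"
    using p2 by (subst Bochner_Integration.integral_add[symmetric]) (auto simp: p2_def q_def distrib_left)
  also have "\<dots> = G 1 - G d"
    by (rule integral_FTC_atLeastAtMost[OF d(2) deriv])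
       (use d r in \<open>auto simp: S_def T_def intro!: continuous_intros\<close>)
  finally have p2_G: "\<bar>integral\<^sup>L lborel p2\<bar> \<le> \<bar>G 1\<bar> + \<bar>G d\<bar> + \<bar>integral\<^sup>L lborel q\<bar>" by linarith
  have G_le: "\<bar>G v\<bar> \<le> a * v powr (a - 1) / (2 * pi * r)" for v
    using a r T1[of v] by (auto simp: G_def abs_mult intro!: divide_right_mono mult_left_le)
  have q_le: "\<bar>integral\<^sup>L lborel q\<bar> \<le> a / (2 * pi * r) * (1 + d powr (a - 1))"
  proof -
    have c: "continuous_on {d..1} (\<lambda>v. (a - 1) * v powr (a - 2))"
      using d by (auto intro!: continuous_intros)
    have ftc: "(LINT v|lborel. ?q v) = 1 powr (a - 1) - d powr (a - 1)"
    proof (rule integral_FTC_atLeastAtMost[OF d(2) _ c])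
      fix v assume "d \<le> v" "v \<le> 1"
      then have "((\<lambda>v. v powr (a - 1)) has_real_derivative (a - 1) * v powr (a - 2)) (at v within {d..1})"
        using d by (auto intro!: derivative_eq_intros simp: field_simps)
      then show "((\<lambda>v. v powr (a - 1)) has_vector_derivative (a - 1) * v powr (a - 2)) (at v within {d..1})"
        by (simp only: has_real_derivative_iff_has_vector_derivative)
    qed
    have ci: "integrable lborel (\<lambda>v. ?q v)"
      by (rule borel_integrable_atLeastAtMost'[OF c, unfolded set_integrable_def])
    have "\<bar>integral\<^sup>L lborel q\<bar> \<le> (LINT v|lborel. \<bar>q v\<bar>)" by (rule integral_abs_bound)
    also have "\<dots> \<le> (LINT v|lborel. a / (2 * pi * r) * \<bar>?q v\<bar>)"
    proof (rule integral_mono'[OF integrable_mult_right[OF integrable_abs[OF ci]]])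
      fix v
      have "\<bar>q v\<bar> = a / (2 * pi * r) * \<bar>?q v\<bar> * \<bar>T v\<bar>"
        using a r by (simp add: q_def abs_mult)
      also have "\<dots> \<le> a / (2 * pi * r) * \<bar>?q v\<bar>"
        using a r T1[of v] by (intro mult_left_le) auto
      finally show "\<bar>q v\<bar> \<le> a / (2 * pi * r) * \<bar>?q v\<bar>" .
    qed (use a r in auto)
    also have "\<dots> = a / (2 * pi * r) * \<bar>1 - d powr (a - 1)\<bar>"
    proof -
      \<comment> \<open>The integrand has constant sign, that of a - 1, so the integral of its
        modulus is the modulus of its integral, known from the fundamental theorem.\<close>
      have "(LINT v|lborel. \<bar>?q v\<bar>) = \<bar>1 - d powr (a - 1)\<bar>"
      proof (cases "a \<ge> 1")
        case True
        then have "(LINT v|lborel. \<bar>?q v\<bar>) = (LINT v|lborel. ?q v)"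
          by (intro Bochner_Integration.integral_cong) (auto simp: abs_mult)
        also have "\<dots> = \<bar>\<dots>\<bar>"
          using True by (intro abs_of_nonneg[symmetric] Bochner_Integration.integral_nonneg) auto
        finally show ?thesis unfolding ftc by simp
      next
        case False
        then have "(LINT v|lborel. \<bar>?q v\<bar>) = (LINT v|lborel. - (?q v))"
          by (intro Bochner_Integration.integral_cong) (auto simp: abs_mult, simp add: algebra_simps)
        also have "\<dots> = \<bar>\<dots>\<bar>"
          using False by (intro abs_of_nonneg[symmetric] Bochner_Integration.integral_nonneg) (auto simp: indicator_def mult_nonpos_nonneg)
        finally show ?thesis unfolding Bochner_Integration.integral_minus ftc by simp
      qed
      then show ?thesis by simp
    qed
    also have "\<dots> \<le> a / (2 * pi * r) * (1 + d powr (a - 1))"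
      using a r by (intro mult_left_mono) (auto simp: abs_le_iff)
    finally show ?thesis .
  qed
  have "\<bar>integral\<^sup>L lborel p2\<bar> \<le> a * 1 powr (a - 1) / (2 * pi * r) + a * d powr (a - 1) / (2 * pi * r) + a / (2 * pi * r) * (1 + d powr (a - 1))"
    by (rule order_trans[OF p2_G]) (intro add_mono G_le q_le)
  also have "\<dots> = a / (pi * r) * (1 + d powr (a - 1))" using r by (simp add: field_simps)
  also have "\<dots> \<le> a / r * (1 + d powr (a - 1))"
    using a r pi_gt3 by (intro mult_right_mono divide_left_mono) auto
  also have "\<dots> = a / r + a * r powr (- a)"
    using r by (simp add: d_def powr_divide powr_diff powr_minus_divide field_simps)
  finally have p2_le: "\<bar>integral\<^sup>L lborel p2\<bar> \<le> a / r + a * r powr (- a)" .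
  have "(LINT y|lborel. jacobi a y * sin (2 * pi * r * y)) = (LINT v|lborel. jacobi a (1 - v) * sin (2 * pi * r * (1 - v)))"
    by (rule lborel_integral_reflect[symmetric])
  also have "\<dots> = (LINT v|lborel. p1 v + p2 v)"
  proof (rule integral_cong_AE)
    \<comment> \<open>The two closed intervals overlap in the single point \<open>d\<close>.\<close>
    show "AE v in lborel. jacobi a (1 - v) * sin (2 * pi * r * (1 - v)) = p1 v + p2 v"
      using AE_lborel_singleton[of d]
      by eventually_elim (use d in \<open>auto simp: jacobi_reflect p1_def p2_def S_def indicator_def\<close>)
    show "(\<lambda>v. p1 v + p2 v) \<in> borel_measurable lborel" unfolding p1_def p2_def by measurable
  qed measurable
  also have "\<dots> = integral\<^sup>L lborel p1 + integral\<^sup>L lborel p2" using p1 p2 by simp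
  finally have eq: "(LINT y|lborel. jacobi a y * sin (2 * pi * r * y)) = integral\<^sup>L lborel p1 + integral\<^sup>L lborel p2" .
  have "(1 + a) * r powr (- a) = r powr (- a) + a * r powr (- a)" by (simp add: distrib_right)
  then have "\<bar>integral\<^sup>L lborel p1 + integral\<^sup>L lborel p2\<bar> \<le> a / r + (1 + a) * r powr (- a)"
    using p1_le p2_le by linarith
  then show ?thesis unfolding sine_kernel_def eq by (simp add: abs_mult)
qed

text \<open>The kernel is O(r) at 0 and O(r^(-min(a,1))) at infinity, which is exponential decay in
  u = ln r on both sides. It is weakened to 1 / (1 + u^2), whose integrability is at hand.\<close>

lemma sine_kernel_exp_bound:
  assumes a: "a > 0"
  shows "\<exists>C. \<forall>u. \<bar>sine_kernel a (exp u)\<bar> \<le> C * (1 / (1 + u\<^sup>2))"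
proof -
  define g where "g = min a 1"
  have g: "0 < g" "g \<le> a" "g \<le> 1" using a by (auto simp: g_def)
  define K where "K = max (4 * pi) (2 * (1 + 2 * a))"
  have K: "K > 0" "4 * pi \<le> K" "2 * (1 + 2 * a) \<le> K" using a by (auto simp: K_def less_max_iff_disj)
  have bd: "\<bar>sine_kernel a (exp u)\<bar> \<le> K * exp (- (g * \<bar>u\<bar>))" for u
  proof (cases "u \<le> 0")
    case True
    have "\<bar>sine_kernel a (exp u)\<bar> \<le> 4 * pi * exp u" using abs_sine_kernel_le_small[OF a, of "exp u"] by simp
    also have "\<dots> \<le> K * exp (- (g * \<bar>u\<bar>))"
      using True g K mult_right_mono[of g 1 "- u"] by (intro mult_mono) auto
    finally show ?thesis .
  next
    case False
    have le: "exp (- u) \<le> exp (- (g * \<bar>u\<bar>))" "exp (- (a * u)) \<le> exp (- (g * \<bar>u\<bar>))"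
      using False g by (auto intro: mult_right_mono mult_left_le_one_le)
    have "\<bar>sine_kernel a (exp u)\<bar> \<le> 2 * (a * exp (- u) + (1 + a) * exp (- (a * u)))"
      using abs_sine_kernel_le_large[OF a, of "exp u"] False by (simp add: powr_def exp_minus field_simps)
    also have "\<dots> \<le> 2 * (a * exp (- (g * \<bar>u\<bar>)) + (1 + a) * exp (- (g * \<bar>u\<bar>)))"
      using a le by (intro mult_left_mono add_mono) auto
    also have "\<dots> = 2 * (1 + 2 * a) * exp (- (g * \<bar>u\<bar>))" by (simp add: algebra_simps)
    also have "\<dots> \<le> K * exp (- (g * \<bar>u\<bar>))" using K by (intro mult_right_mono) auto
    finally show ?thesis .
  qed
  \<comment> \<open>Chosen so that c (1 + u^2) lies below the quadratic Taylor polynomial of exp(g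
    |u|).\<close>
  define c where "c = min 1 (g\<^sup>2 / 2)"
  have c: "0 < c" "c \<le> 1" "c \<le> g\<^sup>2 / 2" using g by (auto simp: c_def)
  have "\<bar>sine_kernel a (exp u)\<bar> \<le> K / c * (1 / (1 + u\<^sup>2))" for u
  proof -
    have "c * (1 + u\<^sup>2) \<le> 1 + g * \<bar>u\<bar> + (g * \<bar>u\<bar>)\<^sup>2 / 2"
    proof -
      have "c * u\<^sup>2 \<le> g\<^sup>2 / 2 * u\<^sup>2" using c by (intro mult_right_mono) auto
      moreover have "0 \<le> g * \<bar>u\<bar>" using g by simp
      ultimately show ?thesis using c by (simp add: power_mult_distrib algebra_simps)
    qed
    also have "\<dots> \<le> exp (g * \<bar>u\<bar>)" using g by (intro exp_lower_Taylor_quadratic) simp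
    finally have "exp (- (g * \<bar>u\<bar>)) \<le> 1 / (c * (1 + u\<^sup>2))"
      using c by (simp add: exp_minus inverse_eq_divide add_pos_nonneg frac_le)
    then have "K * exp (- (g * \<bar>u\<bar>)) \<le> K * (1 / (c * (1 + u\<^sup>2)))"
      using K by (intro mult_left_mono) auto
    with bd[of u] show ?thesis by simp
  qed
  then show ?thesis by blast
qed

lemma integrable_sine_kernel_exp:
  assumes a: "a > 0" shows "integrable lborel (\<lambda>u. sine_kernel a (exp u))"
proof -
  obtain C where C: "\<And>u. \<bar>sine_kernel a (exp u)\<bar> \<le> C * (1 / (1 + u\<^sup>2))"
    using sine_kernel_exp_bound[OF a] by blast
  show ?thesis
  proof (rule Bochner_Integration.integrable_bound[OF integrable_mult_right[OF integrable_1_div_1_plus_square, of C]])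
    show "AE u in lborel. norm (sine_kernel a (exp u)) \<le> norm (C * (1 / (1 + u\<^sup>2)))"
      unfolding real_norm_def by (intro AE_I2 order_trans[OF C abs_ge_self])
  qed (use a in measurable)
qed

lemma integrable_sine_kernel_exp_square:
  assumes a: "a > 0" shows "integrable lborel (\<lambda>u. (sine_kernel a (exp u))\<^sup>2)"
proof (rule Bochner_Integration.integrable_bound[OF integrable_mult_right[OF integrable_sine_kernel_exp[OF a], of 2]])
  show "AE u in lborel. norm ((sine_kernel a (exp u))\<^sup>2) \<le> norm (2 * sine_kernel a (exp u))"
    unfolding power2_eq_square norm_mult
    using abs_sine_kernel_le[OF a] by (intro AE_I2 mult_right_mono) auto
qed (use a in measurable)

lemma isCont_autocorr_sine_kernel:
  assumes a: "a > 0"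
  shows "isCont (autocorr (\<lambda>u. complex_of_real (sine_kernel a (exp u)))) z"
proof (rule isCont_autocorr_bounded)
  show "integrable lborel (\<lambda>u. complex_of_real (sine_kernel a (exp u)))"
    using integrable_sine_kernel_exp[OF a] by simp
  show "norm (complex_of_real (sine_kernel a (exp u))) \<le> 2" for u
    using abs_sine_kernel_le[OF a] by simp
  show "isCont (\<lambda>u. complex_of_real (sine_kernel a (exp u))) u" for u
    by (intro continuous_intros isCont_o2[OF isCont_exp isCont_sine_kernel[OF a]])
qed

section \<open>Mellin transforms and the Gamma function\<close>

text \<open>From (z + k + 1/2)^2 = (z + k)(z + k + 1) + 1/4, the Gauss products show that Gamma(z)
  Gamma(z + 1) / Gamma(z + 1/2)^2 is the limit of the products of 1 + w_k with w_k = 1 / (4 (z +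
  k)(z + k + 1)). The sum of |w_k| is at most 1/2, which keeps these products between 1/2 and 2 in
  modulus; finally Gamma(z + 1) = z Gamma(z).\<close>

lemma Gamma_half_step_bounds:
  assumes z: "Re z \<ge> 1 / 2"
  shows "(norm (Gamma (z + 1 / 2)))\<^sup>2 \<le> 2 * norm z * (norm (Gamma z))\<^sup>2"
    and "norm z * (norm (Gamma z))\<^sup>2 \<le> 2 * (norm (Gamma (z + 1 / 2)))\<^sup>2"
proof -
  \<comment> \<open>The modulus of \<open>w k\<close> at the extreme point z = 1/2. It telescopes,
    with total sum 1/2.\<close>
  define e where "e k = 1 / 4 / ((real k + 1 / 2) * (real k + 3 / 2))" for k
  define w where "w k = 1 / 4 / ((z + of_nat k) * (z + 1 + of_nat k))" for k
  have nz: "z + of_nat k \<noteq> 0" "z + 1 + of_nat k \<noteq> 0" "z + 1 / 2 + of_nat k \<noteq> 0" for k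
  proof -
    have "Re (z + of_nat k) > 0" "Re (z + 1 + of_nat k) > 0" "Re (z + 1 / 2 + of_nat k) > 0" using z by auto
    then show "z + of_nat k \<noteq> 0" "z + 1 + of_nat k \<noteq> 0" "z + 1 / 2 + of_nat k \<noteq> 0" by (metis less_irrefl zero_complex.sel(1))+
  qed
  have e_nonneg: "0 \<le> e k" for k by (simp add: e_def)
  have w_le: "norm (w k) \<le> e k" for k
  proof -
    have "real k + 1 / 2 \<le> norm (z + of_nat k)" "real k + 3 / 2 \<le> norm (z + 1 + of_nat k)"
      using z complex_Re_le_cmod[of "z + of_nat k"] complex_Re_le_cmod[of "z + 1 + of_nat k"] by auto
    then have "(real k + 1 / 2) * (real k + 3 / 2) \<le> norm ((z + of_nat k) * (z + 1 + of_nat k))"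
      unfolding norm_mult by (intro mult_mono) auto
    then show ?thesis unfolding w_def e_def norm_divide by (intro frac_le) auto
  qed
  have e_tele: "e k = 1 / 4 * (1 / (real k + 1 / 2) - 1 / (real (Suc k) + 1 / 2))" for k
    by (simp add: e_def field_simps)
  have e_sum: "(\<Sum>k=0..n. e k) \<le> 1 / 2" for n
  proof -
    have "(\<Sum>k=0..n. e k) = 1 / 4 * (\<Sum>k\<le>n. 1 / (real k + 1 / 2) - 1 / (real (Suc k) + 1 / 2))"
      unfolding e_tele sum_distrib_left[symmetric] atMost_atLeast0 ..
    also have "\<dots> = 1 / 4 * (2 - 1 / (real (Suc n) + 1 / 2))"
      by (subst sum_telescope) simp
    finally have eq: "(\<Sum>k=0..n. e k) = 1 / 4 * (2 - 1 / (real (Suc n) + 1 / 2))" .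
    have *: "1 / 4 * (2 - x) \<le> 1 / 2" if "0 \<le> x" for x :: real using that by simp
    show ?thesis unfolding eq by (rule *) simp
  qed
  \<comment> \<open>The upper limit of the sum is the outer \<open>k\<close>, so one term is
    compared with a partial sum.\<close>
  have "2 * e k \<le> 2 * (\<Sum>k=0..k. e k)" for k
    using e_nonneg by (intro mult_left_mono member_le_sum) auto
  then have e1: "e k \<le> 1" for k using e_sum[of k] by (smt (verit) field_sum_of_halves)
  define P where "P n = (\<Prod>k=0..n. 1 + w k)" for n
  have P_up: "norm (P n) \<le> 2" for n
  proof -
    have "norm (P n) = (\<Prod>k=0..n. norm (1 + w k))" unfolding P_def by (rule prod_norm[symmetric])
    also have "\<dots> \<le> (\<Prod>k=0..n. 1 + e k)"
      using w_le norm_triangle_ineq[of 1 "w _"] by (intro prod_mono) (auto intro: order_trans[OF norm_triangle_ineq])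
    also have "\<dots> \<le> exp (\<Sum>k=0..n. e k)" by (intro prod_le_exp_sum e_nonneg)
    also have "\<dots> \<le> exp (1 / 2)" using e_sum by simp
    also have "\<dots> \<le> 2" by (rule exp_half_le2)
    finally show ?thesis .
  qed
  have P_low: "1 / 2 \<le> norm (P n)" for n
  proof -
    have "1 / 2 \<le> 1 - (\<Sum>k=0..n. e k)" using e_sum[of n] by simp
    also have "\<dots> \<le> (\<Prod>k=0..n. 1 - e k)" using e_nonneg e1 by (intro Weierstrass_prod_ineq) auto
    also have "\<dots> \<le> (\<Prod>k=0..n. norm (1 + w k))"
    proof (intro prod_mono conjI)
      fix k
      show "0 \<le> 1 - e k" using e1[of k] by simp
      show "1 - e k \<le> norm (1 + w k)"
        using w_le[of k] norm_diff_ineq[of 1 "w k"] by simp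
    qed
    also have "\<dots> = norm (P n)" unfolding P_def by (rule prod_norm)
    finally show ?thesis .
  qed
  have P_eq: "Gamma_series z n * Gamma_series (z + 1) n = P n * (Gamma_series (z + 1 / 2) n)\<^sup>2" for n
  proof -
    have "1 + w k = (z + 1 / 2 + of_nat k)\<^sup>2 / ((z + of_nat k) * (z + 1 + of_nat k))" for k
    proof -
      have "(z + 1 / 2 + of_nat k)\<^sup>2 = (z + of_nat k) * (z + 1 + of_nat k) + 1 / 4"
        by (simp add: power2_eq_square algebra_simps)
      then show ?thesis using nz[of k] by (simp add: w_def add_divide_distrib)
    qed
    then have "P n = (\<Prod>k=0..n. (z + 1 / 2 + of_nat k)\<^sup>2) / ((\<Prod>k=0..n. z + of_nat k) * (\<Prod>k=0..n. z + 1 + of_nat k))"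
      unfolding P_def by (simp add: prod_dividef prod.distrib)
    then have P: "P n = (pochhammer (z + 1 / 2) (n + 1))\<^sup>2 / (pochhammer z (n + 1) * pochhammer (z + 1) (n + 1))"
      by (simp add: pochhammer_Suc_prod prod_power_distrib)
    have poch: "pochhammer (z + 1 / 2) (n + 1) \<noteq> 0"
      using nz by (auto simp: pochhammer_Suc_prod)
    have ex: "exp (z * of_real (ln (of_nat n))) * exp ((z + 1) * of_real (ln (of_nat n))) = (exp ((z + 1 / 2) * of_real (ln (of_nat n))))\<^sup>2"
      by (simp add: power2_eq_square exp_add[symmetric] algebra_simps)
    have "Gamma_series z n * Gamma_series (z + 1) n =
      fact n * fact n * (exp (z * of_real (ln (of_nat n))) * exp ((z + 1) * of_real (ln (of_nat n)))) / (pochhammer z (n + 1) * pochhammer (z + 1) (n + 1))"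
      unfolding Gamma_series_def by (simp add: mult_ac)
    also have "\<dots> = P n * (Gamma_series (z + 1 / 2) n)\<^sup>2"
      unfolding ex P Gamma_series_def using poch by (simp add: power_divide power_mult_distrib power2_eq_square mult_ac)
    finally show ?thesis .
  qed
  have zni: "z \<notin> \<int>\<^sub>\<le>\<^sub>0"
    using z by (auto elim!: nonpos_Ints_cases')
  have lim1: "(\<lambda>n. norm (Gamma_series z n * Gamma_series (z + 1) n)) \<longlonglongrightarrow> norm (Gamma z * Gamma (z + 1))"
    by (intro tendsto_intros)
  have lim2: "(\<lambda>n. 2 * (norm (Gamma_series (z + 1 / 2) n))\<^sup>2) \<longlonglongrightarrow> 2 * (norm (Gamma (z + 1 / 2)))\<^sup>2"
    by (intro tendsto_intros)
  have lim3: "(\<lambda>n. 2 * norm (Gamma_series z n * Gamma_series (z + 1) n)) \<longlonglongrightarrow> 2 * norm (Gamma z * Gamma (z + 1))"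
    by (intro tendsto_intros)
  have lim4: "(\<lambda>n. (norm (Gamma_series (z + 1 / 2) n))\<^sup>2) \<longlonglongrightarrow> (norm (Gamma (z + 1 / 2)))\<^sup>2"
    by (intro tendsto_intros)
  have GG: "norm (Gamma z * Gamma (z + 1)) = norm z * (norm (Gamma z))\<^sup>2"
    by (simp add: Gamma_plus1[OF zni] norm_mult power2_eq_square)
  show "norm z * (norm (Gamma z))\<^sup>2 \<le> 2 * (norm (Gamma (z + 1 / 2)))\<^sup>2"
    unfolding GG[symmetric]
  proof (rule LIMSEQ_le[OF lim1 lim2], intro exI allI impI)
    show "norm (Gamma_series z n * Gamma_series (z + 1) n) \<le> 2 * (norm (Gamma_series (z + 1 / 2) n))\<^sup>2" for n
      unfolding P_eq norm_mult norm_power using P_up[of n] by (intro mult_right_mono) auto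
  qed
  have "(norm (Gamma (z + 1 / 2)))\<^sup>2 \<le> 2 * norm (Gamma z * Gamma (z + 1))"
  proof (rule LIMSEQ_le[OF lim4 lim3], intro exI allI impI)
    show "(norm (Gamma_series (z + 1 / 2) n))\<^sup>2 \<le> 2 * norm (Gamma_series z n * Gamma_series (z + 1) n)" for n
      unfolding P_eq norm_mult norm_power
      using mult_right_mono[OF P_low[of n], of "(norm (Gamma_series (z + 1 / 2) n))\<^sup>2"] by simp
  qed
  then show "(norm (Gamma (z + 1 / 2)))\<^sup>2 \<le> 2 * norm z * (norm (Gamma z))\<^sup>2"
    unfolding GG by simp
qed

section \<open>Mellin transforms of multiplicative convolutions\<close>

lemma ft_convolution:
  fixes f g :: "'a::euclidean_space \<Rightarrow> complex"
  assumes f: "integrable lborel f" and g: "integrable lborel g"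
  shows "ft (\<lambda>x. LINT y|lborel. f (x - y) * g y) \<xi> = ft f \<xi> * ft g \<xi>"
proof -
  have [measurable]: "f \<in> borel_measurable borel" "g \<in> borel_measurable borel" using f g by auto
  have ft_shift: "(LINT x|lborel. f (x - y) * cis (- (2 * pi * (x \<bullet> \<xi>)))) = cis (- (2 * pi * (y \<bullet> \<xi>))) * ft f \<xi>" for y
    using ft_translate[of f "- y" \<xi>] by (simp add: ft_def)
  have fi: "integrable lborel (\<lambda>x. f (x - y))" for y
    using lborel_integrable_translate[of f "- y"] f by simp
  have "ft (\<lambda>x. LINT y|lborel. f (x - y) * g y) \<xi> = (LINT x|lborel. LINT y|lborel. f (x - y) * cis (- (2 * pi * (x \<bullet> \<xi>))) * g y)"
    unfolding ft_def integral_mult_left_zero[symmetric] by (simp add: mult_ac)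
  also have "\<dots> = (LINT y|lborel. LINT x|lborel. f (x - y) * cis (- (2 * pi * (x \<bullet> \<xi>))) * g y)"
  proof (rule lborel_pair.Fubini_integral, rule lborel_pair.Fubini_integrable)
    show "AE y in lborel. integrable lborel (\<lambda>x. case (y, x) of (y, x) \<Rightarrow> f (x - y) * cis (- (2 * pi * (x \<bullet> \<xi>))) * g y)"
      by (auto intro!: AE_I2 integrable_mult_left integrable_ft_integrand fi)
    have "(LINT x|lborel. norm (case (y, x) of (y, x) \<Rightarrow> f (x - y) * cis (- (2 * pi * (x \<bullet> \<xi>))) * g y)) = (LINT x|lborel. norm (f x)) * norm (g y)" for y
      using lborel_integral_translate[of "\<lambda>x. norm (f x)" "- y"] by (simp add: norm_mult)
    then show "integrable lborel (\<lambda>y. LINT x|lborel. norm (case (y, x) of (y, x) \<Rightarrow> f (x - y) * cis (- (2 * pi * (x \<bullet> \<xi>))) * g y))"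
      using g by (simp only:) (intro integrable_mult_right integrable_norm)
  qed measurable
  also have "\<dots> = (LINT y|lborel. ft f \<xi> * (g y * cis (- (2 * pi * (y \<bullet> \<xi>)))))"
    unfolding integral_mult_left_zero ft_shift by (simp add: mult_ac)
  also have "\<dots> = ft f \<xi> * ft g \<xi>"
    unfolding integral_mult_right_zero ft_def ..
  finally show ?thesis .
qed

lemma ft_reflect:
  fixes f :: "'a::euclidean_space \<Rightarrow> complex"
  shows "ft (\<lambda>x. f (- x)) \<xi> = ft f (- \<xi>)"
  using lborel_integral_reflect[of "\<lambda>x. f (- x) * cis (- (2 * pi * (x \<bullet> \<xi>)))" 0] by (simp add: ft_def)

lemma norm_ft_real_minus:
  fixes f :: "'a::euclidean_space \<Rightarrow> real"
  shows "norm (ft (\<lambda>x. complex_of_real (f x)) (- \<xi>)) = norm (ft (\<lambda>x. complex_of_real (f x)) \<xi>)"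
proof -
  have "ft (\<lambda>x. complex_of_real (f x)) (- \<xi>) = cnj (ft (\<lambda>x. complex_of_real (f x)) \<xi>)"
    by (simp add: ft_def cis_cnj flip: Bochner_Integration.integral_cnj)
  then show ?thesis by simp
qed

text \<open>Euler's integral for Gamma(s - 2 pi i l) in the variable u = ln t.\<close>

lemma
  assumes s: "0 < s"
  shows integrable_gamma_exp: "integrable lborel (\<lambda>u. exp u powr s * exp (- exp u))"
    and mel_gamma: "mel (\<lambda>x. x powr s * exp (- x)) l = Gamma (Complex s (- (2 * pi * l)))"
proof -
  define z where "z = Complex s (- (2 * pi * l))"
  have z: "Re z > 0" using s by (simp add: z_def)
  define h where "h = (\<lambda>t::real. complex_of_real (t powr s * exp (- t)) * cis (- (2 * pi * (ln t * l))))"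
  have hm [measurable]: "h \<in> borel_measurable borel" unfolding h_def by measurable
  have eq: "indicator {0<..} t *\<^sub>R (complex_of_real t powr (z - 1) / of_real (exp t)) = (indicator {0<..} t / t) *\<^sub>R h t" for t
  proof (cases "t > 0")
    case True
    have "complex_of_real t powr (z - 1) = exp ((z - 1) * of_real (ln t))"
      using True by (simp add: powr_def Ln_of_real)
    also have "(z - 1) * of_real (ln t) = of_real ((s - 1) * ln t) + \<i> * of_real (- (2 * pi * (ln t * l)))"
      by (simp add: z_def complex_eq_iff)
    also have "exp \<dots> = of_real (t powr (s - 1)) * cis (- (2 * pi * (ln t * l)))"
      using True by (simp only: exp_add cis_conv_exp exp_of_real) (simp add: powr_def)
    also have "t powr (s - 1) = t powr s / t" using True by (simp add: powr_diff)
    finally show ?thesis using True by (simp add: h_def exp_minus scaleR_conv_of_real field_simps)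
  qed simp
  \<comment> \<open>Euler's integral is available over \<open>lebesgue\<close>; Borel measurability
    of the integrand brings it down to \<open>lborel\<close>.\<close>
  have int: "set_integrable lebesgue {0<..} (\<lambda>t. complex_of_real t powr (z - 1) / of_real (exp t))"
    using absolutely_integrable_Gamma_integral'[OF z] .
  have m: "(\<lambda>t. (indicator {0<..} t / t) *\<^sub>R h t) \<in> borel_measurable lborel" by measurable
  have int': "integrable lborel (\<lambda>t. (indicator {0<..} t / t) *\<^sub>R h t)"
    using int integrable_completion[OF m] by (simp add: set_integrable_def eq)
  have "Gamma z = integral {0<..} (\<lambda>t. complex_of_real t powr (z - 1) / of_real (exp t))"
    using Gamma_integral_complex'[OF z] by (simp add: integral_unique)
  also have "\<dots> = (LINT t:{0<..}|lebesgue. complex_of_real t powr (z - 1) / of_real (exp t))"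
    using set_lebesgue_integral_eq_integral(2)[OF int] by simp
  also have "\<dots> = (LINT t|lborel. (indicator {0<..} t / t) *\<^sub>R h t)"
    unfolding set_lebesgue_integral_def eq by (rule integral_completion[OF m])
  also have "\<dots> = (LINT u|lborel. h (exp u))" by (rule integral_exp_eq[OF hm, symmetric])
  also have "\<dots> = mel (\<lambda>x. x powr s * exp (- x)) l" by (simp add: mel_def ft_def h_def)
  finally show "mel (\<lambda>x. x powr s * exp (- x)) l = Gamma (Complex s (- (2 * pi * l)))"
    by (simp add: z_def)
  have "integrable lborel (\<lambda>u. h (exp u))"
    using int' integrable_exp_iff[OF hm] by simp
  then have "integrable lborel (\<lambda>u. norm (h (exp u)))" by (rule integrable_norm)
  then show "integrable lborel (\<lambda>u. exp u powr s * exp (- exp u))"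
    by (simp add: h_def norm_mult)
qed

lemma integral_gamma_real:
  fixes s :: real
  assumes s: "0 < s"
  shows "(LINT t|lborel. indicator {0<..} t * (t powr (s - 1) * exp (- t))) = Gamma s"
    and "integrable lborel (\<lambda>t. indicator {0<..} t * (t powr (s - 1) * exp (- t)))"
proof -
  have eq: "(indicator {0<..} t / t) *\<^sub>R (t powr s * exp (- t)) = indicator {0<..} t * (t powr (s - 1) * exp (- t))" for t :: real
    by (simp add: powr_diff indicator_def)
  have "complex_of_real (LINT u|lborel. exp u powr s * exp (- exp u)) = mel (\<lambda>x. x powr s * exp (- x)) 0"
    by (simp add: mel_def ft_def del: of_real_mult)
  also have "\<dots> = Gamma (complex_of_real s)"
    using mel_gamma[OF s, of 0] by (simp add: complex_of_real_def)
  finally have "complex_of_real (LINT u|lborel. exp u powr s * exp (- exp u)) = Gamma (complex_of_real s)" .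
  then have "(LINT u|lborel. exp u powr s * exp (- exp u)) = Gamma s"
    by (simp add: Gamma_complex_of_real)
  then show "(LINT t|lborel. indicator {0<..} t * (t powr (s - 1) * exp (- t))) = Gamma s"
    using integral_exp_eq[of "\<lambda>t. t powr s * exp (- t)"] by (simp only: eq) simp
  show "integrable lborel (\<lambda>t. indicator {0<..} t * (t powr (s - 1) * exp (- t)))"
    using integrable_gamma_exp[OF s] integrable_exp_iff[of "\<lambda>t. t powr s * exp (- t)"] by (simp only: eq) simp
qed

text \<open>The Beta integral, in the form of a multiplicative convolution of \<open>riesz a\<close> with the Gamma integrand.\<close>

lemma mel_riesz:
  assumes a: "0 < a"
  shows "mel (riesz a) l * Gamma (Complex (1 + a) (- (2 * pi * l))) =
    of_real (Gamma (1 + a)) * Gamma (Complex 1 (- (2 * pi * l)))"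
proof -
  \<comment> \<open>The exponent 1 + a makes the powers of t cancel: (w/t)(1 - w/t)^(a-1) t^(1+a) /
    t = w (t - w)^(a-1), and the shift by w leaves the integral for Gamma(a).\<close>
  define g where "g x = x powr (1 + a) * exp (- x)" for x :: real
  have gi: "integrable lborel (\<lambda>u. complex_of_real (g (exp u)))"
    unfolding g_def using a by (intro integrable_of_real integrable_gamma_exp) simp
  have ri: "integrable lborel (\<lambda>u. complex_of_real (riesz a (exp u)))"
    using integrable_riesz_exp[OF a] by simp
  have conv: "(LINT u|lborel. riesz a (exp (v - u)) * g (exp u)) = Gamma (1 + a) * (exp v powr 1 * exp (- exp v))" for v
  proof -
    define w where "w = exp v"
    have w: "w > 0" by (simp add: w_def)
    have "(LINT u|lborel. riesz a (exp (v - u)) * g (exp u)) = (LINT u|lborel. riesz a (w / exp u) * g (exp u))"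
      by (simp add: exp_diff w_def)
    also have "\<dots> = (LINT t|lborel. (indicator {0<..} t / t) *\<^sub>R (riesz a (w / t) * g t))"
      unfolding g_def by (rule integral_exp_eq) measurable
    also have "\<dots> = (LINT t|lborel. (a * w * exp (- w)) * (indicator {0<..} (t - w) * ((t - w) powr (a - 1) * exp (- (t - w)))))"
    proof (rule Bochner_Integration.integral_cong[OF refl])
      fix t
      show "(indicator {0<..} t / t) *\<^sub>R (riesz a (w / t) * g t) = (a * w * exp (- w)) * (indicator {0<..} (t - w) * ((t - w) powr (a - 1) * exp (- (t - w))))"
      proof (cases "t > w")
        case True
        then have t: "t > 0" "w / t \<le> 1" "0 < t - w" using w by auto
        have "1 - w / t = (t - w) / t" using t by (simp add: field_simps)
        then have "(1 - w / t) powr (a - 1) = (t - w) powr (a - 1) * t / t powr a"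
          using t by (simp add: powr_divide powr_diff)
        then have "riesz a (w / t) = a * (w / t) * ((t - w) powr (a - 1) * t / t powr a)"
          using t w order_trans[of "-1" 0 "w / t"] by (simp add: riesz_def indicator_def)
        moreover have "g t = t * t powr a * exp (- t)" using t by (simp add: g_def powr_add)
        moreover have "exp (- t) = exp (- w) * exp (- (t - w))" by (simp add: exp_add[symmetric])
        ultimately show ?thesis using t True by (simp add: field_simps)
      next
        case False
        \<comment> \<open>For t < w the argument exceeds 1, and for t = w the value is 0 by
          \<open>0 powr b = 0\<close>.\<close>
        have "riesz a (w / t) = 0" if "t > 0"
          using that False w by (cases "t = w") (auto simp: riesz_def indicator_def field_simps)
        then show ?thesis using False by (auto simp: indicator_def)
      qed
    qed
    also have "\<dots> = (a * w * exp (- w)) * Gamma a"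
      using lborel_integral_translate[of "\<lambda>t. indicator {0<..} t * (t powr (a - 1) * exp (- t))" "- w"] integral_gamma_real(1)[OF a]
      by simp
    also have "\<dots> = Gamma (1 + a) * (exp v powr 1 * exp (- exp v))"
      using Gamma_plus1[of a] a w by (simp add: w_def add.commute mult_ac nonpos_Ints_def)
    finally show ?thesis .
  qed
  have "mel (riesz a) l * mel g l = ft (\<lambda>v. LINT u|lborel. complex_of_real (riesz a (exp (v - u))) * complex_of_real (g (exp u))) l"
    unfolding mel_def by (rule ft_convolution[OF ri gi, symmetric])
  also have "(\<lambda>v. LINT u|lborel. complex_of_real (riesz a (exp (v - u))) * complex_of_real (g (exp u))) =
     (\<lambda>v. of_real (Gamma (1 + a)) * complex_of_real (exp v powr 1 * exp (- exp v)))"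
    unfolding of_real_mult[symmetric] integral_complex_of_real conv ..
  also have "ft \<dots> l = of_real (Gamma (1 + a)) * mel (\<lambda>x. x powr 1 * exp (- x)) l"
    unfolding mel_def ft_def mult.assoc integral_mult_right_zero ..
  finally have "mel (riesz a) l * mel g l = of_real (Gamma (1 + a)) * mel (\<lambda>x. x powr 1 * exp (- x)) l" .
  then show ?thesis
    unfolding g_def using mel_gamma[of "1 + a" l] mel_gamma[of 1 l] a by simp
qed

text \<open>The function x^p exp(-pi x^2) at x = exp v. The exponent 1 gives the function fixed by
  the sine transform; the exponent 2 occurs because dt = t dt/t adds a power when that function is
  integrated against dt.\<close>

definition gauss_log :: "real \<Rightarrow> real \<Rightarrow> real" where
  "gauss_log p v = exp (p * v) * exp (- (pi * exp (2 * v)))"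

text \<open>The substitution u = ln pi + 2 v turns pi x^2 into the variable of the Gamma integral.
  It halves the frequency, hence \<open>pi * l\<close> in place of \<open>2 * pi * l\<close>, and
  the translation by ln pi only adds a phase, which the norm removes.\<close>

lemma
  assumes p: "0 < p"
  shows integrable_gauss_log: "integrable lborel (gauss_log p)"
    and norm_ft_gauss_log: "norm (ft (\<lambda>v. complex_of_real (gauss_log p v)) l) =
      norm (Gamma (Complex (p / 2) (- (pi * l)))) / (2 * pi powr (p / 2))"
proof -
  define f where "f u = exp u powr (p / 2) * exp (- exp u)" for u :: real
  have f: "integrable lborel f" unfolding f_def using p by (intro integrable_gamma_exp) simp
  have eq: "gauss_log p v = f (ln pi + 2 * v) / pi powr (p / 2)" for v
  proof -
    have "exp (ln pi + 2 * v) = pi * exp (2 * v)" by (simp add: exp_add)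
    moreover have "(pi * exp (2 * v)) powr (p / 2) = pi powr (p / 2) * exp (p * v)"
      by (simp add: powr_mult powr_def[of "exp _"] mult_ac)
    ultimately show ?thesis by (simp add: f_def gauss_log_def)
  qed
  show "integrable lborel (gauss_log p)"
    unfolding eq using lborel_integrable_real_affine[OF f, of 2 "ln pi"] by simp
  define F where "F u = complex_of_real (f u) * cis (- (2 * pi * (u \<bullet> (l / 2))))" for u
  have "Gamma (Complex (p / 2) (- (pi * l))) = mel (\<lambda>x. x powr (p / 2) * exp (- x)) (l / 2)"
    using mel_gamma[of "p / 2" "l / 2"] p by simp
  also have "\<dots> = (LINT u|lborel. F u)" by (simp add: mel_def ft_def F_def f_def)
  also have "\<dots> = 2 *\<^sub>R (LINT v|lborel. F (ln pi + 2 * v))"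
    using lborel_integral_real_affine[of 2 F "ln pi"] by simp
  also have "(\<lambda>v. F (ln pi + 2 * v)) = (\<lambda>v. of_real (pi powr (p / 2)) * cis (- (pi * ln pi * l)) * (complex_of_real (gauss_log p v) * cis (- (2 * pi * (v \<bullet> l)))))"
  proof (rule ext)
    fix v
    have "cis (- (2 * pi * ((ln pi + 2 * v) \<bullet> (l / 2)))) = cis (- (pi * ln pi * l)) * cis (- (2 * pi * (v \<bullet> l)))"
      by (simp add: cis_mult algebra_simps)
    moreover have "f (ln pi + 2 * v) = pi powr (p / 2) * gauss_log p v" by (simp add: eq)
    ultimately show "F (ln pi + 2 * v) = of_real (pi powr (p / 2)) * cis (- (pi * ln pi * l)) * (complex_of_real (gauss_log p v) * cis (- (2 * pi * (v \<bullet> l))))"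
      by (simp add: F_def mult_ac)
  qed
  finally have "Gamma (Complex (p / 2) (- (pi * l))) = 2 *\<^sub>R (of_real (pi powr (p / 2)) * cis (- (pi * ln pi * l)) * ft (\<lambda>v. complex_of_real (gauss_log p v)) l)"
    unfolding ft_def integral_mult_right_zero .
  then have "norm (Gamma (Complex (p / 2) (- (pi * l)))) = 2 * (pi powr (p / 2) * norm (ft (\<lambda>v. complex_of_real (gauss_log p v)) l))"
    by (simp add: norm_mult)
  then show "norm (ft (\<lambda>v. complex_of_real (gauss_log p v)) l) = norm (Gamma (Complex (p / 2) (- (pi * l)))) / (2 * pi powr (p / 2))"
    by simp
qed

section \<open>Comparison of the two kernels\<close>

lemma integrable_id_gaussian: "integrable lborel (\<lambda>t::real. t * exp (- (pi * t\<^sup>2)))"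
proof (rule Bochner_Integration.integrable_bound[OF integrable_1_div_1_plus_square])
  show "AE t in lborel. norm (t * exp (- (pi * t\<^sup>2))) \<le> norm (1 / (1 + t\<^sup>2))"
  proof (rule AE_I2)
    fix t :: real
    have "\<bar>t\<bar> \<le> (1 + t\<^sup>2) / 2"
      using sum_squares_bound[of 1 "\<bar>t\<bar>"] by simp
    then have "\<bar>t\<bar> * (1 + t\<^sup>2) \<le> (1 + t\<^sup>2) / 2 * (1 + t\<^sup>2)" by (intro mult_right_mono) auto
    also have "\<dots> = 1 / 2 + 1 * t\<^sup>2 + 1 * (t\<^sup>2)\<^sup>2 / 2" by (simp add: power2_eq_square algebra_simps)
    also have "\<dots> \<le> 1 + pi * t\<^sup>2 + pi\<^sup>2 * (t\<^sup>2)\<^sup>2 / 2"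
      using pi_gt3 one_le_power[of pi 2] by (intro add_mono divide_right_mono mult_right_mono) auto
    also have "\<dots> \<le> exp (pi * t\<^sup>2)"
      using exp_lower_Taylor_quadratic[of "pi * t\<^sup>2"] by (simp add: power_mult_distrib)
    finally show "norm (t * exp (- (pi * t\<^sup>2))) \<le> norm (1 / (1 + t\<^sup>2))"
      by (simp add: abs_mult exp_minus field_simps add_pos_nonneg)
  qed
qed measurable

text \<open>The derivative 2 pi x q - 2 pi p of the function \<open>F\<close>, which vanishes at
  infinity, has integral 0. So the integral of p is x times that of q, the cosine transform of the
  Gaussian.\<close>

lemma gaussian_sine_transform:
  fixes x :: real
  shows "(LINT t|lborel. t * exp (- (pi * t\<^sup>2)) * sin (2 * pi * x * t)) = x * exp (- (pi * x\<^sup>2))"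
proof -
  define p where "p t = t * exp (- (pi * t\<^sup>2)) * sin (2 * pi * x * t)" for t
  define q where "q t = exp (- (pi * t\<^sup>2)) * cos (2 * pi * x * t)" for t
  define F where "F t = exp (- (pi * t\<^sup>2)) * sin (2 * pi * x * t)" for t
  have p: "integrable lborel p"
    by (rule Bochner_Integration.integrable_bound[OF integrable_id_gaussian])
       (auto simp: p_def[abs_def] abs_mult intro!: mult_left_le mult_left_mono)
  have gauss: "integrable lborel (\<lambda>t::real. complex_of_real (exp (- pi * t\<^sup>2)) * cis (- (2 * pi * (t * x))))"
    by (intro integrable_mult_cis gaussian_ft_real(1)) measurable
  have q_Re: "q t = Re (complex_of_real (exp (- pi * t\<^sup>2)) * cis (- (2 * pi * (t * x))))" for t
    by (simp add: q_def mult_ac)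
  have q: "integrable lborel q"
    unfolding q_Re[abs_def] by (rule integrable_Re[OF gauss])
  have qI: "integral\<^sup>L lborel q = exp (- (pi * x\<^sup>2))"
    unfolding q_Re[abs_def] integral_Re[OF gauss] gaussian_ft_real(2) by simp
  have deriv: "(F has_vector_derivative (2 * pi * x * q t - 2 * pi * p t)) (at t within A)" for t A
    unfolding has_real_derivative_iff_has_vector_derivative[symmetric] F_def p_def q_def
    by (auto intro!: derivative_eq_intros simp: algebra_simps power2_eq_square)
  define D where "D t = 2 * pi * x * q t - 2 * pi * p t" for t
  have D: "integrable lborel D" unfolding D_def[abs_def] using p q by simp
  have ftc: "(LINT t|lborel. indicator {- real n..real n} t *\<^sub>R D t) = F (real n) - F (- real n)" for n
  proof (rule integral_FTC_atLeastAtMost)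
    show "(F has_vector_derivative D t) (at t within {- real n..real n})" for t
      unfolding D_def by (rule deriv)
    show "continuous_on {- real n..real n} D"
      unfolding D_def p_def q_def by (intro continuous_intros)
  qed simp
  have "(\<lambda>n. LINT t|lborel. indicator {- real n..real n} t *\<^sub>R D t) \<longlonglongrightarrow> integral\<^sup>L lborel D"
  proof (rule integral_dominated_convergence[where w="\<lambda>t. \<bar>D t\<bar>"])
    show "AE t in lborel. (\<lambda>n. indicator {- real n..real n} t *\<^sub>R D t) \<longlonglongrightarrow> D t"
    proof (rule AE_I2)
      fix t
      obtain N :: nat where N: "\<bar>t\<bar> \<le> real N" using real_arch_simple by blast
      show "(\<lambda>n. indicator {- real n..real n} t *\<^sub>R D t) \<longlonglongrightarrow> D t"
        by (rule tendsto_eventually, rule eventually_sequentiallyI[of N]) (use N in \<open>auto simp: indicator_def\<close>)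
    qed
  qed (use D in \<open>auto simp: indicator_def\<close>)
  moreover have "(\<lambda>n. F (real n) - F (- real n)) \<longlonglongrightarrow> 0"
  proof (rule Lim_null_comparison)
    have "norm (F (real n) - F (- real n)) \<le> 2 * exp (- (pi * real n))" for n
    proof -
      have "real n \<le> (real n)\<^sup>2" by (cases n) (auto simp: power2_eq_square)
      then have le: "exp (- (pi * (real n)\<^sup>2)) \<le> exp (- (pi * real n))" by simp
      have "\<bar>F t\<bar> \<le> exp (- (pi * t\<^sup>2))" for t
        by (auto simp: F_def abs_mult intro!: mult_left_le)
      from this[of "real n"] this[of "- real n"] le show ?thesis
        unfolding real_norm_def power2_minus by linarith
    qed
    then show "\<forall>\<^sub>F n in sequentially. norm (F (real n) - F (- real n)) \<le> 2 * exp (- (pi * real n))" by simp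
    show "(\<lambda>n. 2 * exp (- (pi * real n))) \<longlonglongrightarrow> 0" by real_asymp
  qed
  ultimately have "integral\<^sup>L lborel D = 0" unfolding ftc by (rule LIMSEQ_unique)
  then have "2 * pi * x * integral\<^sup>L lborel q - 2 * pi * integral\<^sup>L lborel p = 0"
    unfolding D_def[abs_def] using p q by simp
  then have "integral\<^sup>L lborel p = x * integral\<^sup>L lborel q" by simp
  then show ?thesis unfolding qI p_def[abs_def] .
qed

lemma integral_even:
  fixes h :: "real \<Rightarrow> real"
  assumes h: "integrable lborel h" and even: "\<And>t. h (- t) = h t"
  shows "(LINT t|lborel. h t) = 2 * (LINT t|lborel. indicator {0<..} t * h t)"
proof -
  have i: "integrable lborel (\<lambda>t. indicator A t * h t)" if "A \<in> sets borel" for A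
    using integrable_mult_indicator[of A lborel h] that h by simp
  have "(LINT t|lborel. h t) = (LINT t|lborel. indicator {0<..} t * h t + indicator {..<0} t * h t)"
  proof (rule integral_cong_AE)
    show "AE t in lborel. h t = indicator {0<..} t * h t + indicator {..<0} t * h t"
      using AE_lborel_singleton[of 0] by eventually_elim (auto simp: indicator_def)
  qed (use h in measurable)
  also have "\<dots> = (LINT t|lborel. indicator {0<..} t * h t) + (LINT t|lborel. indicator {..<0} t * h t)"
    by (intro Bochner_Integration.integral_add i) auto
  also have "(LINT t|lborel. indicator {..<0} t * h t) = (LINT t|lborel. indicator {0<..} t * h t)"
    using lborel_integral_reflect[of "\<lambda>t. indicator {..<0} t * h t" 0] by (simp add: even indicator_def)
  finally show ?thesis by simp
qed

text \<open>Both sides are \<open>\<integral> a (1 - y)\<^sup>a\<^sup>-\<^sup>1 w (r y) dy\<close> with \<open>r = exp \<rho>\<close>, where \<open>w x = x exp (-\<pi> x\<^sup>2)\<close>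
  is its own sine transform.\<close>

lemma sine_kernel_gauss_convolution:
  assumes a: "a > 0"
  shows "(LINT u|lborel. sine_kernel a (exp (\<rho> - u)) * gauss_log 2 (- u)) =
    (LINT u|lborel. gauss_log 1 (\<rho> - u) * riesz a (exp (- u)))"
proof -
  define r where "r = exp \<rho>"
  \<comment> \<open>The fixed function cut to the positive half-line. Its product with the sine is
    even before the cut, so half of the integral remains, which the factor 2 of
    \<open>sine_kernel\<close> restores.\<close>
  define w where "w t = indicator {0<..} t * (t * exp (- (pi * t\<^sup>2)))" for t :: real
  have w: "integrable lborel w"
    unfolding w_def[abs_def] using integrable_mult_indicator[of "{0<..}" lborel, OF _ integrable_id_gaussian] by simp
  have [measurable]: "w \<in> borel_measurable borel" using w by auto
  let ?J = "\<lambda>y t. 2 * (jacobi a y * w t * sin (2 * pi * (r * y) * t))"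
  have inner: "2 * (LINT t|lborel. w t * sin (2 * pi * x * t)) = x * exp (- (pi * x\<^sup>2))" for x
  proof -
    have "integrable lborel (\<lambda>t. t * exp (- (pi * t\<^sup>2)) * sin (2 * pi * x * t))"
      by (rule Bochner_Integration.integrable_bound[OF integrable_id_gaussian])
         (auto simp: abs_mult intro!: mult_left_le mult_left_mono)
    from integral_even[OF this] gaussian_sine_transform[of x] show ?thesis
      by (simp add: w_def mult.assoc)
  qed
  have "(LINT u|lborel. sine_kernel a (exp (\<rho> - u)) * gauss_log 2 (- u)) = (LINT u|lborel. sine_kernel a (exp (\<rho> + u)) * gauss_log 2 u)"
    using lborel_integral_reflect[of "\<lambda>u. sine_kernel a (exp (\<rho> - u)) * gauss_log 2 (- u)" 0] by simp
  also have "\<dots> = (LINT u|lborel. sine_kernel a (r * exp u) * ((exp u)\<^sup>2 * exp (- (pi * (exp u)\<^sup>2))))"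
  proof -
    have "gauss_log 2 u = (exp u)\<^sup>2 * exp (- (pi * (exp u)\<^sup>2))" for u
      by (simp add: gauss_log_def exp_double)
    then show ?thesis by (simp add: r_def exp_add)
  qed
  also have "\<dots> = (LINT t|lborel. (indicator {0<..} t / t) *\<^sub>R (sine_kernel a (r * t) * (t\<^sup>2 * exp (- (pi * t\<^sup>2)))))"
    using a by (intro integral_exp_eq) measurable
  also have "\<dots> = (LINT t|lborel. LINT y|lborel. ?J y t)"
  proof (rule Bochner_Integration.integral_cong[OF refl])
    fix t
    have "(LINT y|lborel. ?J y t) =
        (LINT y|lborel. 2 * w t * (jacobi a y * sin (2 * pi * (r * t) * y)))"
      by (simp only: mult_ac)
    also have "\<dots> = w t * sine_kernel a (r * t)"
      unfolding integral_mult_right_zero by (simp add: sine_kernel_def)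
    finally show "(indicator {0<..} t / t) *\<^sub>R (sine_kernel a (r * t) * (t\<^sup>2 * exp (- (pi * t\<^sup>2)))) =
        (LINT y|lborel. ?J y t)"
      by (simp add: w_def power2_eq_square)
  qed
  also have "\<dots> = (LINT y|lborel. LINT t|lborel. ?J y t)"
  proof (rule lborel_pair.Fubini_integral, rule Bochner_Integration.integrable_bound)
    show "integrable (lborel \<Otimes>\<^sub>M lborel) (\<lambda>p. 2 * (case p of (y, t) \<Rightarrow> jacobi a y * w t))"
      by (intro integrable_mult_right lborel_pair.integrable_pair_mult integrable_jacobi[OF a] w)
    show "AE p in lborel \<Otimes>\<^sub>M lborel. norm (case p of (y, t) \<Rightarrow> ?J y t)
       \<le> norm (2 * (case p of (y, t) \<Rightarrow> jacobi a y * w t))"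
      by (intro AE_I2) (auto simp: abs_mult intro!: mult_left_le)
  qed measurable
  also have "\<dots> = (LINT y|lborel. jacobi a y * (2 * (LINT t|lborel. w t * sin (2 * pi * (r * y) * t))))"
  proof (rule Bochner_Integration.integral_cong[OF refl])
    fix y
    have "(LINT t|lborel. ?J y t) =
        (LINT t|lborel. (jacobi a y * 2) * (w t * sin (2 * pi * (r * y) * t)))"
      by (simp only: mult_ac)
    also have "\<dots> = jacobi a y * (2 * (LINT t|lborel. w t * sin (2 * pi * (r * y) * t)))"
      unfolding integral_mult_right_zero by (rule mult.assoc)
    finally show "(LINT t|lborel. ?J y t) = \<dots>" .
  qed
  also have "\<dots> = (LINT y|lborel. jacobi a y * (r * y * exp (- (pi * (r * y)\<^sup>2))))"
    unfolding inner ..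
  also have "\<dots> = (LINT y|lborel. (indicator {0<..} y / y) *\<^sub>R ((r * y) * exp (- (pi * (r * y)\<^sup>2)) * riesz a y))"
  proof (rule Bochner_Integration.integral_cong[OF refl])
    fix y
    show "jacobi a y * (r * y * exp (- (pi * (r * y)\<^sup>2))) = (indicator {0<..} y / y) *\<^sub>R ((r * y) * exp (- (pi * (r * y)\<^sup>2)) * riesz a y)"
    proof (cases "y > 0")
      case False
      then have "jacobi a y = 0 \<or> y = 0" by (auto simp: jacobi_def indicator_def)
      then show ?thesis using False by auto
    qed (simp add: riesz_eq_jacobi)
  qed
  also have "\<dots> = (LINT u|lborel. (r * exp u) * exp (- (pi * (r * exp u)\<^sup>2)) * riesz a (exp u))"
    by (rule integral_exp_eq[symmetric]) measurable
  also have "\<dots> = (LINT u|lborel. gauss_log 1 (\<rho> + u) * riesz a (exp u))"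
  proof -
    have "gauss_log 1 (\<rho> + u) = (r * exp u) * exp (- (pi * (r * exp u)\<^sup>2))" for u
      unfolding gauss_log_def exp_double by (simp add: r_def exp_add)
    then show ?thesis by simp
  qed
  also have "\<dots> = (LINT u|lborel. gauss_log 1 (\<rho> - u) * riesz a (exp (- u)))"
    using lborel_integral_reflect[of "\<lambda>u. gauss_log 1 (\<rho> - u) * riesz a (exp (- u))" 0] by simp
  finally show ?thesis .
qed

text \<open>The reflections u -> -u make both sides of \<open>sine_kernel_gauss_convolution\<close>
  convolutions. Reflecting a real function conjugates its transform and leaves the norm unchanged.
  The factor sqrt pi is the quotient of the two Gaussian normalisations 2 pi and 2 sqrt pi.\<close>

lemma norm_mel_sine_kernel:
  assumes a: "a > 0"
  shows "norm (mel (sine_kernel a) l) * norm (Gamma (Complex 1 (- (pi * l)))) =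
    sqrt pi * norm (mel (riesz a) l) * norm (Gamma (Complex (1 / 2) (- (pi * l))))"
proof -
  have si: "integrable lborel (\<lambda>u. complex_of_real (sine_kernel a (exp u)))"
    using integrable_sine_kernel_exp[OF a] by simp
  have ri: "integrable lborel (\<lambda>u. complex_of_real (riesz a (exp (- u))))"
    using integrable_riesz_exp[OF a] lborel_integrable_reflect[of "\<lambda>u. riesz a (exp u)" 0] by simp
  have g1: "integrable lborel (\<lambda>u. complex_of_real (gauss_log 1 u))"
    using integrable_gauss_log[of 1] by simp
  have g2: "integrable lborel (\<lambda>u. complex_of_real (gauss_log 2 (- u)))"
    using integrable_gauss_log[of 2] lborel_integrable_reflect[of "gauss_log 2" 0] by simp
  have "mel (sine_kernel a) l * ft (\<lambda>u. complex_of_real (gauss_log 2 (- u))) l =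
    ft (\<lambda>v. LINT u|lborel. complex_of_real (sine_kernel a (exp (v - u))) * complex_of_real (gauss_log 2 (- u))) l"
    unfolding mel_def by (rule ft_convolution[OF si g2, symmetric])
  also have "(\<lambda>v. LINT u|lborel. complex_of_real (sine_kernel a (exp (v - u))) * complex_of_real (gauss_log 2 (- u))) =
    (\<lambda>v. LINT u|lborel. complex_of_real (gauss_log 1 (v - u)) * complex_of_real (riesz a (exp (- u))))"
    unfolding of_real_mult[symmetric] integral_complex_of_real sine_kernel_gauss_convolution[OF a] ..
  also have "ft \<dots> l = ft (\<lambda>u. complex_of_real (gauss_log 1 u)) l * ft (\<lambda>u. complex_of_real (riesz a (exp (- u)))) l"
    by (rule ft_convolution[OF g1 ri])
  finally have eq: "mel (sine_kernel a) l * ft (\<lambda>u. complex_of_real (gauss_log 2 (- u))) l =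
    ft (\<lambda>u. complex_of_real (gauss_log 1 u)) l * ft (\<lambda>u. complex_of_real (riesz a (exp (- u)))) l" .
  have n1: "norm (ft (\<lambda>u. complex_of_real (gauss_log 2 (- u))) l) = norm (Gamma (Complex 1 (- (pi * l)))) / (2 * pi)"
    using norm_ft_gauss_log[of 2 l] norm_ft_real_minus[of "gauss_log 2" l] ft_reflect[of "\<lambda>u. complex_of_real (gauss_log 2 u)" l]
    by simp
  have n2: "norm (ft (\<lambda>u. complex_of_real (riesz a (exp (- u)))) l) = norm (mel (riesz a) l)"
    using norm_ft_real_minus[of "\<lambda>u. riesz a (exp u)" l] ft_reflect[of "\<lambda>u. complex_of_real (riesz a (exp u))" l]
    by (simp add: mel_def)
  have n3: "norm (ft (\<lambda>u. complex_of_real (gauss_log 1 u)) l) = norm (Gamma (Complex (1 / 2) (- (pi * l)))) / (2 * sqrt pi)"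
    using norm_ft_gauss_log[of 1 l] by (simp add: powr_half_sqrt)
  have "norm (mel (sine_kernel a) l) * (norm (Gamma (Complex 1 (- (pi * l)))) / (2 * pi)) =
    norm (Gamma (Complex (1 / 2) (- (pi * l)))) / (2 * sqrt pi) * norm (mel (riesz a) l)"
    using arg_cong[OF eq, of norm] unfolding norm_mult n1 n2 n3 .
  then have "norm (mel (sine_kernel a) l) * norm (Gamma (Complex 1 (- (pi * l)))) =
    pi / sqrt pi * norm (mel (riesz a) l) * norm (Gamma (Complex (1 / 2) (- (pi * l))))"
    by (simp add: field_simps)
  also have "pi / sqrt pi = sqrt pi" by (simp add: real_div_sqrt)
  finally show ?thesis .
qed

text \<open>After elimination of the Riesz kernel of order \<open>a\<close>, the ratio of the two
  squares is a constant times |Gamma(z2 + 1/2) / Gamma(z2)|^2 |Gamma(z1) / Gamma(z1 + 1/2)|^2. The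
  first quotient is comparable with |z2|, the second with 1 / |z1|, and |z2| / |z1| stays between
  positive bounds.\<close>

lemma mel_sine_kernel_comparison:
  assumes a: "a > 0"
  shows "\<exists>A B. 0 < A \<and> 0 < B \<and> (\<forall>l.
    A * (norm (mel (riesz (1 / 2 + a)) l))\<^sup>2 \<le> (norm (mel (sine_kernel a) l))\<^sup>2 \<and>
    (norm (mel (sine_kernel a) l))\<^sup>2 \<le> B * (norm (mel (riesz (1 / 2 + a)) l))\<^sup>2)"
proof -
  define c where "c = (Gamma (1 + a))\<^sup>2"
  define c' where "c' = (Gamma (1 + (1 / 2 + a)))\<^sup>2"
  have c: "c > 0" "c' > 0"
    unfolding c_def c'_def using a by (intro zero_less_power Gamma_real_pos; simp)+
  define K where "K = pi * c / c'"
  have K: "K > 0" using c by (simp add: K_def)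
  \<comment> \<open>The lower constant is (n2 / 2)(1 / (2 n1)) with n2 >= 2 n1. The upper one is (2
    n2)(2 / n1) with n2 <= 2 (1 + a) n1.\<close>
  have "K / 2 * (norm (mel (riesz (1 / 2 + a)) l))\<^sup>2 \<le> (norm (mel (sine_kernel a) l))\<^sup>2 \<and>
    (norm (mel (sine_kernel a) l))\<^sup>2 \<le> K * (8 * (1 + a)) * (norm (mel (riesz (1 / 2 + a)) l))\<^sup>2" for l
  proof -
    define z1 z2 where "z1 = Complex (1 / 2) (- (pi * l))" and "z2 = Complex (1 + a) (- (2 * pi * l))"
    define g1 g1' g2 g2' T where "g1 = (norm (Gamma z1))\<^sup>2" and "g1' = (norm (Gamma (z1 + 1 / 2)))\<^sup>2"
      and "g2 = (norm (Gamma z2))\<^sup>2" and "g2' = (norm (Gamma (z2 + 1 / 2)))\<^sup>2"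
      and "T = (norm (Gamma (Complex 1 (- (2 * pi * l)))))\<^sup>2"
    define S R R' where "S = (norm (mel (sine_kernel a) l))\<^sup>2" and "R = (norm (mel (riesz a) l))\<^sup>2"
      and "R' = (norm (mel (riesz (1 / 2 + a)) l))\<^sup>2"
    define n1 n2 where "n1 = norm z1" and "n2 = norm z2"
    have nz: "Gamma z \<noteq> 0" if "Re z > 0" for z :: complex
      using that by (auto simp: Gamma_eq_zero_iff elim!: nonpos_Ints_cases')
    have pos: "g1 > 0" "g1' > 0" "g2 > 0" "g2' > 0"
      unfolding g1_def g1'_def g2_def g2'_def using a by (auto simp: z1_def z2_def intro!: nz)
    have zs: "z1 + 1 / 2 = Complex 1 (- (pi * l))" "z2 + 1 / 2 = Complex (1 + (1 / 2 + a)) (- (2 * pi * l))"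
      by (simp_all add: z1_def z2_def complex_eq_iff)
    have SR: "S * g1' = pi * R * g1"
      using arg_cong[OF norm_mel_sine_kernel[OF a, of l], of "\<lambda>x. x\<^sup>2"]
      unfolding S_def R_def g1_def g1'_def zs z1_def[symmetric] by (simp add: power_mult_distrib)
    have RT: "R * g2 = c * T"
      using arg_cong[OF mel_riesz[OF a, of l], of "\<lambda>x. (norm x)\<^sup>2"]
      unfolding R_def g2_def T_def c_def z2_def[symmetric] by (simp add: norm_mult power_mult_distrib)
    have RT': "R' * g2' = c' * T"
      using arg_cong[OF mel_riesz[of "1 / 2 + a" l], of "\<lambda>x. (norm x)\<^sup>2"] a
      unfolding R'_def g2'_def T_def c'_def zs by (simp add: norm_mult power_mult_distrib)
    \<comment> \<open>\<open>T\<close> occurs in the identities of both Riesz kernels, so it cancels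
      in the ratio.\<close>
    define x y where "x = g2' / g2" and "y = g1 / g1'"
    have "T = R' * g2' / c'" using RT' c by (simp add: field_simps)
    moreover have "R = c * T / g2" using RT pos by (simp add: field_simps)
    moreover have "S = pi * R * g1 / g1'" using SR pos by (simp add: field_simps)
    ultimately have S: "S = K * (x * y) * R'" unfolding K_def x_def y_def by (simp add: mult_ac)
    have n1: "n1 > 0" by (auto simp: n1_def z1_def complex_eq_iff)
    have "g2' \<le> 2 * n2 * g2" "n2 * g2 \<le> 2 * g2'" "n1 * g1 \<le> 2 * g1'" "g1' \<le> 2 * n1 * g1"
      unfolding g1_def g1'_def g2_def g2'_def n1_def n2_def
      using a by (auto intro!: Gamma_half_step_bounds simp: z1_def z2_def)
    then have xy: "x \<le> 2 * n2" "n2 / 2 \<le> x" "y \<le> 2 / n1" "1 / (2 * n1) \<le> y"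
      using pos n1 by (auto simp: x_def y_def field_simps)
    \<comment> \<open>The imaginary part of z2 is twice that of z1, so only the real parts 1 + a and
      1/2 enter the bounds.\<close>
    have n2: "2 * n1 \<le> n2" "n2 \<le> 2 * (1 + a) * n1"
    proof -
      have s1: "n1\<^sup>2 = 1 / 4 + (pi * l)\<^sup>2" and s2: "n2\<^sup>2 = (1 + a)\<^sup>2 + 4 * (pi * l)\<^sup>2"
        by (simp_all add: n1_def n2_def z1_def z2_def cmod_power2 power_mult_distrib power_divide)
      have a1: "1 \<le> (1 + a)\<^sup>2" using a by (intro one_le_power) simp
      have "(2 * n1)\<^sup>2 \<le> n2\<^sup>2" using a1 by (simp add: power_mult_distrib s1 s2)
      then show "2 * n1 \<le> n2" by (rule power2_le_imp_le) (simp add: n2_def)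
      have "4 * (pi * l)\<^sup>2 * 1 \<le> 4 * (pi * l)\<^sup>2 * (1 + a)\<^sup>2" using a1 by (intro mult_left_mono) auto
      moreover have "(2 * (1 + a) * n1)\<^sup>2 = 4 * (1 + a)\<^sup>2 * n1\<^sup>2" by (simp only: power_mult_distrib) simp
      ultimately have "n2\<^sup>2 \<le> (2 * (1 + a) * n1)\<^sup>2" unfolding s1 s2 by (simp add: distrib_left mult.commute)
      then show "n2 \<le> 2 * (1 + a) * n1" by (rule power2_le_imp_le) (use a n1 in simp)
    qed
    have "x * y \<le> (2 * n2) * (2 / n1)"
      using xy pos n1 n2 by (intro mult_mono) (auto simp: y_def x_def)
    also have "\<dots> \<le> 8 * (1 + a)" using n2 n1 by (simp add: field_simps)
    finally have up: "x * y \<le> 8 * (1 + a)" .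
    have "1 / 2 \<le> (n2 / 2) * (1 / (2 * n1))" using n2 n1 by (simp add: field_simps)
    also have "\<dots> \<le> x * y" using xy pos n1 n2 by (intro mult_mono) (auto simp: y_def x_def)
    finally have low: "1 / 2 \<le> x * y" .
    have R': "0 \<le> R'" by (simp add: R'_def)
    have "K * (1 / 2) * R' \<le> S" "S \<le> K * (8 * (1 + a)) * R'"
      unfolding S using low up K R' by (intro mult_right_mono mult_left_mono; simp)+
    then show ?thesis by (simp add: S_def R'_def)
  qed
  then show ?thesis
    using K a by (intro exI[of _ "K / 2"] exI[of _ "K * (8 * (1 + a))"]) auto
qed

section \<open>The two operators on the Fourier side\<close>

text \<open>The weight 1 / (t_1 ... t_n) is distributed as the square of the factors 1 / sqrt t_i.
  Only the norm of \<open>F\<close> is prescribed, so a unimodular constant in front of the integral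
  is harmless.\<close>

lemma square_function_kernel:
  fixes E :: "real^'n::finite \<Rightarrow> complex" and K :: "'n \<Rightarrow> real \<Rightarrow> real \<Rightarrow> real"
  assumes E: "integrable lborel E"
    and K: "\<And>i. mellin_kernel (\<lambda>t b. if 0 < t then K i t b / sqrt t else 0) (Q i) (C i)"
    and F: "\<And>t. t \<in> positive_orthant \<Longrightarrow>
      norm (F t) = norm (LINT \<xi>|lborel. E \<xi> * of_real (\<Prod>i\<in>UNIV. K i (t $ i) (\<xi> $ i)))"
  shows "square_function F = ennreal (sqrt (LINT l|lborel. (\<Prod>i\<in>UNIV. Q i (l $ i)) * (norm (multi_mellin E l))\<^sup>2))"
proof -
  define N where "N i t b = (if 0 < t then K i t b / sqrt t else 0)" for i t b
  have N: "mellin_kernel (N i) (Q i) (C i)" for i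
    unfolding N_def by (rule K)
  define F' where "F' t = (LINT \<xi>|lborel. E \<xi> * of_real (\<Prod>i\<in>UNIV. N i (t $ i) (\<xi> $ i)))" for t
  have eq: "ennreal ((norm (F t))\<^sup>2 / (\<Prod>i\<in>UNIV. t $ i)) * indicator positive_orthant t = ennreal ((norm (F' t))\<^sup>2)" for t
  proof (cases "t \<in> positive_orthant")
    case True
    then have t: "0 < t $ i" for i by (simp add: positive_orthant_def)
    have "(\<Prod>i\<in>UNIV. N i (t $ i) (\<xi> $ i)) = (\<Prod>i\<in>UNIV. K i (t $ i) (\<xi> $ i)) / (\<Prod>i\<in>UNIV. sqrt (t $ i))" for \<xi>
      unfolding prod_dividef[symmetric] by (intro prod.cong refl) (simp add: N_def t)
    then have "F' t = (LINT \<xi>|lborel. E \<xi> * of_real (\<Prod>i\<in>UNIV. K i (t $ i) (\<xi> $ i)) / of_real (\<Prod>i\<in>UNIV. sqrt (t $ i)))"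
      unfolding F'_def by (simp only: of_real_divide times_divide_eq_right)
    also have "\<dots> = (LINT \<xi>|lborel. E \<xi> * of_real (\<Prod>i\<in>UNIV. K i (t $ i) (\<xi> $ i))) / of_real (\<Prod>i\<in>UNIV. sqrt (t $ i))"
      by (rule integral_divide_zero)
    finally have "norm (F' t) = norm (F t) / \<bar>\<Prod>i\<in>UNIV. sqrt (t $ i)\<bar>"
      unfolding F[OF True] by (simp only: norm_divide norm_of_real)
    moreover have "(\<Prod>i\<in>UNIV. sqrt (t $ i))\<^sup>2 = (\<Prod>i\<in>UNIV. t $ i)"
      unfolding prod_power_distrib using less_imp_le[OF t] by simp
    ultimately show ?thesis using True by (simp add: power_divide)
  next
    case False
    \<comment> \<open>Outside the orthant one factor vanishes, which turns the integral over the
      orthant into one over the whole space.\<close>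
    then obtain j where "\<not> 0 < t $ j" by (auto simp: positive_orthant_def)
    then have "(\<Prod>i\<in>UNIV. N i (t $ i) (\<xi> $ i)) = 0" for \<xi>
      by (intro prod_zero) (auto simp: N_def intro!: bexI[of _ j])
    then have "F' t = 0" unfolding F'_def by (simp only: of_real_0 mult_zero_right Bochner_Integration.integral_zero)
    then show ?thesis using False by simp
  qed
  have int: "integrable lborel (\<lambda>t. (norm (F' t))\<^sup>2)"
    unfolding F'_def by (rule mellin_kernel_integrable[OF E N])
  have val: "(LINT t|lborel. (norm (F' t))\<^sup>2) = (LINT l|lborel. (\<Prod>i\<in>UNIV. Q i (l $ i)) * (norm (multi_mellin E l))\<^sup>2)"
    unfolding F'_def by (rule mellin_kernel_identity[OF E N])
  have "(\<integral>\<^sup>+t\<in>positive_orthant. ennreal ((norm (F t))\<^sup>2 / (\<Prod>i\<in>UNIV. t $ i)) \<partial>lborel) = (\<integral>\<^sup>+t. ennreal ((norm (F' t))\<^sup>2) \<partial>lborel)"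
    by (simp only: eq)
  also have "\<dots> = ennreal (LINT t|lborel. (norm (F' t))\<^sup>2)"
    by (rule nn_integral_eq_integral[OF int]) simp
  finally show ?thesis
    unfolding square_function_def ennsqrt_def val[symmetric] by simp
qed

lemma ft_phi_dil:
  assumes a: "a > 0" and s: "s > 0"
  shows "(LINT y|lborel. complex_of_real (phi_dil a s y) * cis (- (2 * pi * (y * \<xi>)))) = - \<i> * of_real (sine_kernel a (s * \<xi>))"
proof -
  have "(LINT y|lborel. complex_of_real (phi_dil a s y) * cis (- (2 * pi * (y * \<xi>)))) =
    \<bar>s\<bar> *\<^sub>R (LINT y|lborel. complex_of_real (phi_dil a s (0 + s * y)) * cis (- (2 * pi * ((0 + s * y) * \<xi>))))"
    using s by (intro lborel_integral_real_affine) simp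
  also have "\<dots> = (LINT y|lborel. of_real s * (complex_of_real (phi_dil a s (0 + s * y)) * cis (- (2 * pi * ((0 + s * y) * \<xi>)))))"
    using s by (simp add: scaleR_conv_of_real)
  also have "\<dots> = ft (\<lambda>y. complex_of_real (phi a y)) (s * \<xi>)"
    unfolding ft_def using s by (intro Bochner_Integration.integral_cong refl) (simp add: phi_dil_def mult_ac)
  also have "\<dots> = - \<i> * of_real (sine_kernel a (s * \<xi>))" by (rule ft_phi[OF a])
  finally show ?thesis .
qed

lemma integrable_phi_dil:
  assumes a: "a > 0" and s: "s > 0" shows "integrable lborel (phi_dil a s)"
  unfolding phi_dil_def[abs_def]
  using lborel_integrable_real_affine[OF integrable_phi[OF a], of "1 / s" 0] s by simp

text \<open>Fourier inversion is inserted for f(x - y), and Fubini then leaves the transform of the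
  tensor kernel. Each odd factor \<open>phi\<close> contributes one -i.\<close>

lemma S_op_eq:
  fixes f :: "real^'n::finite \<Rightarrow> complex" and \<alpha> :: "real^'n"
  assumes f: "f \<in> schwartz_space" and \<alpha>: "\<And>i. 0 < \<alpha> $ i" and t: "t \<in> positive_orthant"
  shows "S_op \<alpha> t f x = (- \<i>) ^ CARD('n) * (LINT \<xi>|lborel. ft f \<xi> * cis (2 * pi * (x \<bullet> \<xi>)) *
    of_real (\<Prod>i\<in>UNIV. sine_kernel (\<alpha> $ i) (t $ i * \<xi> $ i)))"
proof -
  have t: "0 < t $ i" for i using t by (simp add: positive_orthant_def)
  obtain B where B: "\<And>x. norm (f x) \<le> B" using schwartz_bounded[OF f] by blast
  have fi: "integrable lborel f" by (rule schwartz_integrable[OF f])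
  have Fi: "integrable lborel (ft f)" by (rule schwartz_ft_integrable[OF f])
  define E where "E \<xi> = ft f \<xi> * cis (2 * pi * (x \<bullet> \<xi>))" for \<xi>
  have Ei: "integrable lborel E" unfolding E_def by (intro integrable_mult_cis Fi) measurable
  define P where "P y = complex_of_real (Phi \<alpha> t y)" for y
  have Pi: "integrable lborel P"
    unfolding P_def Phi_def by (intro integrable_of_real integrable_lborel_prod_vec integrable_phi_dil \<alpha> t)
  have inv: "f (x - y) * P y = (LINT \<xi>|lborel. E \<xi> * P y * cis (- (2 * pi * (y \<bullet> \<xi>))))" for y
  proof -
    have "f (x - y) = (LINT \<xi>|lborel. ft f \<xi> * cis (2 * pi * ((x - y) \<bullet> \<xi>)))"
      by (rule ft_inversion[OF fi B schwartz_isCont[OF f] Fi])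
    then have "f (x - y) * P y = (LINT \<xi>|lborel. ft f \<xi> * cis (2 * pi * ((x - y) \<bullet> \<xi>)) * P y)"
      by simp
    also have "\<dots> = (LINT \<xi>|lborel. E \<xi> * P y * cis (- (2 * pi * (y \<bullet> \<xi>))))"
    proof (rule Bochner_Integration.integral_cong[OF refl])
      fix \<xi>
      have "cis (2 * pi * ((x - y) \<bullet> \<xi>)) = cis (2 * pi * (x \<bullet> \<xi>)) * cis (- (2 * pi * (y \<bullet> \<xi>)))"
        by (simp add: cis_mult inner_diff_left algebra_simps)
      then show "ft f \<xi> * cis (2 * pi * ((x - y) \<bullet> \<xi>)) * P y = E \<xi> * P y * cis (- (2 * pi * (y \<bullet> \<xi>)))"
        by (simp add: E_def mult_ac)
    qed
    finally show ?thesis .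
  qed
  have "S_op \<alpha> t f x = (LINT y|lborel. LINT \<xi>|lborel. E \<xi> * P y * cis (- (2 * pi * (y \<bullet> \<xi>))))"
    unfolding S_op_def P_def[symmetric] inv ..
  also have "\<dots> = (LINT \<xi>|lborel. LINT y|lborel. E \<xi> * P y * cis (- (2 * pi * (y \<bullet> \<xi>))))"
    by (intro lborel_pair.Fubini_integral lborel_pair.integrable_pair_mult_cis Ei Pi) measurable
  also have "\<dots> = (LINT \<xi>|lborel. (- \<i>) ^ CARD('n) * (E \<xi> * of_real (\<Prod>i\<in>UNIV. sine_kernel (\<alpha> $ i) (t $ i * \<xi> $ i))))"
  proof (rule Bochner_Integration.integral_cong[OF refl])
    fix \<xi> :: "real^'n"
    have "(LINT y|lborel. E \<xi> * P y * cis (- (2 * pi * (y \<bullet> \<xi>)))) = E \<xi> * (LINT y|lborel. P y * cis (- (2 * pi * (y \<bullet> \<xi>))))"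
      unfolding mult.assoc by (rule integral_mult_right_zero)
    also have "(LINT y|lborel. P y * cis (- (2 * pi * (y \<bullet> \<xi>)))) =
      (LINT y::real^'n|lborel. (\<Prod>i\<in>UNIV. complex_of_real (phi_dil (\<alpha> $ i) (t $ i) (y $ i)) * cis (- (2 * pi * (y $ i * \<xi> $ i)))))"
      by (simp add: P_def Phi_def prod.distrib inner_vec_def sum_distrib_left cis_sum[symmetric] sum_negf)
    also have "\<dots> = (\<Prod>i\<in>UNIV. LINT y|lborel. complex_of_real (phi_dil (\<alpha> $ i) (t $ i) y) * cis (- (2 * pi * (y * \<xi> $ i))))"
      by (intro integral_lborel_prod_vec integrable_mult_cis integrable_of_real integrable_phi_dil \<alpha> t) measurable
    also have "\<dots> = (\<Prod>i\<in>UNIV. - \<i> * of_real (sine_kernel (\<alpha> $ i) (t $ i * \<xi> $ i)))"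
      unfolding ft_phi_dil[OF \<alpha> t] ..
    also have "\<dots> = (- \<i>) ^ CARD('n) * of_real (\<Prod>i\<in>UNIV. sine_kernel (\<alpha> $ i) (t $ i * \<xi> $ i))"
      by (simp only: prod.distrib prod_constant of_real_prod)
    finally show "(LINT y|lborel. E \<xi> * P y * cis (- (2 * pi * (y \<bullet> \<xi>)))) =
      (- \<i>) ^ CARD('n) * (E \<xi> * of_real (\<Prod>i\<in>UNIV. sine_kernel (\<alpha> $ i) (t $ i * \<xi> $ i)))"
      by (simp only: mult.left_commute)
  qed
  finally show ?thesis unfolding E_def integral_mult_right_zero .
qed

text \<open>Here the factors -i come from the Hilbert multiplier, while its signs turn the even
  multiplier of \<open>tau\<close> into the odd one. The transform is known only almost everywhere,
  which the integral does not notice.\<close>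

lemma tau_eq:
  fixes f :: "real^'n::finite \<Rightarrow> complex" and \<beta> :: "real^'n"
  assumes f: "f \<in> schwartz_space" and R: "R \<in> positive_orthant"
  shows "tau \<beta> R (hilbert_tensor f) x = (- \<i>) ^ CARD('n) * (LINT \<xi>|lborel. ft f \<xi> * cis (2 * pi * (x \<bullet> \<xi>)) *
    of_real (\<Prod>i\<in>UNIV. riesz (\<beta> $ i) (\<xi> $ i / R $ i)))"
proof -
  have R: "0 < R $ i" for i using R by (simp add: positive_orthant_def)
  have [measurable]: "fourier_L2 (hilbert_tensor f) \<in> borel_measurable borel"
    by (rule fourier_L2_hilbert_tensor_measurable[OF f])
  have [measurable]: "ft f \<in> borel_measurable borel"
    using schwartz_integrable[OF f] by measurable
  let ?m = "\<lambda>\<xi>. complex_of_real (\<Prod>i\<in>UNIV. \<beta> $ i * (\<bar>\<xi> $ i\<bar> / R $ i) * (1 - \<bar>\<xi> $ i\<bar> / R $ i) powr (\<beta> $ i - 1))"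
  let ?A = "{\<xi>. \<forall>i. - (R $ i) \<le> \<xi> $ i \<and> \<xi> $ i \<le> R $ i}"
  have A [measurable]: "?A \<in> sets borel" by measurable
  have prod: "indicator ?A \<xi> * (\<Prod>i\<in>UNIV. \<beta> $ i * (\<bar>\<xi> $ i\<bar> / R $ i) * (1 - \<bar>\<xi> $ i\<bar> / R $ i) powr (\<beta> $ i - 1)) * (\<Prod>i\<in>UNIV. sgn (\<xi> $ i)) =
     (\<Prod>i\<in>UNIV. riesz (\<beta> $ i) (\<xi> $ i / R $ i))" for \<xi>
  proof (cases "\<xi> \<in> ?A")
    case True
    have "\<beta> $ i * (\<bar>\<xi> $ i\<bar> / R $ i) * (1 - \<bar>\<xi> $ i\<bar> / R $ i) powr (\<beta> $ i - 1) * sgn (\<xi> $ i) = riesz (\<beta> $ i) (\<xi> $ i / R $ i)" for i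
    proof -
      have "- R $ i \<le> \<xi> $ i" "\<xi> $ i \<le> R $ i" using True by auto
      then have "\<xi> $ i / R $ i \<in> {-1..1}" using R[of i] by (simp add: field_simps)
      moreover have "\<bar>\<xi> $ i\<bar> * sgn (\<xi> $ i) = \<xi> $ i" by (simp add: sgn_if abs_if)
      ultimately show ?thesis
        using R[of i] by (simp add: riesz_def mult_ac)
    qed
    then show ?thesis using True by (simp add: prod.distrib[symmetric])
  next
    case False
    then obtain j where "\<not> (- R $ j \<le> \<xi> $ j \<and> \<xi> $ j \<le> R $ j)" by auto
    then have "\<xi> $ j / R $ j \<notin> {-1..1}" using R[of j] by (auto simp: field_simps)
    then have "riesz (\<beta> $ j) (\<xi> $ j / R $ j) = 0" by (simp add: riesz_def)
    then have "(\<Prod>i\<in>UNIV. riesz (\<beta> $ i) (\<xi> $ i / R $ i)) = 0" by (intro prod_zero) auto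
    then show ?thesis using False by simp
  qed
  have "tau \<beta> R (hilbert_tensor f) x = (LINT \<xi>|lborel. indicator ?A \<xi> *\<^sub>R (?m \<xi> * fourier_L2 (hilbert_tensor f) \<xi> * cis (2 * pi * (x \<bullet> \<xi>))))"
    unfolding tau_def set_lebesgue_integral_def ..
  also have "\<dots> = (LINT \<xi>|lborel. (- \<i>) ^ CARD('n) * (ft f \<xi> * cis (2 * pi * (x \<bullet> \<xi>)) *
    of_real (\<Prod>i\<in>UNIV. riesz (\<beta> $ i) (\<xi> $ i / R $ i))))"
  proof (rule integral_cong_AE)
    show "AE \<xi> in lborel. indicator ?A \<xi> *\<^sub>R (?m \<xi> * fourier_L2 (hilbert_tensor f) \<xi> * cis (2 * pi * (x \<bullet> \<xi>))) =
      (- \<i>) ^ CARD('n) * (ft f \<xi> * cis (2 * pi * (x \<bullet> \<xi>)) * of_real (\<Prod>i\<in>UNIV. riesz (\<beta> $ i) (\<xi> $ i / R $ i)))"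
      using fourier_L2_hilbert_tensor[OF f]
    proof eventually_elim
      case (elim \<xi>)
      have "hilbert_mult f \<xi> = (- \<i>) ^ CARD('n) * of_real (\<Prod>i\<in>UNIV. sgn (\<xi> $ i)) * ft f \<xi>"
        by (simp only: hilbert_mult_def fourier_eq_ft prod.distrib prod_constant of_real_prod)
      then show ?case
        unfolding elim prod[symmetric] by (simp add: scaleR_conv_of_real mult_ac del: of_real_prod)
    qed
  qed measurable
  finally show ?thesis unfolding integral_mult_right_zero .
qed

theorem theorem2:
  fixes \<alpha> \<beta> :: "real^'n::finite"
  assumes "\<And>i. 0 < \<alpha> $ i"
    and "\<beta> = (\<chi> i. 1/2) + \<alpha>"
  shows "\<exists>A B. 0 < A \<and> 0 < B \<and>
    (\<forall>f\<in>schwartz_space. \<forall>x::real^'n.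
       ennreal A * mu_func \<alpha> f x \<le> h_func \<beta> (hilbert_tensor f) x \<and>
       h_func \<beta> (hilbert_tensor f) x \<le> ennreal B * mu_func \<alpha> f x)"
proof -
  note \<alpha> = assms(1)
  have \<beta>: "\<beta> $ i = 1 / 2 + \<alpha> $ i" for i using assms(2) by simp
  define QS where "QS i l = (norm (mel (sine_kernel (\<alpha> $ i)) l))\<^sup>2" for i l
  define QR where "QR i l = (norm (mel (riesz (\<beta> $ i)) l))\<^sup>2" for i l
  have "\<forall>i. \<exists>A B. 0 < A \<and> 0 < B \<and> (\<forall>l. A * QR i l \<le> QS i l \<and> QS i l \<le> B * QR i l)"
    unfolding QS_def QR_def \<beta> using mel_sine_kernel_comparison[OF \<alpha>] by blast
  then obtain a b where ab: "0 < a i" "0 < b i" "a i * QR i l \<le> QS i l" "QS i l \<le> b i * QR i l" for i l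
    by metis
  \<comment> \<open>The one-variable bounds multiply, because both weights are products of
    nonnegative factors.\<close>
  define A where "A = (\<Prod>i\<in>UNIV. a i)"
  define B where "B = (\<Prod>i\<in>UNIV. b i)"
  have A: "0 < A" and B: "0 < B" unfolding A_def B_def using ab by (auto intro: prod_pos)
  have Q_nonneg: "0 \<le> QR i l" "0 \<le> QS i l" for i l by (simp_all add: QR_def QS_def)
  have KS: "mellin_kernel (\<lambda>t b. if 0 < t then sine_kernel (\<alpha> $ i) (t * b) / sqrt t else 0) (QS i)
      (LINT u|lborel. (sine_kernel (\<alpha> $ i) (exp u))\<^sup>2)" for i
    unfolding QS_def
    by (intro mellin_kernel_mult sine_kernel_measurable sine_kernel_odd integrable_sine_kernel_exp
        integrable_sine_kernel_exp_square isCont_autocorr_sine_kernel \<alpha>)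
  have \<beta>_pos: "0 < \<beta> $ i" "1 / 2 < \<beta> $ i" for i using \<alpha>[of i] by (simp_all add: \<beta>)
  have KR: "mellin_kernel (\<lambda>t b. if 0 < t then riesz (\<beta> $ i) (b / t) / sqrt t else 0) (QR i)
      (LINT u|lborel. (riesz (\<beta> $ i) (exp u))\<^sup>2)" for i
    unfolding QR_def
    by (intro mellin_kernel_divide riesz_measurable riesz_odd integrable_riesz_exp
        integrable_riesz_exp_square isCont_autocorr_riesz \<beta>_pos)
  \<comment> \<open>\<open>A\<close> and \<open>B\<close> bound the square of \<open>mu_func\<close>
    by that of \<open>h_func\<close>; the claim goes the other way, hence reciprocals, with square
    roots and the roles of \<open>A\<close> and \<open>B\<close> exchanged.\<close>
  have main: "ennreal (1 / sqrt B) * mu_func \<alpha> f x \<le> h_func \<beta> (hilbert_tensor f) x \<and>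
       h_func \<beta> (hilbert_tensor f) x \<le> ennreal (1 / sqrt A) * mu_func \<alpha> f x"
    if f: "f \<in> schwartz_space" for f :: "real^'n \<Rightarrow> complex" and x
  proof -
    define E where "E \<xi> = ft f \<xi> * cis (2 * pi * (x \<bullet> \<xi>))" for \<xi>
    have E: "integrable lborel E"
      unfolding E_def by (intro integrable_mult_cis schwartz_ft_integrable f) measurable
    define M where "M l = (norm (multi_mellin E l))\<^sup>2" for l
    have M: "0 \<le> M l" for l by (simp add: M_def)
    let ?R = "\<lambda>l. \<Prod>i\<in>UNIV. QR i (l $ i)" and ?S = "\<lambda>l. \<Prod>i\<in>UNIV. QS i (l $ i)"
    define IS where "IS = (LINT l|lborel. ?S l * M l)"
    define IR where "IR = (LINT l|lborel. ?R l * M l)"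
    have unit: "norm ((- \<i>) ^ CARD('n)) = 1" by (simp add: norm_power)
    have mu: "mu_func \<alpha> f x = ennreal (sqrt IS)"
      unfolding mu_func_def IS_def M_def
      by (rule square_function_kernel[OF E KS]) (simp only: S_op_eq[OF f \<alpha>] E_def norm_mult unit mult_1_left)
    have h: "h_func \<beta> (hilbert_tensor f) x = ennreal (sqrt IR)"
      unfolding h_func_def IR_def M_def
      by (rule square_function_kernel[OF E KR]) (simp only: tau_eq[OF f] E_def norm_mult unit mult_1_left)
    have Mm: "M \<in> borel_measurable borel"
    proof -
      have "multi_mellin E \<in> borel_measurable (borel :: (real^'n) measure)"
        unfolding multi_mellin_def[abs_def]
      proof (rule lborel.borel_measurable_lebesgue_integral)
        have [measurable]: "E \<in> borel_measurable borel" using E by auto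
        show "(\<lambda>(l, \<xi>). E \<xi> * of_real (\<Prod>i\<in>UNIV. sgn (\<xi> $ i)) * cis (\<Sum>i\<in>UNIV. 2 * pi * l $ i * ln \<bar>\<xi> $ i\<bar>))
          \<in> borel_measurable (borel \<Otimes>\<^sub>M lborel)" by measurable
      qed
      then show ?thesis unfolding M_def by measurable
    qed
    have Mb: "M l \<le> (LINT \<xi>|lborel. norm (E \<xi>))\<^sup>2" for l
    proof -
      have "norm (multi_mellin E l) \<le> (LINT \<xi>|lborel. norm (E \<xi>))"
        unfolding multi_mellin_def
        by (intro order_trans[OF integral_norm_bound] integral_mono' norm_mult_sgn_cis_le) (use E in auto)
      then show ?thesis unfolding M_def by (intro power_mono) auto
    qed
    \<comment> \<open>The comparison of \<open>IS\<close> and \<open>IR\<close> needs integrability,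
      since a divergent Bochner integral would count as 0. It holds because \<open>M\<close> is
      bounded by the squared L^1 norm of \<open>E\<close>.\<close>
    have int: "integrable lborel (\<lambda>l::real^'n. (\<Prod>i\<in>UNIV. Q i (l $ i)) * M l)"
      if "\<And>i. integrable lborel (Q i)" for Q :: "'n \<Rightarrow> real \<Rightarrow> real"
    proof (rule Bochner_Integration.integrable_bound)
      have Qi: "integrable lborel (\<lambda>l::real^'n. \<Prod>i\<in>UNIV. Q i (l $ i))"
        by (intro integrable_lborel_prod_vec that)
      then show "integrable lborel (\<lambda>l::real^'n. (\<Prod>i\<in>UNIV. Q i (l $ i)) * (LINT \<xi>|lborel. norm (E \<xi>))\<^sup>2)"
        by (rule integrable_mult_left)
      show "(\<lambda>l::real^'n. (\<Prod>i\<in>UNIV. Q i (l $ i)) * M l) \<in> borel_measurable lborel"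
        using Qi Mm by (intro borel_measurable_times) auto
      show "AE l in lborel. norm ((\<Prod>i\<in>UNIV. Q i (l $ i)) * M l) \<le> norm ((\<Prod>i\<in>UNIV. Q i (l $ i)) * (LINT \<xi>|lborel. norm (E \<xi>))\<^sup>2)"
        using Mb M by (auto simp: abs_mult intro!: AE_I2 mult_left_mono)
    qed
    have intS: "integrable lborel (\<lambda>l::real^'n. ?S l * M l)"
      and intR: "integrable lborel (\<lambda>l::real^'n. ?R l * M l)"
      by (intro int mellin_kernel.Q_integrable[OF KS] mellin_kernel.Q_integrable[OF KR])+
    have "A * IR = (LINT l|lborel. A * (?R l * M l))" unfolding IR_def by simp
    also have "\<dots> \<le> IS"
      unfolding IS_def
    proof (rule integral_mono[OF integrable_mult_right[OF intR] intS])
      fix l :: "real^'n"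
      have "A * ?R l = (\<Prod>i\<in>UNIV. a i * QR i (l $ i))" by (simp add: A_def prod.distrib)
      also have "\<dots> \<le> ?S l"
        using ab less_imp_le[OF ab(1)] Q_nonneg by (intro prod_mono) auto
      finally show "A * (?R l * M l) \<le> ?S l * M l"
        unfolding mult.assoc[symmetric] by (rule mult_right_mono[OF _ M])
    qed
    finally have le1: "A * IR \<le> IS" .
    have "IS \<le> (LINT l|lborel. B * (?R l * M l))"
      unfolding IS_def
    proof (rule integral_mono[OF intS integrable_mult_right[OF intR]])
      fix l :: "real^'n"
      have "?S l \<le> (\<Prod>i\<in>UNIV. b i * QR i (l $ i))"
        using ab Q_nonneg by (intro prod_mono) auto
      also have "\<dots> = B * ?R l" by (simp add: B_def prod.distrib)
      finally show "?S l * M l \<le> B * (?R l * M l)"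
        unfolding mult.assoc[symmetric] by (rule mult_right_mono[OF _ M])
    qed
    also have "\<dots> = B * IR" unfolding IR_def by simp
    finally have le2: "IS \<le> B * IR" .
    have "1 / sqrt B * sqrt IS \<le> sqrt IR"
      using real_sqrt_le_mono[OF le2] B by (simp add: real_sqrt_mult field_simps)
    moreover have "sqrt IR \<le> 1 / sqrt A * sqrt IS"
      using real_sqrt_le_mono[OF le1] A by (simp add: real_sqrt_mult field_simps)
    ultimately show ?thesis
      unfolding mu h using A B by (simp add: ennreal_mult'[symmetric] ennreal_leI del: times_divide_eq_left)
  qed
  show ?thesis
    by (rule exI[of _ "1 / sqrt B"], rule exI[of _ "1 / sqrt A"]) (use A B main in auto)
qed

end
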